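(* Let $\mathcal{H}_K$ be an analytic Hilbert space over $\mathbb{B}^n$ and let $\mathcal{E}_*$ be a Hilbert space. Let $\mathcal{S}$ be a non-trivial closed subspace of $\mathcal{H}_K \otimes \mathcal{E}_*$. Then $\mathcal{S}$ is a joint $(M_{z_1} \otimes I_{\mathcal{E}_*}, \ldots, M_{z_n} \otimes I_{\mathcal{E}_*})$-invariant subspace of $\mathcal{H}_K \otimes \mathcal{E}_*$ if and only if there exist a Hilbert space $\mathcal{E}$ and a partially isometric multiplier $\Theta \in \mathcal{M}(H^2_n \otimes \mathcal{E}, \mathcal{H}_K \otimes \mathcal{E}_* )$ such that \[\mathcal{S} = \Theta H^2_n(\mathcal{E}),\] or equivalently, \[P_{\mathcal{S}} = M_\Theta M_\Theta^*.\]
   Context: All Hilbert spaces are separable and over $\mathbb{C}$; $n \ge 1$; $\mathbb{B}^n$ is the open unit ball of $\mathbb{C}^n$; $P_{\mathcal{S}}$ is the orthogonal projection onto the closed subspace $\mathcal{S}$. A closed subspace is non-trivial if it is neither $\{0\}$ nor the whole space. Co-spherically contractive and pure tuples: a commuting $n$-tuple $T=(T_1,\ldots,T_n)$ of bounded operators on a Hilbert space $\mathcal{H}$ is co-spherically contractive if $\sum_{i=1}^n T_iT_i^* \le I_{\mathcal{H}}$. It is pure if moreover $P_\infty(T) := \lim_{m\to\infty} P_T^m(I_{\mathcal{H}}) = 0$ in the strong operator topology, where $P_T(X) = \sum_{i=1}^n T_i X T_i^*$ for $X \in \mathcal{B}(\mathcal{H})$. Analytic Hilbert space: let $K : \mathbb{B}^n\times\mathbb{B}^n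 \to \mathbb{C}$ be a positive definite kernel, holomorphic in the first variable and anti-holomorphic in the second, and let $\mathcal{H}_K$ be its reproducing kernel Hilbert space (of holomorphic functions on $\mathbb{B}^n$). $\mathcal{H}_K$ is an analytic Hilbert space over $\mathbb{B}^n$ if (i) the multiplication operators $(M_{z_i}f)(w) = w_i f(w)$, $i=1,\ldots,n$, are bounded operators on $\mathcal{H}_K$, and (ii) $(M_{z_1},\ldots,M_{z_n})$ is a pure co-spherically contractive tuple on $\mathcal{H}_K$. The Drury-Arveson space $H^2_n$ is the reproducing kernel Hilbert space on $\mathbb{B}^n$ with kernel $(1 - \sum_{i=1}^n z_i\bar{w}_i)^{-1}$ (it is an analytic Hilbert space), and $H^2_n(\mathcal{E}) = H^2_n\otimes\mathcal{E}$. For a Hilbert space $\mathcal{E}$, elements of $\mathcal{H}_K\otimes\mathcal{E}$ are identified with $\mathcal{E}$-valued functions on $\mathbb{B}^n$ via $(f\otimes\eta)(w) = f(w)\eta$. Multipliers: for analytic Hilbert spaces $\mathcal{H}_{K_1},\mathcal{H}_{K_2}$ and Hilbert spaces $\mathcal{E}_1,\mathcal{E}_2$, a map $\Theta:\mathbb{B}^n\to\mathcal{B}(\mathcal{E}_1,\mathcal{E}_2)$ is a multiplier, written $\Theta\in\mathcal{M}(\mathcal{H}_{K_1}\otimes\mathcal{E}_1,\mathcal{H}_{K_2}\otimes\mathcal{E}_2)$, if $\Theta f \in \mathcal{H}_{K_2}\otimes\mathcal{E}_2$ for all $f\in\mathcal{H}_{K_1}\otimes\mathcal{E}_1$, where $(\Theta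 f)(w) = \Theta(w)f(w)$. The operator $M_\Theta f = \Theta f$ is then bounded. The multiplier is partially isometric if $M_\Theta$ is a partial isometry. $\Theta H^2_n(\mathcal{E})$ denotes the range of $M_\Theta$. *)

theory Defs
  imports "HOL-Analysis.Analysis" "HOL-Library.Function_Algebras"
begin

section \<open>Complex Hilbert spaces\<close>

class complex_vector = ab_group_add +
  fixes scaleC :: "complex \<Rightarrow> 'a \<Rightarrow> 'a"  (infixr "*\<^sub>C" 75)
  assumes scaleC_add_right: "a *\<^sub>C (x + y) = a *\<^sub>C x + a *\<^sub>C y"
    and scaleC_add_left: "(a + b) *\<^sub>C x = a *\<^sub>C x + b *\<^sub>C x"
    and scaleC_scaleC: "a *\<^sub>C b *\<^sub>C x = (a * b) *\<^sub>C x"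
    and scaleC_one: "1 *\<^sub>C x = x"

instantiation complex :: complex_vector
begin
definition scaleC_complex :: "complex \<Rightarrow> complex \<Rightarrow> complex"
  where "scaleC_complex a x = a * x"
instance
  by standard (simp_all add: scaleC_complex_def algebra_simps)
end

instantiation "fun" :: (type, complex_vector) complex_vector
begin
definition scaleC_fun :: "complex \<Rightarrow> ('a \<Rightarrow> 'b) \<Rightarrow> 'a \<Rightarrow> 'b"
  where "scaleC_fun a f = (\<lambda>x. a *\<^sub>C f x)"
instance
  by standard
    (simp_all add: scaleC_fun_def fun_eq_iff scaleC_add_right scaleC_add_left scaleC_scaleC scaleC_one)
end

definition csubspace :: "'a::complex_vector set \<Rightarrow> bool" where
  "csubspace V \<longleftrightarrow> 0 \<in> V \<and> (\<forall>x\<in>V. \<forall>y\<in>V. x + y \<in> V) \<and> (\<forall>c. \<forall>x\<in>V. c *\<^sub>C x \<in> V)"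

text \<open>A Hilbert space is a linear subspace \<open>vecs H\<close> of an ambient complex vector space, with an
  inner product of its own, linear in the first argument. The values of \<open>ip H\<close>, and of operators,
  outside \<open>vecs H\<close> carry no meaning. Since HOL cannot quantify over types, the existence of a
  Hilbert space is stated over the ambient space \<open>nat \<Rightarrow> complex\<close>: every separable Hilbert space is
  isometrically isomorphic to one carried by a subspace of it, via \<open>x \<mapsto> (\<langle>x, d\<^sub>k\<rangle>)\<^sub>k\<close> for a dense
  sequence \<open>d\<close>.\<close>

record 'a hspace =
  vecs :: "'a set"
  ip :: "'a \<Rightarrow> 'a \<Rightarrow> complex"

definition hnorm :: "'a hspace \<Rightarrow> 'a \<Rightarrow> real" where
  "hnorm H x = sqrt (Re (ip H x x))"

definition hconv :: "'a::complex_vector hspace \<Rightarrow> (nat \<Rightarrow> 'a) \<Rightarrow> 'a \<Rightarrow> bool" where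
  "hconv H X x \<longleftrightarrow> (\<lambda>k. hnorm H (X k - x)) \<longlonglongrightarrow> 0"

definition inner_product_on :: "'a::complex_vector set \<Rightarrow> ('a \<Rightarrow> 'a \<Rightarrow> complex) \<Rightarrow> bool" where
  "inner_product_on V p \<longleftrightarrow>
     (\<forall>x\<in>V. \<forall>y\<in>V. \<forall>z\<in>V. p (x + y) z = p x z + p y z) \<and>
     (\<forall>c. \<forall>x\<in>V. \<forall>y\<in>V. p (c *\<^sub>C x) y = c * p x y) \<and>
     (\<forall>x\<in>V. \<forall>y\<in>V. p y x = cnj (p x y)) \<and>
     (\<forall>x\<in>V. 0 \<le> Re (p x x)) \<and>
     (\<forall>x\<in>V. p x x = 0 \<longrightarrow> x = 0)"

definition hcomplete :: "'a::complex_vector hspace \<Rightarrow> bool" where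
  "hcomplete H \<longleftrightarrow>
     (\<forall>X. (\<forall>k. X k \<in> vecs H) \<and>
          (\<forall>e>0. \<exists>N::nat. \<forall>j\<ge>N. \<forall>k\<ge>N. hnorm H (X j - X k) < e)
          \<longrightarrow> (\<exists>x\<in>vecs H. hconv H X x))"

definition hseparable :: "'a::complex_vector hspace \<Rightarrow> bool" where
  "hseparable H \<longleftrightarrow>
     (\<exists>D. countable D \<and> D \<subseteq> vecs H \<and> (\<forall>x\<in>vecs H. \<forall>e>0. \<exists>d\<in>D. hnorm H (x - d) < e))"

definition hilbert_space :: "'a::complex_vector hspace \<Rightarrow> bool" where
  "hilbert_space H \<longleftrightarrow>
     csubspace (vecs H) \<and> inner_product_on (vecs H) (ip H) \<and> hcomplete H \<and> hseparable H"

definition closed_csubspace :: "'a::complex_vector hspace \<Rightarrow> 'a set \<Rightarrow> bool" where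
  "closed_csubspace H S \<longleftrightarrow>
     csubspace S \<and> S \<subseteq> vecs H \<and>
     (\<forall>X x. (\<forall>k. X k \<in> S) \<and> x \<in> vecs H \<and> hconv H X x \<longrightarrow> x \<in> S)"

definition nontrivial_closed_csubspace :: "'a::complex_vector hspace \<Rightarrow> 'a set \<Rightarrow> bool" where
  "nontrivial_closed_csubspace H S \<longleftrightarrow> closed_csubspace H S \<and> S \<noteq> {0} \<and> S \<noteq> vecs H"

section \<open>Operators\<close>

definition bounded_op ::
  "'a::complex_vector hspace \<Rightarrow> 'b::complex_vector hspace \<Rightarrow> ('a \<Rightarrow> 'b) \<Rightarrow> bool" where
  "bounded_op H1 H2 A \<longleftrightarrow>
     (\<forall>x\<in>vecs H1. A x \<in> vecs H2) \<and>
     (\<forall>x\<in>vecs H1. \<forall>y\<in>vecs H1. A (x + y) = A x + A y) \<and>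
     (\<forall>c. \<forall>x\<in>vecs H1. A (c *\<^sub>C x) = c *\<^sub>C A x) \<and>
     (\<exists>C. \<forall>x\<in>vecs H1. hnorm H2 (A x) \<le> C * hnorm H1 x)"

definition hadj :: "'a hspace \<Rightarrow> 'b hspace \<Rightarrow> ('a \<Rightarrow> 'b) \<Rightarrow> 'b \<Rightarrow> 'a" where
  "hadj H1 H2 A y = (THE x. x \<in> vecs H1 \<and> (\<forall>u\<in>vecs H1. ip H2 (A u) y = ip H1 u x))"

definition hproj :: "'a::complex_vector hspace \<Rightarrow> 'a set \<Rightarrow> 'a \<Rightarrow> 'a" where
  "hproj H S x = (THE y. y \<in> S \<and> (\<forall>s\<in>S. ip H (x - y) s = 0))"

definition op_le :: "'a::complex_vector hspace \<Rightarrow> ('a \<Rightarrow> 'a) \<Rightarrow> ('a \<Rightarrow> 'a) \<Rightarrow> bool" where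
  "op_le H A B \<longleftrightarrow>
     (\<forall>x\<in>vecs H. Im (ip H (B x - A x) x) = 0 \<and> 0 \<le> Re (ip H (B x - A x) x))"

definition partial_isometry ::
  "'a::complex_vector hspace \<Rightarrow> 'b::complex_vector hspace \<Rightarrow> ('a \<Rightarrow> 'b) \<Rightarrow> bool" where
  "partial_isometry H1 H2 A \<longleftrightarrow>
     bounded_op H1 H2 A \<and>
     (\<forall>x\<in>vecs H1. (\<forall>u\<in>vecs H1. A u = 0 \<longrightarrow> ip H1 x u = 0) \<longrightarrow> hnorm H2 (A x) = hnorm H1 x)"

definition commuting_tuple :: "'a::complex_vector hspace \<Rightarrow> ('n \<Rightarrow> 'a \<Rightarrow> 'a) \<Rightarrow> bool" where
  "commuting_tuple H T \<longleftrightarrow>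
     (\<forall>i. bounded_op H H (T i)) \<and> (\<forall>i j. \<forall>x\<in>vecs H. T i (T j x) = T j (T i x))"

definition tuple_map ::
  "'a::complex_vector hspace \<Rightarrow> ('n::finite \<Rightarrow> 'a \<Rightarrow> 'a) \<Rightarrow> ('a \<Rightarrow> 'a) \<Rightarrow> 'a \<Rightarrow> 'a" where
  "tuple_map H T X = (\<lambda>x. \<Sum>i\<in>UNIV. T i (X (hadj H H (T i) x)))"

definition cospherically_contractive ::
  "'a::complex_vector hspace \<Rightarrow> ('n::finite \<Rightarrow> 'a \<Rightarrow> 'a) \<Rightarrow> bool" where
  "cospherically_contractive H T \<longleftrightarrow>
     commuting_tuple H T \<and> op_le H (\<lambda>x. \<Sum>i\<in>UNIV. T i (hadj H H (T i) x)) (\<lambda>x. x)"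

definition pure_cospherically_contractive ::
  "'a::complex_vector hspace \<Rightarrow> ('n::finite \<Rightarrow> 'a \<Rightarrow> 'a) \<Rightarrow> bool" where
  "pure_cospherically_contractive H T \<longleftrightarrow>
     cospherically_contractive H T \<and>
     (\<forall>x\<in>vecs H. hconv H (\<lambda>m. ((tuple_map H T ^^ m) (\<lambda>y. y)) x) 0)"

section \<open>Reproducing kernel Hilbert spaces on the unit ball\<close>

text \<open>Functions on the unit ball are total functions that vanish off the ball, so that the pointwise
  vector space structure of the function type is that of functions on the ball.\<close>

abbreviation unit_ball :: "(complex ^ 'n::finite) set" where
  "unit_ball \<equiv> ball 0 1"

definition holomorphic_ball :: "(complex ^ 'n::finite \<Rightarrow> complex) \<Rightarrow> bool" where
  "holomorphic_ball f \<longleftrightarrow>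
     (\<forall>z\<in>unit_ball. \<exists>D. (f has_derivative D) (at z) \<and> (\<forall>c v. D (c *s v) = c * D v))"

text \<open>As is usual for reproducing kernels, positive definite means positive semidefinite Gram
  matrices.\<close>

definition positive_definite_kernel ::
  "(complex ^ 'n::finite \<Rightarrow> complex ^ 'n \<Rightarrow> complex) \<Rightarrow> bool" where
  "positive_definite_kernel K \<longleftrightarrow>
     (\<forall>A c. finite A \<and> A \<subseteq> unit_ball \<longrightarrow>
        Im (\<Sum>z\<in>A. \<Sum>w\<in>A. cnj (c z) * c w * K z w) = 0 \<and>
        0 \<le> Re (\<Sum>z\<in>A. \<Sum>w\<in>A. cnj (c z) * c w * K z w))"

definition kernel_fun ::
  "(complex ^ 'n::finite \<Rightarrow> complex ^ 'n \<Rightarrow> complex) \<Rightarrow> complex ^ 'n \<Rightarrow> complex ^ 'n \<Rightarrow> complex" where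
  "kernel_fun K w = (\<lambda>z. if z \<in> unit_ball then K z w else 0)"

definition is_rkhs ::
  "(complex ^ 'n::finite \<Rightarrow> complex ^ 'n \<Rightarrow> complex) \<Rightarrow> (complex ^ 'n \<Rightarrow> complex) hspace \<Rightarrow> bool" where
  "is_rkhs K H \<longleftrightarrow>
     hilbert_space H \<and>
     (\<forall>f\<in>vecs H. \<forall>w. w \<notin> unit_ball \<longrightarrow> f w = 0) \<and>
     (\<forall>w\<in>unit_ball. kernel_fun K w \<in> vecs H) \<and>
     (\<forall>f\<in>vecs H. \<forall>w\<in>unit_ball. ip H f (kernel_fun K w) = f w)"

text \<open>The operator \<open>M\<^sub>z\<^sub>i\<close>, and, on vector-valued functions, \<open>M\<^sub>z\<^sub>i \<otimes> I\<close>.\<close>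

definition mult_coord ::
  "'n::finite \<Rightarrow> (complex ^ 'n \<Rightarrow> 'a::complex_vector) \<Rightarrow> complex ^ 'n \<Rightarrow> 'a" where
  "mult_coord i F = (\<lambda>w. (w $ i) *\<^sub>C F w)"

definition analytic_hilbert_space ::
  "(complex ^ 'n::finite \<Rightarrow> complex ^ 'n \<Rightarrow> complex) \<Rightarrow> (complex ^ 'n \<Rightarrow> complex) hspace \<Rightarrow> bool" where
  "analytic_hilbert_space K H \<longleftrightarrow>
     positive_definite_kernel K \<and>
     (\<forall>w\<in>unit_ball. holomorphic_ball (\<lambda>z. K z w)) \<and>
     (\<forall>z\<in>unit_ball. holomorphic_ball (\<lambda>w. cnj (K z w))) \<and>
     is_rkhs K H \<and>
     (\<forall>i::'n. bounded_op H H (mult_coord i)) \<and>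
     pure_cospherically_contractive H (mult_coord :: 'n \<Rightarrow> _)"

definition elementary_tensor ::
  "(complex ^ 'n::finite \<Rightarrow> complex) \<Rightarrow> 'a::complex_vector \<Rightarrow> complex ^ 'n \<Rightarrow> 'a" where
  "elementary_tensor f \<eta> = (\<lambda>w. f w *\<^sub>C \<eta>)"

text \<open>\<open>is_tensor H E F\<close>: \<open>F\<close> is the Hilbert space tensor product of \<open>H\<close> and \<open>E\<close>, realized as
  \<open>E\<close>-valued functions on the ball. The first four clauses after \<open>hilbert_space F\<close> make \<open>F\<close> a
  completion of the algebraic tensor product; boundedness of the evaluations forces the function
  attached to a limit of elementary tensors to be the pointwise limit.\<close>

definition is_tensor ::
  "(complex ^ 'n::finite \<Rightarrow> complex) hspace \<Rightarrow> 'a::complex_vector hspace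
    \<Rightarrow> (complex ^ 'n \<Rightarrow> 'a) hspace \<Rightarrow> bool" where
  "is_tensor H E F \<longleftrightarrow>
     hilbert_space F \<and>
     (\<forall>G\<in>vecs F. \<forall>w. w \<notin> unit_ball \<longrightarrow> G w = 0) \<and>
     (\<forall>f\<in>vecs H. \<forall>\<eta>\<in>vecs E. elementary_tensor f \<eta> \<in> vecs F) \<and>
     (\<forall>f\<in>vecs H. \<forall>g\<in>vecs H. \<forall>\<eta>\<in>vecs E. \<forall>\<zeta>\<in>vecs E.
        ip F (elementary_tensor f \<eta>) (elementary_tensor g \<zeta>) = ip H f g * ip E \<eta> \<zeta>) \<and>
     (\<forall>G\<in>vecs F. \<forall>e>0. \<exists>(m::nat) f \<eta>.
        (\<forall>j<m. f j \<in> vecs H \<and> \<eta> j \<in> vecs E) \<and>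
        hnorm F (G - (\<Sum>j<m. elementary_tensor (f j) (\<eta> j))) < e) \<and>
     (\<forall>w\<in>unit_ball. bounded_op F E (\<lambda>G. G w))"

definition drury_arveson_kernel :: "complex ^ 'n::finite \<Rightarrow> complex ^ 'n \<Rightarrow> complex" where
  "drury_arveson_kernel z w = inverse (1 - (\<Sum>i\<in>UNIV. z $ i * cnj (w $ i)))"

definition is_drury_arveson ::
  "'a::complex_vector hspace \<Rightarrow> (complex ^ 'n::finite \<Rightarrow> 'a) hspace \<Rightarrow> bool" where
  "is_drury_arveson E F \<longleftrightarrow> (\<exists>D. is_rkhs drury_arveson_kernel D \<and> is_tensor D E F)"

section \<open>Multipliers and invariant subspaces\<close>

definition mult_op ::
  "(complex ^ 'n::finite \<Rightarrow> 'a \<Rightarrow> 'b::complex_vector)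
    \<Rightarrow> (complex ^ 'n \<Rightarrow> 'a) \<Rightarrow> complex ^ 'n \<Rightarrow> 'b" where
  "mult_op \<Theta> F = (\<lambda>w. if w \<in> unit_ball then \<Theta> w (F w) else 0)"

text \<open>\<open>F1\<close> and \<open>F2\<close> are spaces of functions on the ball with values in \<open>E1\<close> and \<open>E2\<close>.\<close>

definition multiplier ::
  "'a::complex_vector hspace \<Rightarrow> (complex ^ 'n::finite \<Rightarrow> 'a) hspace
    \<Rightarrow> 'b::complex_vector hspace \<Rightarrow> (complex ^ 'n \<Rightarrow> 'b) hspace
    \<Rightarrow> (complex ^ 'n \<Rightarrow> 'a \<Rightarrow> 'b) \<Rightarrow> bool" where
  "multiplier E1 F1 E2 F2 \<Theta> \<longleftrightarrow>
     (\<forall>w\<in>unit_ball. bounded_op E1 E2 (\<Theta> w)) \<and> (\<forall>f\<in>vecs F1. mult_op \<Theta> f \<in> vecs F2)"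

definition partially_isometric_multiplier ::
  "'a::complex_vector hspace \<Rightarrow> (complex ^ 'n::finite \<Rightarrow> 'a) hspace
    \<Rightarrow> 'b::complex_vector hspace \<Rightarrow> (complex ^ 'n \<Rightarrow> 'b) hspace
    \<Rightarrow> (complex ^ 'n \<Rightarrow> 'a \<Rightarrow> 'b) \<Rightarrow> bool" where
  "partially_isometric_multiplier E1 F1 E2 F2 \<Theta> \<longleftrightarrow>
     multiplier E1 F1 E2 F2 \<Theta> \<and> partial_isometry F1 F2 (mult_op \<Theta>)"

definition joint_invariant :: "(complex ^ 'n::finite \<Rightarrow> 'a::complex_vector) set \<Rightarrow> bool" where
  "joint_invariant S \<longleftrightarrow> (\<forall>i::'n. \<forall>F\<in>S. mult_coord i F \<in> S)"

end

theory Submission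
  imports Defs
begin

text \<open>Let \<open>S\<close> be invariant and let \<open>s\<^bsub>w,b\<^esub> = P\<^sub>S (K\<^sub>w \<otimes> b)\<close>; these vectors span a dense subspace of \<open>S\<close>. With
  \<open>T\<^sub>i\<close> the restriction of \<open>M\<^sub>z\<^sub>i \<otimes> I\<close> to \<open>S\<close>, the form \<open>q(x, y) = \<langle>x, y\<rangle> - \<Sum>\<^sub>i \<langle>T\<^sub>i\<^sup>*x, T\<^sub>i\<^sup>*y\<rangle>\<close> is positive,
  and \<open>T\<^sub>i\<^sup>* s\<^bsub>w,b\<^esub> = cnj w\<^sub>i s\<^bsub>w,b\<^esub>\<close> gives \<open>q(s\<^bsub>w,a\<^esub>, s\<^bsub>z,b\<^esub>) = (1 - \<langle>z, w\<rangle>) \<langle>s\<^bsub>w,a\<^esub>, s\<^bsub>z,b\<^esub>\<rangle>\<close>. Factor \<open>q(x, y) = \<langle>e x, e y\<rangle>\<close>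
  through \<open>\<ell>\<^sup>2\<close>. Then \<open>s\<^bsub>w,b\<^esub> \<mapsto> k\<^sub>w \<otimes> e s\<^bsub>w,b\<^esub>\<close>, where \<open>k\<close> is the Drury-Arveson kernel, extends to an isometry from
  \<open>S\<close> into \<open>H\<^sup>2\<^sub>n \<otimes> \<ell>\<^sup>2\<close>, whose adjoint is the operator of multiplication by \<open>\<Theta>(w) = (b \<mapsto> e s\<^bsub>w,b\<^esub>)\<^sup>*\<close>.\<close>

section \<open>Hilbert spaces on a carrier set\<close>

text \<open>The Drury-Arveson kernel k is the reciprocal of 1 - <z, w>. Multiplying q on the vectors
  s by k therefore gives back their inner products, and this is why the map to H2 tensor l2 is
  isometric. Positivity of q says that the column of adjoints of a row contraction is again a
  contraction. The restrictions to S form a row contraction because the coordinates do so on the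
  full space. There the property is positivity of the kernel (1 - <z, w>) K(z, w), which passes from
  scalar to vector values by a Schur product argument.

  Two obstacles shape the rest. Different combinations of the s can give the same vector, so the
  isometry is not defined on their span: functionals on formal combinations are represented instead,
  and the isometry and its adjoint appear only through the images of single vectors. Moreover the
  multiplier needs a concrete source space over a fixed type. The factor e comes from a Cholesky
  expansion along a dense sequence, so its values are scalar sequences, and the Drury-Arveson space
  and its tensor product with l2 are constructed.\<close>

global_interpretation cvs: vector_space "scaleC :: complex \<Rightarrow> 'a::complex_vector \<Rightarrow> 'a"
  by unfold_locales (simp_all add: scaleC_add_right scaleC_add_left scaleC_scaleC scaleC_one)

lemma csubspace_iff: "csubspace V \<longleftrightarrow> cvs.subspace V"
  by (simp add: csubspace_def cvs.subspace_def)

text \<open>Definiteness is split off because the defect form on S and the residuals of the Cholesky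
  expansion are only semidefinite, yet the Cauchy-Schwarz inequality is applied to them.\<close>

locale semi_hspace =
  fixes H :: "'a::complex_vector hspace"
  assumes subspace: "cvs.subspace (vecs H)"
    and ip_add_left: "\<lbrakk>x \<in> vecs H; y \<in> vecs H; z \<in> vecs H\<rbrakk> \<Longrightarrow> ip H (x + y) z = ip H x z + ip H y z"
    and ip_scale_left: "\<lbrakk>x \<in> vecs H; y \<in> vecs H\<rbrakk> \<Longrightarrow> ip H (c *\<^sub>C x) y = c * ip H x y"
    and ip_commute: "\<lbrakk>x \<in> vecs H; y \<in> vecs H\<rbrakk> \<Longrightarrow> ip H y x = cnj (ip H x y)"
    and ip_self_nonneg: "x \<in> vecs H \<Longrightarrow> 0 \<le> Re (ip H x x)"
begin

lemma zero_in [simp]: "0 \<in> vecs H"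
  using subspace by (rule cvs.subspace_0)

lemma add_in [simp]: "x \<in> vecs H \<Longrightarrow> y \<in> vecs H \<Longrightarrow> x + y \<in> vecs H"
  using subspace by (rule cvs.subspace_add)

lemma diff_in [simp]: "x \<in> vecs H \<Longrightarrow> y \<in> vecs H \<Longrightarrow> x - y \<in> vecs H"
  using subspace by (rule cvs.subspace_diff)

lemma scale_in [simp]: "x \<in> vecs H \<Longrightarrow> c *\<^sub>C x \<in> vecs H"
  using subspace by (rule cvs.subspace_scale)

lemma sum_in [simp]: "(\<And>i. i \<in> A \<Longrightarrow> f i \<in> vecs H) \<Longrightarrow> sum f A \<in> vecs H"
  using subspace by (rule cvs.subspace_sum)

lemma ip_add_right:
  "\<lbrakk>x \<in> vecs H; y \<in> vecs H; z \<in> vecs H\<rbrakk> \<Longrightarrow> ip H z (x + y) = ip H z x + ip H z y"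
  by (metis add_in complex_cnj_add ip_add_left ip_commute)

lemma ip_scale_right:
  "\<lbrakk>x \<in> vecs H; y \<in> vecs H\<rbrakk> \<Longrightarrow> ip H x (c *\<^sub>C y) = cnj c * ip H x y"
  by (metis scale_in complex_cnj_mult ip_scale_left ip_commute)

lemma ip_diff_left:
  "\<lbrakk>x \<in> vecs H; y \<in> vecs H; z \<in> vecs H\<rbrakk> \<Longrightarrow> ip H (x - y) z = ip H x z - ip H y z"
  by (metis diff_in diff_add_cancel eq_diff_eq ip_add_left)

lemma ip_diff_right:
  "\<lbrakk>x \<in> vecs H; y \<in> vecs H; z \<in> vecs H\<rbrakk> \<Longrightarrow> ip H z (x - y) = ip H z x - ip H z y"
  by (metis diff_in diff_add_cancel eq_diff_eq ip_add_right)

lemma ip_zero_left [simp]: "x \<in> vecs H \<Longrightarrow> ip H 0 x = 0"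
  by (metis zero_in diff_self ip_diff_left)

lemma ip_zero_right [simp]: "x \<in> vecs H \<Longrightarrow> ip H x 0 = 0"
  by (metis zero_in diff_self ip_diff_right)

lemma ip_sum_left:
  "\<lbrakk>\<And>i. i \<in> A \<Longrightarrow> f i \<in> vecs H; y \<in> vecs H\<rbrakk> \<Longrightarrow> ip H (sum f A) y = (\<Sum>i\<in>A. ip H (f i) y)"
  by (induction A rule: infinite_finite_induct) (simp_all add: ip_add_left)

lemma ip_sum_right:
  "\<lbrakk>\<And>i. i \<in> A \<Longrightarrow> f i \<in> vecs H; y \<in> vecs H\<rbrakk> \<Longrightarrow> ip H y (sum f A) = (\<Sum>i\<in>A. ip H y (f i))"
  by (induction A rule: infinite_finite_induct) (simp_all add: ip_add_right)

lemmas ip_simps = ip_add_left ip_add_right ip_scale_left ip_scale_right ip_diff_left ip_diff_right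

lemma hnorm_nonneg [simp]: "x \<in> vecs H \<Longrightarrow> 0 \<le> hnorm H x"
  by (simp add: hnorm_def ip_self_nonneg)

lemma ip_self: "x \<in> vecs H \<Longrightarrow> ip H x x = complex_of_real ((hnorm H x)\<^sup>2)"
  using arg_cong[OF ip_commute[of x x], of Im] ip_self_nonneg[of x]
  by (simp add: hnorm_def complex_eq_iff)

lemma hnorm_sq: "x \<in> vecs H \<Longrightarrow> (hnorm H x)\<^sup>2 = Re (ip H x x)"
  by (simp add: ip_self)

lemma hnorm_0 [simp]: "hnorm H 0 = 0"
  by (simp add: hnorm_def)

lemma hnorm_scale:
  assumes "x \<in> vecs H"
  shows "hnorm H (c *\<^sub>C x) = cmod c * hnorm H x"
proof (rule power2_eq_imp_eq)
  have "ip H (c *\<^sub>C x) (c *\<^sub>C x) = (c * cnj c) * ip H x x"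
    using assms by (simp add: ip_scale_left ip_scale_right)
  also have "\<dots> = of_real ((cmod c * hnorm H x)\<^sup>2)"
    using assms by (simp add: ip_self power_mult_distrib flip: complex_norm_square)
  finally have "Re (ip H (c *\<^sub>C x) (c *\<^sub>C x)) = (cmod c * hnorm H x)\<^sup>2"
    by (simp only: Re_complex_of_real)
  then show "(hnorm H (c *\<^sub>C x))\<^sup>2 = (cmod c * hnorm H x)\<^sup>2"
    using assms by (simp only: hnorm_sq scale_in)
qed (use assms in simp_all)

lemma hnorm_minus_commute: "x \<in> vecs H \<Longrightarrow> y \<in> vecs H \<Longrightarrow> hnorm H (x - y) = hnorm H (y - x)"
  using hnorm_scale[of "y - x" "-1"] by simp

lemma hnorm_add_sq:
  assumes "x \<in> vecs H" "y \<in> vecs H"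
  shows "(hnorm H (x + y))\<^sup>2 = (hnorm H x)\<^sup>2 + 2 * Re (ip H x y) + (hnorm H y)\<^sup>2"
  using assms ip_commute[of x y] by (simp add: hnorm_sq ip_simps)

lemma hnorm_diff_sq:
  assumes "x \<in> vecs H" "y \<in> vecs H"
  shows "(hnorm H (x - y))\<^sup>2 = (hnorm H x)\<^sup>2 - 2 * Re (ip H x y) + (hnorm H y)\<^sup>2"
  using assms ip_commute[of x y] by (simp add: hnorm_sq ip_simps)

lemma cauchy_schwarz:
  assumes [simp]: "x \<in> vecs H" "y \<in> vecs H"
  shows "cmod (ip H x y) \<le> hnorm H x * hnorm H y"
proof -
  define P X Y where "P = (cmod (ip H x y))\<^sup>2" and "X = (hnorm H x)\<^sup>2" and "Y = (hnorm H y)\<^sup>2"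
  \<comment> \<open>Expansion of the squared seminorm of x - s <x, y> y.\<close>
  have quad: "0 \<le> X - 2 * s * P + s\<^sup>2 * (P * Y)" for s :: real
  proof -
    have "Re (ip H x ((s * ip H x y) *\<^sub>C y)) = s * P"
      unfolding P_def cmod_power2 by (simp add: ip_simps power2_eq_square algebra_simps)
    moreover have "(hnorm H ((s * ip H x y) *\<^sub>C y))\<^sup>2 = s\<^sup>2 * (P * Y)"
      by (simp add: hnorm_scale P_def Y_def power_mult_distrib norm_mult)
    ultimately show ?thesis
      using hnorm_diff_sq[of x "(s * ip H x y) *\<^sub>C y"] zero_le_power2[of "hnorm H (x - (s * ip H x y) *\<^sub>C y)"]
      by (simp add: X_def)
  qed
  have "P \<ge> 0" "Y \<ge> 0" "X \<ge> 0" by (simp_all add: P_def Y_def X_def)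
  have "P \<le> X * Y"
  proof (cases "P = 0")
    case False
    with \<open>P \<ge> 0\<close> have "P > 0" by simp
    show ?thesis
    proof (cases "Y = 0")
      case True
      \<comment> \<open>A null vector y leaves a function linear in s; at this s it takes the value
        -1, so P cannot be positive.\<close>
      with quad[of "(X + 1) / (2 * P)"] \<open>P > 0\<close> show ?thesis by simp
    next
      case False
      with \<open>Y \<ge> 0\<close> have "Y > 0" by simp
      with quad[of "1 / Y"] show ?thesis
        by (simp add: power2_eq_square field_simps)
    qed
  qed (simp add: \<open>Y \<ge> 0\<close> \<open>X \<ge> 0\<close>)
  then have "(cmod (ip H x y))\<^sup>2 \<le> (hnorm H x * hnorm H y)\<^sup>2"
    by (simp add: P_def X_def Y_def power_mult_distrib)
  then show ?thesis
    by (rule power2_le_imp_le) simp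
qed

lemma hnorm_triangle:
  assumes [simp]: "x \<in> vecs H" "y \<in> vecs H"
  shows "hnorm H (x + y) \<le> hnorm H x + hnorm H y"
proof (rule power2_le_imp_le)
  have "Re (ip H x y) \<le> hnorm H x * hnorm H y"
    using cauchy_schwarz[of x y] complex_Re_le_cmod[of "ip H x y"] by simp
  then show "(hnorm H (x + y))\<^sup>2 \<le> (hnorm H x + hnorm H y)\<^sup>2"
    by (simp add: hnorm_add_sq power2_sum)
qed simp

lemma hnorm_triangle_via:
  assumes "x \<in> vecs H" "y \<in> vecs H" "z \<in> vecs H"
  shows "hnorm H (x - z) \<le> hnorm H (x - y) + hnorm H (y - z)"
  using hnorm_triangle[of "x - y" "y - z"] assms by simp

lemma hnorm_triangle_diff:
  assumes "x \<in> vecs H" "y \<in> vecs H"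
  shows "\<bar>hnorm H x - hnorm H y\<bar> \<le> hnorm H (x - y)"
  using hnorm_triangle[of "x - y" y] hnorm_triangle[of "y - x" x] hnorm_minus_commute[of x y] assms
  by simp

lemma tendsto_hnorm:
  assumes "hconv H X x" "\<And>n. X n \<in> vecs H" "x \<in> vecs H"
  shows "(\<lambda>n. hnorm H (X n)) \<longlonglongrightarrow> hnorm H x"
proof (rule LIM_zero_cancel, rule Lim_null_comparison)
  show "\<forall>\<^sub>F n in sequentially. norm (hnorm H (X n) - hnorm H x) \<le> hnorm H (X n - x)"
    using assms by (intro always_eventually) (simp add: hnorm_triangle_diff)
qed (use assms in \<open>simp add: hconv_def\<close>)

lemma tendsto_ip_left:
  assumes "hconv H X x" "\<And>n. X n \<in> vecs H" "x \<in> vecs H" "y \<in> vecs H"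
  shows "(\<lambda>n. ip H (X n) y) \<longlonglongrightarrow> ip H x y"
proof (rule LIM_zero_cancel, rule Lim_null_comparison)
  show "\<forall>\<^sub>F n in sequentially. norm (ip H (X n) y - ip H x y) \<le> hnorm H (X n - x) * hnorm H y"
    using assms cauchy_schwarz by (intro always_eventually) (simp flip: ip_diff_left)
  show "(\<lambda>n. hnorm H (X n - x) * hnorm H y) \<longlonglongrightarrow> 0"
    using assms tendsto_mult_left_zero by (auto simp: hconv_def)
qed

end

locale hilbert = semi_hspace +
  assumes ip_definite: "\<lbrakk>x \<in> vecs H; ip H x x = 0\<rbrakk> \<Longrightarrow> x = 0"
    and complete: "hcomplete H"
    and separable: "hseparable H"
begin

lemma hnorm_eq_0: "x \<in> vecs H \<Longrightarrow> hnorm H x = 0 \<longleftrightarrow> x = 0"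
  using ip_definite by (auto simp: ip_self)

lemma ip_eqI:
  assumes "x \<in> vecs H" "y \<in> vecs H" "\<And>u. u \<in> vecs H \<Longrightarrow> ip H u x = ip H u y"
  shows "x = y"
  using ip_definite[of "x - y"] assms by (simp add: ip_diff_right)

lemma cauchy_convergent:
  assumes "\<And>k. X k \<in> vecs H"
    and "\<And>e. e > 0 \<Longrightarrow> \<exists>N::nat. \<forall>j\<ge>N. \<forall>k\<ge>N. hnorm H (X j - X k) < e"
  obtains x where "x \<in> vecs H" "hconv H X x"
  using complete assms unfolding hcomplete_def by blast

end

lemma hilbert_space_iff: "hilbert_space H \<longleftrightarrow> hilbert H"
proof
  assume "hilbert_space H"
  then show "hilbert H"
    unfolding hilbert_space_def csubspace_iff inner_product_on_def
    by (elim conjE) (unfold_locales; blast)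
next
  assume "hilbert H"
  then interpret hilbert H .
  show "hilbert_space H"
    unfolding hilbert_space_def csubspace_iff inner_product_on_def
    by (intro conjI ballI allI impI subspace complete separable ip_add_left ip_scale_left
        ip_self_nonneg ip_definite ip_commute)
qed

text \<open>Cancels one factor from estimates of the form ||h|| ||h|| \<le> C ||h||, where ||h|| may
  be zero.\<close>

lemma le_of_mult_self_le:
  fixes a b :: real
  shows "a * a \<le> b * a \<Longrightarrow> 0 \<le> a \<Longrightarrow> 0 \<le> b \<Longrightarrow> a \<le> b"
  by (cases "a = 0") (auto simp: mult_le_cancel_right)

lemma closed_csubspaceD: "closed_csubspace H S \<Longrightarrow> cvs.subspace S" "closed_csubspace H S \<Longrightarrow> S \<subseteq> vecs H"
  by (auto simp: closed_csubspace_def csubspace_iff)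

lemma closed_csubspace_limit:
  assumes S: "closed_csubspace H S" and X: "\<And>n. X n \<in> S" and x: "x \<in> vecs H" and conv: "hconv H X x"
  shows "x \<in> S"
proof -
  have "\<forall>X x. (\<forall>k. X k \<in> S) \<and> x \<in> vecs H \<and> hconv H X x \<longrightarrow> x \<in> S"
    using S unfolding closed_csubspace_def by (elim conjE)
  note lim = spec[OF spec[OF this], THEN mp, of X x]
  show ?thesis by (intro lim conjI allI X x conv)
qed

section \<open>Representation of functionals, projections and adjoints\<close>

context hilbert
begin

text \<open>A common generalization of the Riesz representation theorem and the projection theorem. As \<open>B\<close> need
  not be injective, \<open>W\<close> can consist of formal linear combinations of the vectors in the range of \<open>B\<close>, and
  \<open>\<phi>\<close> need not be shown to be well defined on their span. The vector \<open>h\<close> is the limit of a minimizing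
  sequence of \<open>\<parallel>B w\<parallel>\<^sup>2 - 2 Re (\<phi> w)\<close>.\<close>

lemma representation:
  fixes W :: "'w::complex_vector set"
  assumes W: "cvs.subspace W"
    and B_in: "\<And>w. w \<in> W \<Longrightarrow> B w \<in> vecs H"
    and B_add: "\<And>v w. v \<in> W \<Longrightarrow> w \<in> W \<Longrightarrow> B (v + w) = B v + B w"
    and B_scale: "\<And>c w. w \<in> W \<Longrightarrow> B (c *\<^sub>C w) = c *\<^sub>C B w"
    and \<phi>_add: "\<And>v w. v \<in> W \<Longrightarrow> w \<in> W \<Longrightarrow> \<phi> (v + w) = \<phi> v + \<phi> w"
    and \<phi>_scale: "\<And>c w. w \<in> W \<Longrightarrow> \<phi> (c *\<^sub>C w) = c * \<phi> w"
    and bound: "\<And>w. w \<in> W \<Longrightarrow> cmod (\<phi> w) \<le> C * hnorm H (B w)"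
    and "0 \<le> C"
  shows "\<exists>h X. h \<in> vecs H \<and> (\<forall>n::nat. X n \<in> W) \<and> hconv H (\<lambda>n. B (X n)) h \<and>
    (\<forall>w\<in>W. \<phi> w = ip H (B w) h) \<and> hnorm H h \<le> C"
proof -
  define J where "J w = (hnorm H (B w))\<^sup>2 - 2 * Re (\<phi> w)" for w
  note W_simps [simp] = cvs.subspace_0[OF W] cvs.subspace_add[OF W] cvs.subspace_scale[OF W]
  note [simp] = B_in
  have J_lower: "- (C\<^sup>2) \<le> J w" if "w \<in> W" for w
  proof -
    have "0 \<le> (hnorm H (B w) - C)\<^sup>2" by simp
    moreover have "Re (\<phi> w) \<le> C * hnorm H (B w)"
      using bound[OF that] complex_Re_le_cmod[of "\<phi> w"] by linarith
    ultimately show ?thesis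
      by (simp add: J_def power2_diff algebra_simps)
  qed
  define m where "m = Inf (J ` W)"
  have bdd: "bdd_below (J ` W)"
    using J_lower by (intro bdd_belowI2)
  have m_le: "m \<le> J w" if "w \<in> W" for w
    unfolding m_def using that bdd by (intro cInf_lower) auto
  have "\<exists>w\<in>W. J w < m + 1 / Suc n" for n :: nat
  proof -
    have "\<exists>y\<in>J ` W. y < m + 1 / Suc n"
      using W_simps(1) bdd by (subst cInf_less_iff[symmetric]) (auto simp: m_def simp del: W_simps)
    then show ?thesis by blast
  qed
  then obtain X where X [simp]: "\<And>n. X n \<in> W" and JX: "\<And>n. J (X n) < m + 1 / Suc n"
    by metis
  \<comment> \<open>Parallelogram law. The linear parts of \<open>J\<close> cancel, and the midpoint
    lies in W, so two near-minimizers have nearby images under B.\<close>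
  have para: "(hnorm H (B u - B v))\<^sup>2 = 2 * (J u + J v - 2 * J ((1/2) *\<^sub>C (u + v)))"
    if "u \<in> W" "v \<in> W" for u v
    using that
    by (simp add: J_def B_scale B_add \<phi>_scale \<phi>_add hnorm_scale power_mult_distrib power_divide
        hnorm_add_sq hnorm_diff_sq ip_scale_left ip_scale_right field_simps)
  have X_close: "(hnorm H (B (X j) - B (X k)))\<^sup>2 \<le> 2 / Suc j + 2 / Suc k" for j k
    using para[OF X X, of j k] JX[of j] JX[of k] m_le[of "(1/2) *\<^sub>C (X j + X k)"] by simp
  obtain h where h [simp]: "h \<in> vecs H" and conv: "hconv H (\<lambda>n. B (X n)) h"
  proof (rule cauchy_convergent)
    fix e :: real assume "e > 0"
    then obtain N :: nat where N: "inverse (Suc N) < e\<^sup>2 / 4"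
      using reals_Archimedean[of "e\<^sup>2 / 4"] by auto
    show "\<exists>N::nat. \<forall>j\<ge>N. \<forall>k\<ge>N. hnorm H (B (X j) - B (X k)) < e"
    proof (intro exI allI impI)
      fix j k assume "j \<ge> N" "k \<ge> N"
      then have "1 / real (Suc j) \<le> 1 / Suc N" "1 / real (Suc k) \<le> 1 / Suc N"
        by (auto intro!: divide_left_mono)
      then have "(hnorm H (B (X j) - B (X k)))\<^sup>2 < e\<^sup>2"
        using X_close[of j k] N by (simp add: inverse_eq_divide)
      then show "hnorm H (B (X j) - B (X k)) < e"
        using \<open>e > 0\<close> by (simp add: power2_less_imp_less)
    qed
  qed simp
  have J_lim: "(\<lambda>n. J (X n)) \<longlonglongrightarrow> m"
  proof (rule tendsto_sandwich[of "\<lambda>_. m" _ _ "\<lambda>n. m + 1 / Suc n"])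
    show "(\<lambda>n. m + 1 / real (Suc n)) \<longlonglongrightarrow> m"
      using tendsto_add[OF tendsto_const[of m] LIMSEQ_Suc[OF lim_1_over_n[where ?'a = real]]] by simp
  qed (use JX m_le in \<open>auto intro!: always_eventually simp: less_imp_le\<close>)
  have repr: "\<phi> w = ip H (B w) h" if [simp]: "w \<in> W" for w
  proof -
    define \<delta> where "\<delta> = \<phi> w - ip H (B w) h"
    define b where "b = (hnorm H (B w))\<^sup>2"
    have "b \<ge> 0" by (simp add: b_def)
    \<comment> \<open>The minimum may not be attained in W, since only the images
      \<open>B (X n)\<close> converge. The first-order condition is therefore the limit of the
      inequality between \<open>m\<close> and \<open>J\<close> at \<open>X n + t w\<close>.\<close>
    have perturb: "0 \<le> (cmod t)\<^sup>2 * b - 2 * Re (t * \<delta>)" for t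
    proof -
      have "m \<le> J (X n) + 2 * Re (ip H (B (X n)) (t *\<^sub>C B w)) + (cmod t)\<^sup>2 * b - 2 * Re (t * \<phi> w)" for n
        using m_le[of "X n + t *\<^sub>C w"]
        by (simp add: J_def B_add B_scale \<phi>_add \<phi>_scale hnorm_add_sq hnorm_scale power_mult_distrib b_def)
      moreover have "(\<lambda>n. J (X n) + 2 * Re (ip H (B (X n)) (t *\<^sub>C B w)) + (cmod t)\<^sup>2 * b - 2 * Re (t * \<phi> w))
        \<longlonglongrightarrow> m + 2 * Re (ip H h (t *\<^sub>C B w)) + (cmod t)\<^sup>2 * b - 2 * Re (t * \<phi> w)"
        by (intro tendsto_intros J_lim tendsto_ip_left conv) simp_all
      ultimately have "m \<le> m + 2 * Re (ip H h (t *\<^sub>C B w)) + (cmod t)\<^sup>2 * b - 2 * Re (t * \<phi> w)"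
        by (intro LIMSEQ_le_const) auto
      moreover have "Re (ip H h (t *\<^sub>C B w)) = Re (t * ip H (B w) h)"
        using ip_commute[of "B w" h] by (simp add: ip_scale_right)
      ultimately show ?thesis
        by (simp add: \<delta>_def algebra_simps)
    qed
    \<comment> \<open>With t = s cnj \<delta> the perturbation becomes |\<delta>|^2 s (s b - 2).
      This s is positive and makes s b < 1, so the last factor is negative and \<delta> must
      vanish.\<close>
    define s where "s = 1 / (b + 1)"
    have s: "s > 0" "s * b < 1" using \<open>b \<ge> 0\<close> by (simp_all add: s_def field_simps)
    have "0 \<le> (cmod (s * cnj \<delta>))\<^sup>2 * b - 2 * Re (s * cnj \<delta> * \<delta>)" by (rule perturb)
    also have "\<dots> = (cmod \<delta>)\<^sup>2 * s * (s * b - 2)"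
      using s unfolding cmod_power2 by (simp add: norm_mult power2_eq_square algebra_simps)
    finally have "(cmod \<delta>)\<^sup>2 \<le> 0"
      using s by (auto simp: zero_le_mult_iff mult_le_0_iff)
    then show ?thesis by (simp add: \<delta>_def)
  qed
  \<comment> \<open>The bound on \<phi> at \<open>X n\<close>, rewritten through h, tends to <h, h>
    \<le> C ||h||.\<close>
  have "hnorm H h \<le> C"
  proof -
    have "(\<lambda>n. cmod (ip H (B (X n)) h)) \<longlonglongrightarrow> cmod (ip H h h)"
      by (intro tendsto_norm tendsto_ip_left conv) simp_all
    moreover have "(\<lambda>n. C * hnorm H (B (X n))) \<longlonglongrightarrow> C * hnorm H h"
      by (intro tendsto_intros tendsto_hnorm conv) simp_all
    moreover have "cmod (ip H (B (X n)) h) \<le> C * hnorm H (B (X n))" for n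
      using bound[of "X n"] repr[of "X n"] by simp
    ultimately have "cmod (ip H h h) \<le> C * hnorm H h"
      by (intro LIMSEQ_le) auto
    then have "hnorm H h * hnorm H h \<le> C * hnorm H h"
      by (simp add: ip_self power2_eq_square norm_mult)
    then show ?thesis
      by (rule le_of_mult_self_le) (simp_all add: \<open>0 \<le> C\<close>)
  qed
  with h X conv repr show ?thesis by blast
qed

lemma projection:
  assumes S: "closed_csubspace H S" and x: "x \<in> vecs H"
  shows "hproj H S x \<in> S" and "s \<in> S \<Longrightarrow> ip H (x - hproj H S x) s = 0"
proof -
  have subS: "cvs.subspace S" "S \<subseteq> vecs H" by (rule closed_csubspaceD[OF S])+
  note [simp] = x subsetD[OF subS(2)]
  \<comment> \<open>Here B is the identity of S and the functional is the pairing with x. The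
    sequence X lies in S, so closedness puts its limit h in S.\<close>
  have "\<exists>h X. h \<in> vecs H \<and> (\<forall>n::nat. X n \<in> S) \<and> hconv H (\<lambda>n. X n) h \<and>
    (\<forall>s\<in>S. ip H s x = ip H s h) \<and> hnorm H h \<le> hnorm H x"
  proof (rule representation[OF subS(1)])
    show "cmod (ip H s x) \<le> hnorm H x * hnorm H s" if "s \<in> S" for s
      using cauchy_schwarz[of s x] that by (simp add: mult.commute)
  qed (simp_all add: ip_simps)
  then obtain X h where "h \<in> vecs H" and "\<And>n::nat. X n \<in> S" and "hconv H X h"
    and h: "\<And>s. s \<in> S \<Longrightarrow> ip H s x = ip H s h"
    by (elim exE conjE) (rule that; (assumption | erule (1) bspec | erule spec))
  have "h \<in> S"
    by (rule closed_csubspace_limit[OF S]) fact+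
  have orth: "ip H (x - h) s = 0" if "s \<in> S" for s
    using h[OF that] \<open>h \<in> S\<close> that ip_commute[of s x] ip_commute[of s h] by (simp add: ip_simps)
  have "hproj H S x \<in> S \<and> (\<forall>s\<in>S. ip H (x - hproj H S x) s = 0)"
    unfolding hproj_def
  proof (rule theI)
    show "h \<in> S \<and> (\<forall>s\<in>S. ip H (x - h) s = 0)" using \<open>h \<in> S\<close> orth by blast
    fix y assume y: "y \<in> S \<and> (\<forall>s\<in>S. ip H (x - y) s = 0)"
    have "y - h \<in> S" using y \<open>h \<in> S\<close> subS(1) by (simp add: cvs.subspace_diff)
    have "ip H (y - h) (y - h) = ip H (x - h) (y - h) - ip H (x - y) (y - h)"
      using y \<open>h \<in> S\<close> by (simp flip: ip_diff_left)
    then have "ip H (y - h) (y - h) = 0"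
      using y orth \<open>y - h \<in> S\<close> by simp
    then show "y = h" using ip_definite[of "y - h"] y \<open>h \<in> S\<close> by simp
  qed
  then show "hproj H S x \<in> S" and "s \<in> S \<Longrightarrow> ip H (x - hproj H S x) s = 0" by blast+
qed

context
  fixes S assumes S: "closed_csubspace H S"
begin

lemma closed_sub_in [simp]: "s \<in> S \<Longrightarrow> s \<in> vecs H"
  using closed_csubspaceD(2)[OF S] by blast

lemma ip_hproj_left: "x \<in> vecs H \<Longrightarrow> s \<in> S \<Longrightarrow> ip H (hproj H S x) s = ip H x s"
  using projection[OF S, of x] by (simp add: ip_diff_left)

lemma ip_hproj_right: "x \<in> vecs H \<Longrightarrow> s \<in> S \<Longrightarrow> ip H s (hproj H S x) = ip H s x"
  using ip_hproj_left[of x s] projection(1)[OF S, of x]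
  by (metis closed_sub_in ip_commute)

lemma hproj_eqI:
  assumes "x \<in> vecs H" "y \<in> S" "\<And>s. s \<in> S \<Longrightarrow> ip H y s = ip H x s"
  shows "hproj H S x = y"
proof -
  have diff: "y - hproj H S x \<in> S"
    using assms(2) projection(1)[OF S assms(1)] by (rule cvs.subspace_diff[OF closed_csubspaceD(1)[OF S]])
  have "ip H (y - hproj H S x) (y - hproj H S x) = 0"
    using assms projection(1)[OF S, of x] diff by (simp add: ip_diff_left ip_hproj_left)
  then show ?thesis
    using ip_definite[of "y - hproj H S x"] diff by simp
qed

lemma hproj_fixed: "s \<in> S \<Longrightarrow> hproj H S s = s"
  by (rule hproj_eqI) auto

lemma hproj_add:
  assumes "x \<in> vecs H" "y \<in> vecs H"
  shows "hproj H S (x + y) = hproj H S x + hproj H S y"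
  using assms projection(1)[OF S]
  by (intro hproj_eqI cvs.subspace_add[OF closed_csubspaceD(1)[OF S]]) (auto simp: ip_add_left ip_hproj_left)

lemma hproj_scale:
  assumes "x \<in> vecs H"
  shows "hproj H S (c *\<^sub>C x) = c *\<^sub>C hproj H S x"
  using assms projection(1)[OF S]
  by (intro hproj_eqI cvs.subspace_scale[OF closed_csubspaceD(1)[OF S]]) (auto simp: ip_scale_left ip_hproj_left)

lemma hproj_diff:
  assumes "x \<in> vecs H" "y \<in> vecs H"
  shows "hproj H S (x - y) = hproj H S x - hproj H S y"
  using assms projection(1)[OF S]
  by (intro hproj_eqI cvs.subspace_diff[OF closed_csubspaceD(1)[OF S]]) (auto simp: ip_diff_left ip_hproj_left)

lemma hnorm_hproj_le:
  assumes [simp]: "x \<in> vecs H"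
  shows "hnorm H (hproj H S x) \<le> hnorm H x"
proof -
  have [simp]: "hproj H S x \<in> S" by (simp add: projection(1)[OF S])
  have "(hnorm H (hproj H S x))\<^sup>2 = Re (ip H x (hproj H S x))"
    by (simp add: hnorm_sq ip_hproj_left)
  also have "\<dots> \<le> hnorm H x * hnorm H (hproj H S x)"
    using cauchy_schwarz[of x "hproj H S x"] complex_Re_le_cmod[of "ip H x (hproj H S x)"] by simp
  finally show ?thesis
    unfolding power2_eq_square by (rule le_of_mult_self_le) simp_all
qed

lemma hilbert_closed_subspace: "hilbert (H\<lparr>vecs := S\<rparr>)"
proof
  show "cvs.subspace (vecs (H\<lparr>vecs := S\<rparr>))"
    using closed_csubspaceD(1)[OF S] by simp
  have [simp]: "hnorm (H\<lparr>vecs := S\<rparr>) = hnorm H" "hconv (H\<lparr>vecs := S\<rparr>) = hconv H"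
    by (simp_all add: fun_eq_iff hnorm_def hconv_def)
  show "hcomplete (H\<lparr>vecs := S\<rparr>)"
    unfolding hcomplete_def
  proof (intro allI impI, elim conjE)
    fix X assume "\<forall>k. X k \<in> vecs (H\<lparr>vecs := S\<rparr>)"
      and cauchy: "\<forall>e>0. \<exists>N::nat. \<forall>j\<ge>N. \<forall>k\<ge>N. hnorm (H\<lparr>vecs := S\<rparr>) (X j - X k) < e"
    then have X: "\<And>k. X k \<in> S" by simp
    have c: "\<exists>N::nat. \<forall>j\<ge>N. \<forall>k\<ge>N. hnorm H (X j - X k) < e" if "e > 0" for e
      using cauchy that by simp
    obtain x where "x \<in> vecs H" "hconv H X x"
      by (rule cauchy_convergent[of X, OF closed_sub_in[OF X] c])
    then have "x \<in> S" by (rule closed_csubspace_limit[OF S, of X, OF X])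
    then show "\<exists>x\<in>vecs (H\<lparr>vecs := S\<rparr>). hconv (H\<lparr>vecs := S\<rparr>) X x"
      using \<open>hconv H X x\<close> by auto
  qed
  obtain D where D: "countable D" "D \<subseteq> vecs H" "\<And>x e. x \<in> vecs H \<Longrightarrow> e > 0 \<Longrightarrow> \<exists>d\<in>D. hnorm H (x - d) < e"
    using separable unfolding hseparable_def by blast
  show "hseparable (H\<lparr>vecs := S\<rparr>)"
    unfolding hseparable_def
  proof (intro exI conjI ballI allI impI)
    show "countable (hproj H S ` D)" using D by simp
    show "hproj H S ` D \<subseteq> vecs (H\<lparr>vecs := S\<rparr>)" using D projection(1)[OF S] by auto
    fix x e assume "x \<in> vecs (H\<lparr>vecs := S\<rparr>)" and "(0::real) < e"
    then have "x \<in> S" by simp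
    then obtain d where d: "d \<in> D" "hnorm H (x - d) < e" using D(3)[of x e] \<open>0 < e\<close> by auto
    then have "d \<in> vecs H" using D(2) by blast
    \<comment> \<open>A point of S is its own projection and projections are contractive, so
      projecting a dense set of H yields a dense set of S.\<close>
    then have "hnorm H (x - hproj H S d) \<le> hnorm H (x - d)"
      using hnorm_hproj_le[of "x - d"] \<open>x \<in> S\<close> by (simp add: hproj_diff hproj_fixed)
    with d show "\<exists>d\<in>hproj H S ` D. hnorm (H\<lparr>vecs := S\<rparr>) (x - d) < e"
      by (intro bexI[of _ "hproj H S d"]) auto
  qed
qed (simp_all add: ip_add_left ip_scale_left ip_self_nonneg ip_definite ip_commute[symmetric])

end

lemma closed_csubspace_orthogonal:
  assumes "A \<subseteq> vecs H"
  shows "closed_csubspace H {x \<in> vecs H. \<forall>a\<in>A. ip H x a = 0}"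
  unfolding closed_csubspace_def csubspace_iff cvs.subspace_def
proof (intro conjI allI impI; (elim conjE)?)
  fix X x assume X: "\<forall>k. X k \<in> {x \<in> vecs H. \<forall>a\<in>A. ip H x a = 0}" and x: "x \<in> vecs H" "hconv H X x"
  have "ip H x a = 0" if "a \<in> A" for a
    using tendsto_ip_left[OF x(2) _ x(1), of a] X that assms by (auto simp: LIMSEQ_const_iff)
  with x show "x \<in> {x \<in> vecs H. \<forall>a\<in>A. ip H x a = 0}" by blast
qed (use assms in \<open>auto simp: ip_simps subset_iff\<close>)

text \<open>Riesz representation of the functional that pairs \<open>A u\<close> with y. It gives
  the definite description in \<open>hadj\<close> its meaning.\<close>

lemma adjoint:
  assumes A: "bounded_op H G A" and G: "semi_hspace G" and y: "y \<in> vecs G"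
  shows "hadj H G A y \<in> vecs H" and "u \<in> vecs H \<Longrightarrow> ip G (A u) y = ip H u (hadj H G A y)"
proof -
  interpret G: semi_hspace G by (rule G)
  from A obtain C0 where A_in [simp]: "\<And>x. x \<in> vecs H \<Longrightarrow> A x \<in> vecs G"
    and A_add: "\<And>x y. x \<in> vecs H \<Longrightarrow> y \<in> vecs H \<Longrightarrow> A (x + y) = A x + A y"
    and A_scale: "\<And>c x. x \<in> vecs H \<Longrightarrow> A (c *\<^sub>C x) = c *\<^sub>C A x"
    and C0: "\<And>x. x \<in> vecs H \<Longrightarrow> hnorm G (A x) \<le> C0 * hnorm H x"
    unfolding bounded_op_def by blast
  \<comment> \<open>On the zero space a bounding constant can be negative, hence the absolute
    value.\<close>
  define C where "C = \<bar>C0\<bar> * hnorm G y"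
  have "\<exists>h X. h \<in> vecs H \<and> (\<forall>n::nat. X n \<in> vecs H) \<and> hconv H (\<lambda>n. X n) h \<and>
    (\<forall>u\<in>vecs H. ip G (A u) y = ip H u h) \<and> hnorm H h \<le> C"
  proof (rule representation[OF subspace])
    fix u assume u: "u \<in> vecs H"
    have "cmod (ip G (A u) y) \<le> hnorm G (A u) * hnorm G y"
      using G.cauchy_schwarz u y by simp
    also have "hnorm G (A u) \<le> \<bar>C0\<bar> * hnorm H u"
      using C0[OF u] mult_right_mono[OF abs_ge_self[of C0] hnorm_nonneg[OF u]] by linarith
    finally show "cmod (ip G (A u) y) \<le> C * hnorm H u"
      using y by (simp add: C_def mult_right_mono mult_ac)
  qed (use y in \<open>simp_all add: A_add A_scale G.ip_simps C_def\<close>)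
  then obtain h where h: "h \<in> vecs H" "\<And>u. u \<in> vecs H \<Longrightarrow> ip G (A u) y = ip H u h"
    by (elim exE conjE) (rule that; (assumption | erule (1) bspec))
  have "hadj H G A y \<in> vecs H \<and> (\<forall>u\<in>vecs H. ip G (A u) y = ip H u (hadj H G A y))"
    unfolding hadj_def
  proof (rule theI[of _ h])
    show "h \<in> vecs H \<and> (\<forall>u\<in>vecs H. ip G (A u) y = ip H u h)"
      by (intro conjI ballI h)
    fix x assume x: "x \<in> vecs H \<and> (\<forall>u\<in>vecs H. ip G (A u) y = ip H u x)"
    show "x = h"
    proof (rule ip_eqI)
      fix u assume "u \<in> vecs H"
      then have "ip G (A u) y = ip H u x" "ip G (A u) y = ip H u h" using x h(2) by blast+
      then show "ip H u x = ip H u h" by metis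
    qed (use x h(1) in blast)+
  qed
  then show "hadj H G A y \<in> vecs H" and "u \<in> vecs H \<Longrightarrow> ip G (A u) y = ip H u (hadj H G A y)"
    by blast+
qed

lemma adjoint_eqI:
  assumes "bounded_op H G A" "semi_hspace G" "y \<in> vecs G" "x \<in> vecs H"
    and "\<And>u. u \<in> vecs H \<Longrightarrow> ip G (A u) y = ip H u x"
  shows "hadj H G A y = x"
  using assms adjoint[OF assms(1-3)] by (intro ip_eqI) auto

lemma bounded_op_adjoint:
  assumes A: "bounded_op H G A" and G: "semi_hspace G"
  shows "bounded_op G H (hadj H G A)"
proof -
  interpret G: semi_hspace G by (rule G)
  note adj = adjoint[OF A G]
  from A obtain C0 where A_in [simp]: "\<And>x. x \<in> vecs H \<Longrightarrow> A x \<in> vecs G"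
    and C0: "\<And>x. x \<in> vecs H \<Longrightarrow> hnorm G (A x) \<le> C0 * hnorm H x"
    unfolding bounded_op_def by blast
  have "hnorm H (hadj H G A y) \<le> \<bar>C0\<bar> * hnorm G y" if [simp]: "y \<in> vecs G" for y
  proof -
    let ?x = "hadj H G A y"
    have [simp]: "?x \<in> vecs H" by (simp add: adj)
    have "(hnorm H ?x)\<^sup>2 = Re (ip G (A ?x) y)"
      by (simp add: hnorm_sq adj)
    also have "\<dots> \<le> hnorm G (A ?x) * hnorm G y"
      using G.cauchy_schwarz[of "A ?x" y] complex_Re_le_cmod[of "ip G (A ?x) y"] by simp
    also have "hnorm G (A ?x) \<le> \<bar>C0\<bar> * hnorm H ?x"
      using C0[of ?x] mult_right_mono[OF abs_ge_self[of C0] hnorm_nonneg[of ?x]] by simp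
    finally have le: "hnorm H ?x * hnorm H ?x \<le> (\<bar>C0\<bar> * hnorm G y) * hnorm H ?x"
      by (simp add: power2_eq_square mult_ac mult_right_mono)
    then show ?thesis
      by (rule le_of_mult_self_le) simp_all
  qed
  moreover have "hadj H G A (x + y) = hadj H G A x + hadj H G A y" if "x \<in> vecs G" "y \<in> vecs G" for x y
    using that by (intro adjoint_eqI[OF A G]) (simp_all add: adj G.ip_add_right ip_add_right)
  moreover have "hadj H G A (c *\<^sub>C x) = c *\<^sub>C hadj H G A x" if "x \<in> vecs G" for c x
    using that by (intro adjoint_eqI[OF A G]) (simp_all add: adj G.ip_scale_right ip_scale_right)
  ultimately show ?thesis
    unfolding bounded_op_def using adj(1) by blast
qed

end

section \<open>Factorization of positive forms\<close>

text \<open>The Schur complement of the form with respect to \<open>a\<close>: for \<open>a\<close>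
  of nonzero seminorm, the form of the components orthogonal to \<open>a\<close>.\<close>

definition deflate :: "'a hspace \<Rightarrow> 'a \<Rightarrow> 'a hspace" where
  "deflate G a = G\<lparr>ip := \<lambda>x y. ip G x y - ip G x a * cnj (ip G y a) / ip G a a\<rparr>"

lemma vecs_deflate [simp]: "vecs (deflate G a) = vecs G"
  by (simp add: deflate_def)

lemma ip_deflate: "ip (deflate G a) x y = ip G x y - ip G x a * cnj (ip G y a) / ip G a a"
  by (simp add: deflate_def)

text \<open>The residuals of the Cholesky factorization of the form along \<open>d\<close>. If \<open>d k\<close> has seminorm zero,
  division by zero makes the \<open>k\<close>-th step trivial, as it should be.\<close>

primrec residual :: "'a hspace \<Rightarrow> (nat \<Rightarrow> 'a) \<Rightarrow> nat \<Rightarrow> 'a hspace" where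
  "residual H d 0 = H"
| "residual H d (Suc k) = deflate (residual H d k) (d k)"

text \<open>Column entries of the Cholesky factor: the coordinates of x along the Gram-Schmidt
  vectors of \<open>d\<close>. A step with a null vector contributes the coordinate 0.\<close>

definition residual_coeff :: "'a hspace \<Rightarrow> (nat \<Rightarrow> 'a) \<Rightarrow> 'a \<Rightarrow> nat \<Rightarrow> complex" where
  "residual_coeff H d x k = ip (residual H d k) x (d k) / hnorm (residual H d k) (d k)"

lemma vecs_residual [simp]: "vecs (residual H d k) = vecs H"
  by (induction k) simp_all

context semi_hspace
begin

lemma hnorm_deflate_sq:
  assumes "x \<in> vecs H" "a \<in> vecs H"
  shows "Re (ip (deflate H a) x x) = (hnorm H x)\<^sup>2 - (cmod (ip H x a))\<^sup>2 / (hnorm H a)\<^sup>2"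
proof -
  have "ip (deflate H a) x x = complex_of_real ((hnorm H x)\<^sup>2 - (cmod (ip H x a))\<^sup>2 / (hnorm H a)\<^sup>2)"
    using assms by (simp add: ip_deflate ip_self complex_norm_square[symmetric])
  then show ?thesis by (simp only: Re_complex_of_real)
qed

text \<open>Positivity is the Cauchy-Schwarz inequality for x and \<open>a\<close>, divided by the
  squared seminorm of \<open>a\<close>.\<close>

lemma semi_hspace_deflate:
  assumes a: "a \<in> vecs H"
  shows "semi_hspace (deflate H a)"
proof
  fix x y assume x: "x \<in> vecs (deflate H a)" and y: "y \<in> vecs (deflate H a)"
  then have xy: "x \<in> vecs H" "y \<in> vecs H" by simp_all
  have "cnj (ip H a a) = ip H a a" using a by (simp add: ip_self)
  then show "ip (deflate H a) y x = cnj (ip (deflate H a) x y)"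
    using ip_commute[OF xy] by (simp add: ip_deflate mult.commute)
next
  fix x assume "x \<in> vecs (deflate H a)"
  then have x: "x \<in> vecs H" by simp
  have "(cmod (ip H x a))\<^sup>2 \<le> (hnorm H x)\<^sup>2 * (hnorm H a)\<^sup>2"
    using power_mono[OF cauchy_schwarz[OF x a], of 2] by (simp add: power_mult_distrib)
  then show "0 \<le> Re (ip (deflate H a) x x)"
    unfolding hnorm_deflate_sq[OF x a] by (cases "hnorm H a = 0") (simp_all add: pos_divide_le_eq)
qed (use a in \<open>simp_all add: subspace ip_deflate ip_simps diff_divide_distrib add_divide_distrib algebra_simps\<close>)

lemma ip_deflate_self:
  assumes "x \<in> vecs H" "a \<in> vecs H"
  shows "ip (deflate H a) x a = 0"
proof (cases "ip H a a = 0")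
  case True
  then have "ip H x a = 0"
    using cauchy_schwarz[OF assms] assms by (simp add: ip_self)
  then show ?thesis by (simp add: ip_deflate)
next
  case False
  have "cnj (ip H a a) = ip H a a" using assms by (simp add: ip_self)
  with False show ?thesis by (simp add: ip_deflate)
qed

end

context semi_hspace
begin

context
  fixes d :: "nat \<Rightarrow> 'a"
  assumes d [simp]: "\<And>k. d k \<in> vecs H"
begin

lemma semi_hspace_residual: "semi_hspace (residual H d k)"
  by (induction k) (simp_all add: semi_hspace_axioms semi_hspace.semi_hspace_deflate)

lemma ip_residual_zero:
  assumes "j < k" "x \<in> vecs H"
  shows "ip (residual H d k) x (d j) = 0"
  using assms
proof (induction k arbitrary: x)
  case (Suc k)
  interpret R: semi_hspace "residual H d k" by (rule semi_hspace_residual)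
  show ?case
  proof (cases "j = k")
    case True
    then show ?thesis using Suc.prems R.ip_deflate_self[of x "d k"] by simp
  next
    case False
    then have 0: "ip (residual H d k) u (d j) = 0" if "u \<in> vecs H" for u using Suc that by simp
    \<comment> \<open>\<open>d j\<close> is null for the k-th residual, so by Cauchy-Schwarz the
      rank one term subtracted next vanishes on it and leaves it null.\<close>
    then have "ip (residual H d k) (d j) (d k) = 0"
      using R.cauchy_schwarz[of "d j" "d k"] by (simp add: hnorm_def)
    then show ?thesis using Suc.prems by (simp add: ip_deflate 0)
  qed
qed simp

lemma hnorm_residual_antimono:
  assumes "x \<in> vecs H"
  shows "hnorm (residual H d k) x \<le> hnorm H x"
proof (induction k)
  case (Suc k)
  interpret R: semi_hspace "residual H d k" by (rule semi_hspace_residual)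
  have "Re (ip (deflate (residual H d k) (d k)) x x) \<le> (hnorm (residual H d k) x)\<^sup>2"
    using assms by (simp add: R.hnorm_deflate_sq)
  then have "hnorm (residual H d (Suc k)) x \<le> hnorm (residual H d k) x"
    using assms R.hnorm_nonneg by (simp add: hnorm_def[of "deflate _ _"] real_le_lsqrt)
  with Suc show ?case by linarith
qed simp

lemma sum_residual_coeff:
  assumes "x \<in> vecs H" "y \<in> vecs H"
  shows "(\<Sum>j<k. residual_coeff H d x j * cnj (residual_coeff H d y j)) = ip H x y - ip (residual H d k) x y"
proof (induction k)
  case (Suc k)
  interpret R: semi_hspace "residual H d k" by (rule semi_hspace_residual)
  have "residual_coeff H d x k * cnj (residual_coeff H d y k) =
    ip (residual H d k) x (d k) * cnj (ip (residual H d k) y (d k)) / ip (residual H d k) (d k) (d k)"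
    by (simp add: residual_coeff_def R.ip_self power2_eq_square)
  with Suc show ?case by (simp add: ip_deflate)
qed simp

lemma residual_coeff_add:
  assumes "x \<in> vecs H" "y \<in> vecs H"
  shows "residual_coeff H d (x + y) = residual_coeff H d x + residual_coeff H d y"
  using assms
  by (auto simp: residual_coeff_def semi_hspace.ip_add_left[OF semi_hspace_residual] add_divide_distrib)

lemma residual_coeff_scale:
  assumes "x \<in> vecs H"
  shows "residual_coeff H d (c *\<^sub>C x) = c *\<^sub>C residual_coeff H d x"
  using assms
  by (auto simp: residual_coeff_def semi_hspace.ip_scale_left[OF semi_hspace_residual] scaleC_fun_def scaleC_complex_def)

text \<open>Parseval's identity for a semidefinite form. The k-th partial sum misses
  \<open>ip H x y\<close> by exactly the k-th residual form, which Cauchy-Schwarz controls by the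
  residual seminorm of x.\<close>

lemma residual_coeff_sums:
  assumes dense: "\<And>x e. x \<in> vecs H \<Longrightarrow> e > 0 \<Longrightarrow> \<exists>k. hnorm H (x - d k) < e"
    and x: "x \<in> vecs H" and y: "y \<in> vecs H"
  shows "(\<lambda>k. residual_coeff H d x k * cnj (residual_coeff H d y k)) sums ip H x y"
proof -
  \<comment> \<open>Once k exceeds j, \<open>d j\<close> is null for the residual, so x may be
    replaced by x - \<open>d j\<close>, whose residual seminorm is at most its original one. Density
    makes that small.\<close>
  have small: "\<exists>N. \<forall>k\<ge>N. hnorm (residual H d k) x < e" if e: "e > 0" for e
  proof -
    obtain j where j: "hnorm H (x - d j) < e" using dense[OF x e] by blast
    have "hnorm (residual H d k) x < e" if "k \<ge> Suc j" for k
    proof -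
      interpret R: semi_hspace "residual H d k" by (rule semi_hspace_residual)
      have "ip (residual H d k) u (d j) = 0" if "u \<in> vecs H" for u
        using that \<open>k \<ge> Suc j\<close> by (intro ip_residual_zero) simp_all
      then have "(hnorm (residual H d k) x)\<^sup>2 = (hnorm (residual H d k) (x - d j))\<^sup>2"
        using x by (simp add: R.hnorm_diff_sq hnorm_def[of _ "d j"])
      then have "hnorm (residual H d k) x = hnorm (residual H d k) (x - d j)"
        using x by (simp add: power2_eq_iff_nonneg)
      also have "\<dots> \<le> hnorm H (x - d j)" using x by (simp add: hnorm_residual_antimono)
      finally show ?thesis using j by simp
    qed
    then show ?thesis by blast
  qed
  have nonneg: "0 \<le> hnorm (residual H d k) x" for k
    using semi_hspace.hnorm_nonneg[OF semi_hspace_residual, of x k] x by simp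
  have "(\<lambda>k. hnorm (residual H d k) x) \<longlonglongrightarrow> 0"
    unfolding LIMSEQ_iff using small nonneg by simp
  then have lim: "(\<lambda>k. hnorm (residual H d k) x * hnorm H y) \<longlonglongrightarrow> 0"
    by (rule tendsto_mult_left_zero)
  have "(\<lambda>k. ip (residual H d k) x y) \<longlonglongrightarrow> 0"
  proof (rule Lim_null_comparison[OF always_eventually lim], rule allI)
    fix k
    interpret R: semi_hspace "residual H d k" by (rule semi_hspace_residual)
    have "cmod (ip (residual H d k) x y) \<le> hnorm (residual H d k) x * hnorm (residual H d k) y"
      using R.cauchy_schwarz x y by simp
    also have "\<dots> \<le> hnorm (residual H d k) x * hnorm H y"
      using x y nonneg hnorm_residual_antimono by (simp add: mult_left_mono)
    finally show "cmod (ip (residual H d k) x y) \<le> hnorm (residual H d k) x * hnorm H y" .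
  qed
  then have "(\<lambda>k. ip H x y - ip (residual H d k) x y) \<longlonglongrightarrow> ip H x y - 0"
    by (intro tendsto_intros)
  then show ?thesis
    using x y by (simp add: sums_def sum_residual_coeff)
qed

end

end

section \<open>Partial isometries and range projections\<close>

lemma (in hilbert) partial_isometry_range_iff:
  assumes A: "partial_isometry F H A" and F: "hilbert F" and S: "closed_csubspace H S"
  shows "S = A ` vecs F \<longleftrightarrow> (\<forall>x\<in>vecs H. hproj H S x = A (hadj F H A x))"
proof -
  interpret F: hilbert F by (rule F)
  have bdd: "bounded_op F H A" using A by (simp add: partial_isometry_def)
  note adj = F.adjoint[OF bdd semi_hspace_axioms]
  have A_in [simp]: "u \<in> vecs F \<Longrightarrow> A u \<in> vecs H" for u
    using bdd unfolding bounded_op_def by blast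
  have A_add: "u \<in> vecs F \<Longrightarrow> v \<in> vecs F \<Longrightarrow> A (u + v) = A u + A v" for u v
    using bdd unfolding bounded_op_def by blast
  have A_scale: "u \<in> vecs F \<Longrightarrow> A (c *\<^sub>C u) = c *\<^sub>C A u" for c u
    using bdd unfolding bounded_op_def by blast
  \<comment> \<open>\<open>N\<close> is the kernel and \<open>P\<close>, defined next, its
    orthogonal complement, the initial space. A preserves inner products on \<open>P\<close> and
    attains all its values there, so A composed with its adjoint is the projection onto the
    range.\<close>
  define N where "N = {u \<in> vecs F. A u = 0}"
  define P where "P = {u \<in> vecs F. \<forall>v\<in>N. ip F u v = 0}"
  have PN_in [simp]: "u \<in> P \<Longrightarrow> u \<in> vecs F" "u \<in> N \<Longrightarrow> u \<in> vecs F" for u by (simp_all add: P_def N_def)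
  \<comment> \<open>As the orthogonal complement of the range of the adjoint, the kernel is
    closed.\<close>
  have N_eq: "N = {u \<in> vecs F. \<forall>a\<in>hadj F H A ` vecs H. ip F u a = 0}"
  proof -
    have "A u = 0" if "u \<in> vecs F" "\<forall>y\<in>vecs H. ip F u (hadj F H A y) = 0" for u
      using ip_definite[of "A u"] adj(2)[of "A u" u] that by simp
    moreover have "ip F u (hadj F H A y) = 0" if "u \<in> vecs F" "A u = 0" "y \<in> vecs H" for u y
      using that by (simp flip: adj(2))
    ultimately show ?thesis unfolding N_def by blast
  qed
  have N: "closed_csubspace F N"
    unfolding N_eq by (rule F.closed_csubspace_orthogonal) (use adj(1) in blast)
  have P: "closed_csubspace F P"
    unfolding P_def by (rule F.closed_csubspace_orthogonal[OF closed_csubspaceD(2)[OF N]])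
  note P_sub = closed_csubspaceD(1)[OF P]
  have iso: "hnorm H (A u) = hnorm F u" if "u \<in> P" for u
    using A that unfolding partial_isometry_def P_def N_def by blast
  have re: "Re (ip H (A u) (A v)) = Re (ip F u v)" if "u \<in> P" "v \<in> P" for u v
    using iso[OF cvs.subspace_add[OF P_sub that]] iso[OF that(1)] iso[OF that(2)] that
      hnorm_add_sq[of "A u" "A v"] F.hnorm_add_sq[of u v]
    by (simp add: A_add)
  \<comment> \<open>Polarization: norms of sums give real parts, and replacing v by \<i> v gives
    imaginary parts.\<close>
  have ip_P: "ip H (A u) (A v) = ip F u v" if "u \<in> P" "v \<in> P" for u v
    using re[OF that] re[OF that(1) cvs.subspace_scale[OF P_sub that(2), of \<i>]] that
    by (intro complex_eqI) (simp_all add: A_scale ip_scale_right F.ip_scale_right)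
  have decomp: "\<exists>v\<in>P. A u = A v \<and> (\<forall>x\<in>P. ip F u x = ip F v x)" if u: "u \<in> vecs F" for u
  proof (intro bexI conjI ballI)
    let ?n = "hproj F N u"
    have n: "?n \<in> N" by (rule F.projection(1)[OF N u])
    show "u - ?n \<in> P" using n u F.projection(2)[OF N u] by (simp add: P_def del: PN_in(1))
    have "A u = A ((u - ?n) + ?n)" by simp
    also have "\<dots> = A (u - ?n) + A ?n" using n u by (intro A_add) simp_all
    finally show "A u = A (u - ?n)" using n by (simp add: N_def del: PN_in(2))
    fix x assume x: "x \<in> P"
    then have "ip F x ?n = 0" using n by (simp add: P_def del: PN_in(1))
    then show "ip F u x = ip F (u - ?n) x"
      using n u x F.ip_commute[of x ?n] by (simp add: F.ip_diff_left)
  qed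
  have ip_A: "ip H (A u) (A x) = ip F u x" if "u \<in> vecs F" "x \<in> P" for u x
    using decomp[OF that(1)] ip_P that(2) by auto
  have adj_P: "hadj F H A y \<in> P" if y: "y \<in> vecs H" for y
  proof -
    have "ip F (hadj F H A y) v = 0" if "v \<in> N" for v
    proof -
      have "ip F v (hadj F H A y) = 0"
        using that y by (simp add: N_def flip: adj(2) del: PN_in(2))
      then show ?thesis
        using F.ip_commute[of v "hadj F H A y"] that adj(1)[OF y] by simp
    qed
    then show ?thesis using adj(1)[OF y] by (simp add: P_def del: PN_in(1))
  qed
  show ?thesis
  proof
    assume S_eq: "S = A ` vecs F"
    show "\<forall>x\<in>vecs H. hproj H S x = A (hadj F H A x)"
    proof
      fix x assume x: "x \<in> vecs H"
      show "hproj H S x = A (hadj F H A x)"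
      proof (rule hproj_eqI[OF S x])
        show "A (hadj F H A x) \<in> S" using adj(1)[OF x] S_eq by simp
        fix s assume "s \<in> S"
        then obtain u where u: "u \<in> vecs F" "s = A u" using S_eq by blast
        have "ip H s (A (hadj F H A x)) = ip H s x"
          using ip_A[OF u(1) adj_P[OF x]] adj(2)[OF x u(1)] u(2) by simp
        then show "ip H (A (hadj F H A x)) s = ip H x s"
          using u x adj(1)[OF x] by (metis A_in ip_commute)
      qed
    qed
  next
    assume proj: "\<forall>x\<in>vecs H. hproj H S x = A (hadj F H A x)"
    show "S = A ` vecs F"
    proof
      show "S \<subseteq> A ` vecs F"
      proof
        fix s assume s: "s \<in> S"
        then have "s \<in> vecs H" using S closed_sub_in by blast
        then have "s = A (hadj F H A s)" using proj hproj_fixed[OF S s] by simp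
        then show "s \<in> A ` vecs F" using adj(1)[OF \<open>s \<in> vecs H\<close>] by blast
      qed
      show "A ` vecs F \<subseteq> S"
      proof
        fix s assume "s \<in> A ` vecs F"
        then obtain v where v: "v \<in> P" "s = A v" using decomp by auto
        have "hadj F H A (A v) = v"
          using v ip_A by (intro F.adjoint_eqI[OF bdd semi_hspace_axioms]) simp_all
        then have "s = hproj H S s" using proj v by simp
        then show "s \<in> S" using projection(1)[OF S, of s] v by simp
      qed
    qed
  qed
qed

section \<open>Countable Hilbert sums\<close>

text \<open>Serves two constructions: over the scalars it gives \<open>ell2\<close>, indexed by
  words or by natural numbers, and over a kernel space D it gives D tensor l2 as a sequence of
  copies of D.\<close>

definition l2sum :: "'a hspace \<Rightarrow> ('i \<Rightarrow> 'a) hspace" where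
  "l2sum H = \<lparr>vecs = {f. (\<forall>i. f i \<in> vecs H) \<and> (\<lambda>i. (hnorm H (f i))\<^sup>2) summable_on UNIV},
             ip = \<lambda>f g. \<Sum>\<^sub>\<infinity>i. ip H (f i) (g i)\<rparr>"

lemma ip_l2sum: "ip (l2sum H) f g = (\<Sum>\<^sub>\<infinity>i. ip H (f i) (g i))"
  by (simp add: l2sum_def)

lemma l2sum_component: "f \<in> vecs (l2sum H) \<Longrightarrow> f i \<in> vecs H"
  by (simp add: l2sum_def)

lemma l2sum_summable: "f \<in> vecs (l2sum H) \<Longrightarrow> (\<lambda>i. (hnorm H (f i))\<^sup>2) summable_on UNIV"
  by (simp add: l2sum_def)

context semi_hspace
begin

lemma infsum_ip_self:
  assumes "f \<in> vecs (l2sum H)"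
  shows "ip (l2sum H) f f = complex_of_real (\<Sum>\<^sub>\<infinity>i. (hnorm H (f i))\<^sup>2)"
proof -
  have "ip (l2sum H) f f = (\<Sum>\<^sub>\<infinity>i. complex_of_real ((hnorm H (f i))\<^sup>2))"
    using l2sum_component[OF assms] by (simp add: ip_l2sum ip_self)
  also have "\<dots> = complex_of_real (\<Sum>\<^sub>\<infinity>i. (hnorm H (f i))\<^sup>2)"
    by (intro infsumI has_sum_of_real has_sum_infsum l2sum_summable assms)
  finally show ?thesis .
qed

lemma hnorm_l2sum_sq:
  assumes "f \<in> vecs (l2sum H)"
  shows "(hnorm (l2sum H) f)\<^sup>2 = (\<Sum>\<^sub>\<infinity>i. (hnorm H (f i))\<^sup>2)"
  using infsum_ip_self[OF assms] by (simp add: hnorm_def infsum_nonneg)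

lemma l2sum_boundedI:
  assumes "\<And>i. f i \<in> vecs H" "\<And>A. finite A \<Longrightarrow> (\<Sum>i\<in>A. (hnorm H (f i))\<^sup>2) \<le> c"
  shows "f \<in> vecs (l2sum H)" and "(hnorm (l2sum H) f)\<^sup>2 \<le> c"
proof -
  have "(\<lambda>i. (hnorm H (f i))\<^sup>2) summable_on UNIV"
    using assms(2) by (intro nonneg_bdd_above_summable_on) (auto intro!: bdd_aboveI2[where M = c])
  then show f: "f \<in> vecs (l2sum H)" using assms(1) by (simp add: l2sum_def)
  show "(hnorm (l2sum H) f)\<^sup>2 \<le> c"
    unfolding hnorm_l2sum_sq[OF f] by (intro infsum_le_finite_sums l2sum_summable f assms(2))
qed

lemma sum_le_hnorm_l2sum:
  assumes "f \<in> vecs (l2sum H)" "finite A"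
  shows "(\<Sum>i\<in>A. (hnorm H (f i))\<^sup>2) \<le> (hnorm (l2sum H) f)\<^sup>2"
  unfolding hnorm_l2sum_sq[OF assms(1)]
  by (intro finite_sum_le_infsum l2sum_summable assms) auto

lemma hnorm_l2sum_nonneg: "f \<in> vecs (l2sum H) \<Longrightarrow> 0 \<le> hnorm (l2sum H) f"
  by (simp add: hnorm_def[of "l2sum H"] infsum_ip_self infsum_nonneg)

lemma component_le_hnorm_l2sum:
  assumes "f \<in> vecs (l2sum H)"
  shows "hnorm H (f i) \<le> hnorm (l2sum H) f"
  using sum_le_hnorm_l2sum[OF assms, of "{i}"] hnorm_l2sum_nonneg[OF assms]
  by (auto intro!: power2_le_imp_le[where x = "hnorm H (f i)" and y = "hnorm (l2sum H) f"])

lemma l2sum_ip_summable: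
  assumes f: "f \<in> vecs (l2sum H)" and g: "g \<in> vecs (l2sum H)"
  shows "(\<lambda>i. norm (ip H (f i) (g i))) summable_on UNIV"
proof (rule Infinite_Sum.abs_summable_on_comparison_test'[OF summable_on_add[OF l2sum_summable[OF f] l2sum_summable[OF g]]])
  fix i
  have "norm (ip H (f i) (g i)) \<le> hnorm H (f i) * hnorm H (g i)"
    by (intro cauchy_schwarz l2sum_component[OF f] l2sum_component[OF g])
  also have "\<dots> \<le> (hnorm H (f i))\<^sup>2 + (hnorm H (g i))\<^sup>2"
  proof -
    have "0 \<le> hnorm H (f i) * hnorm H (g i)"
      by (intro mult_nonneg_nonneg hnorm_nonneg l2sum_component[OF f] l2sum_component[OF g])
    then show ?thesis
      using sum_squares_bound[of "hnorm H (f i)" "hnorm H (g i)"] by linarith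
  qed
  finally show "norm (ip H (f i) (g i)) \<le> (hnorm H (f i))\<^sup>2 + (hnorm H (g i))\<^sup>2" .
qed

lemma l2sum_ip_has_sum:
  assumes "f \<in> vecs (l2sum H)" "g \<in> vecs (l2sum H)"
  shows "((\<lambda>i. ip H (f i) (g i)) has_sum ip (l2sum H) f g) UNIV"
  unfolding ip_l2sum by (rule has_sum_infsum[OF abs_summable_summable[OF l2sum_ip_summable[OF assms]]])

lemma semi_hspace_l2sum: "semi_hspace (l2sum H)"
proof
  have add: "f + g \<in> vecs (l2sum H)" if f: "f \<in> vecs (l2sum H)" and g: "g \<in> vecs (l2sum H)" for f g :: "'i \<Rightarrow> 'a"
  proof (rule l2sum_boundedI(1)[of _ "2 * (hnorm (l2sum H) f)\<^sup>2 + 2 * (hnorm (l2sum H) g)\<^sup>2"])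
    fix A :: "'i set" assume A: "finite A"
    have "(hnorm H ((f + g) i))\<^sup>2 \<le> 2 * (hnorm H (f i))\<^sup>2 + 2 * (hnorm H (g i))\<^sup>2" for i
      using hnorm_add_sq[OF l2sum_component[OF f] l2sum_component[OF g], of i i]
        hnorm_diff_sq[OF l2sum_component[OF f] l2sum_component[OF g], of i i]
        zero_le_power2[of "hnorm H (f i - g i)"] by simp
    then have "(\<Sum>i\<in>A. (hnorm H ((f + g) i))\<^sup>2) \<le> (\<Sum>i\<in>A. 2 * (hnorm H (f i))\<^sup>2 + 2 * (hnorm H (g i))\<^sup>2)"
      by (intro sum_mono)
    then show "(\<Sum>i\<in>A. (hnorm H ((f + g) i))\<^sup>2) \<le> 2 * (hnorm (l2sum H) f)\<^sup>2 + 2 * (hnorm (l2sum H) g)\<^sup>2"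
      using sum_le_hnorm_l2sum[OF f A] sum_le_hnorm_l2sum[OF g A]
      by (simp add: sum.distrib flip: sum_distrib_left)
  qed (use l2sum_component[OF f] l2sum_component[OF g] in simp)
  have scale: "c *\<^sub>C f \<in> vecs (l2sum H)" if f: "f \<in> vecs (l2sum H)" for c and f :: "'i \<Rightarrow> 'a"
    using l2sum_component[OF f] l2sum_summable[OF f]
    by (simp add: l2sum_def scaleC_fun_def hnorm_scale power_mult_distrib summable_on_cmult_right)
  show "cvs.subspace (vecs (l2sum H :: ('i \<Rightarrow> 'a) hspace))"
    unfolding cvs.subspace_def by (intro conjI ballI allI add scale) (simp add: l2sum_def)
  fix f g h :: "'i \<Rightarrow> 'a" and c
  assume f: "f \<in> vecs (l2sum H)" and g: "g \<in> vecs (l2sum H)"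
  show "ip (l2sum H) (c *\<^sub>C f) g = c * ip (l2sum H) f g"
    using l2sum_component[OF f] l2sum_component[OF g]
    by (simp add: ip_l2sum scaleC_fun_def ip_scale_left infsum_cmult_right')
  show "ip (l2sum H) g f = cnj (ip (l2sum H) f g)"
    unfolding ip_l2sum infsum_cnj[symmetric]
    by (intro infsum_cong ip_commute l2sum_component[OF f] l2sum_component[OF g])
  show "0 \<le> Re (ip (l2sum H) f f)"
    using infsum_ip_self[OF f] by (simp add: infsum_nonneg)
  assume h: "h \<in> vecs (l2sum H)"
  show "ip (l2sum H) (f + g) h = ip (l2sum H) f h + ip (l2sum H) g h"
    using infsum_add[OF abs_summable_summable[OF l2sum_ip_summable[OF f h]] abs_summable_summable[OF l2sum_ip_summable[OF g h]]]
      l2sum_component[OF f] l2sum_component[OF g] l2sum_component[OF h]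
    by (simp add: ip_l2sum ip_add_left)
qed

lemma l2sum_truncate:
  assumes f: "f \<in> vecs (l2sum H)" and e: "e > 0"
  obtains A where "finite A" "hnorm (l2sum H) (f - (\<lambda>i. if i \<in> A then f i else 0)) < e"
    "f - (\<lambda>i. if i \<in> A then f i else 0) \<in> vecs (l2sum H)"
proof -
  let ?n = "\<lambda>i. (hnorm H (f i))\<^sup>2"
  obtain A where A: "finite A" "dist (sum ?n A) (infsum ?n UNIV) \<le> (e / 2)\<^sup>2"
    using infsum_finite_approximation[OF l2sum_summable[OF f], of "(e / 2)\<^sup>2"] e by auto
  define t where "t = f - (\<lambda>i. if i \<in> A then f i else 0)"
  have t: "t i = (if i \<in> A then 0 else f i)" for i by (simp add: t_def)
  have t_in: "t i \<in> vecs H" for i using l2sum_component[OF f] by (simp add: t)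
  have bound: "(\<Sum>i\<in>B. (hnorm H (t i))\<^sup>2) \<le> (e / 2)\<^sup>2" if B: "finite B" for B
  proof -
    have "(\<Sum>i\<in>B. (hnorm H (t i))\<^sup>2) = sum ?n (B - A)"
      using B by (intro sum.mono_neutral_cong_right) (auto simp: t)
    also have "\<dots> = sum ?n ((B - A) \<union> A) - sum ?n A"
      using A B by (subst sum.union_disjoint) auto
    also have "sum ?n ((B - A) \<union> A) \<le> infsum ?n UNIV"
      using A B by (intro finite_sum_le_infsum l2sum_summable f) auto
    also have "infsum ?n UNIV - sum ?n A \<le> (e / 2)\<^sup>2"
      using A(2) by (simp add: dist_real_def)
    finally show ?thesis by simp
  qed
  have sq: "(hnorm (l2sum H) t)\<^sup>2 \<le> (e / 2)\<^sup>2" and t_l2sum: "t \<in> vecs (l2sum H)"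
    by (rule l2sum_boundedI[of t, OF t_in bound]; assumption)+
  from sq have "hnorm (l2sum H) t \<le> e / 2"
    by (rule power2_le_imp_le) (use e in simp)
  then show ?thesis using that[OF A(1)] t_l2sum e by (simp add: t_def)
qed

end

context hilbert
begin

lemma hcomplete_l2sum: "hcomplete (l2sum H :: ('i \<Rightarrow> 'a) hspace)"
  unfolding hcomplete_def
proof (intro allI impI, elim conjE)
  interpret L: semi_hspace "l2sum H :: ('i \<Rightarrow> 'a) hspace" by (rule semi_hspace_l2sum)
  fix X :: "nat \<Rightarrow> 'i \<Rightarrow> 'a"
  assume "\<forall>k. X k \<in> vecs (l2sum H)"
    and "\<forall>e>0. \<exists>N. \<forall>j\<ge>N. \<forall>k\<ge>N. hnorm (l2sum H) (X j - X k) < e"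
  then have X [simp]: "\<And>k. X k \<in> vecs (l2sum H)"
    and cauchy: "\<And>e. e > 0 \<Longrightarrow> \<exists>N. \<forall>j\<ge>N. \<forall>k\<ge>N. hnorm (l2sum H) (X j - X k) < e" by blast+
  have Xi [simp]: "X k i \<in> vecs H" for k i by (simp add: l2sum_component)
  have comp: "hnorm H (X j i - X k i) \<le> hnorm (l2sum H) (X j - X k)" for i j k
    using component_le_hnorm_l2sum[of "X j - X k" i] by simp
  have "\<exists>x. x \<in> vecs H \<and> hconv H (\<lambda>k. X k i) x" for i
  proof -
    have "\<exists>N. \<forall>j\<ge>N. \<forall>k\<ge>N. hnorm H (X j i - X k i) < e" if "e > 0" for e
      using cauchy[OF that] comp[of _ i] by (meson le_less_trans)
    from cauchy_convergent[of "\<lambda>k. X k i", OF Xi this] show ?thesis by blast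
  qed
  then obtain x where x: "\<And>i. x i \<in> vecs H" and conv: "\<And>i. hconv H (\<lambda>k. X k i) (x i)" by metis
  \<comment> \<open>A Fatou argument: finite partial sums for \<open>X n - X m\<close> are bounded
    uniformly, m tends to infinity inside each finite sum, and only then is the supremum over finite
    sets taken.\<close>
  have tail: "\<exists>N. \<forall>n\<ge>N. X n - x \<in> vecs (l2sum H) \<and> hnorm (l2sum H) (X n - x) \<le> e" if e: "e > 0" for e
  proof -
    obtain N where N: "\<And>j k. j \<ge> N \<Longrightarrow> k \<ge> N \<Longrightarrow> hnorm (l2sum H) (X j - X k) < e"
      using cauchy[OF e] by blast
    have bound: "(\<Sum>i\<in>A. (hnorm H ((X n - x) i))\<^sup>2) \<le> e\<^sup>2" if n: "n \<ge> N" and A: "finite A" for n A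
    proof (rule LIMSEQ_le_const2)
      have "hconv H (\<lambda>m. X n i - X m i) (X n i - x i)" for i
      proof -
        have "hnorm H (X n i - X m i - (X n i - x i)) = hnorm H (X m i - x i)" for m
          using hnorm_minus_commute[of "x i" "X m i"] x by simp
        then show ?thesis using conv[of i] by (simp add: hconv_def)
      qed
      then show "(\<lambda>m. \<Sum>i\<in>A. (hnorm H (X n i - X m i))\<^sup>2) \<longlonglongrightarrow> (\<Sum>i\<in>A. (hnorm H ((X n - x) i))\<^sup>2)"
        using x by (auto intro!: tendsto_sum tendsto_power tendsto_hnorm)
      have "(\<Sum>i\<in>A. (hnorm H (X n i - X m i))\<^sup>2) \<le> e\<^sup>2" if "m \<ge> N" for m
      proof -
        have "(\<Sum>i\<in>A. (hnorm H (X n i - X m i))\<^sup>2) \<le> (hnorm (l2sum H) (X n - X m))\<^sup>2"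
          using sum_le_hnorm_l2sum[of "X n - X m", OF _ A] by simp
        also have "\<dots> \<le> e\<^sup>2" using N[OF n that] by (intro power_mono) auto
        finally show ?thesis .
      qed
      then show "\<exists>N. \<forall>m\<ge>N. (\<Sum>i\<in>A. (hnorm H (X n i - X m i))\<^sup>2) \<le> e\<^sup>2" by blast
    qed
    have "X n - x \<in> vecs (l2sum H) \<and> hnorm (l2sum H) (X n - x) \<le> e" if n: "n \<ge> N" for n
    proof -
      have in_H: "(X n - x) i \<in> vecs H" for i using x by simp
      show ?thesis
      proof
        show "X n - x \<in> vecs (l2sum H)" by (rule l2sum_boundedI(1)[OF in_H bound[OF n]])
        have "(hnorm (l2sum H) (X n - x))\<^sup>2 \<le> e\<^sup>2" by (rule l2sum_boundedI(2)[OF in_H bound[OF n]])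
        then show "hnorm (l2sum H) (X n - x) \<le> e" by (rule power2_le_imp_le) (use e in simp)
      qed
    qed
    then show ?thesis by blast
  qed
  obtain N where "X N - x \<in> vecs (l2sum H)" using tail[of 1] by auto
  then have "X N - (X N - x) \<in> vecs (l2sum H)" by (rule L.diff_in[OF X])
  moreover have "X N - (X N - x) = x" by (rule ext) simp
  ultimately have x_in: "x \<in> vecs (l2sum H)" by (simp only:)
  have "hconv (l2sum H) X x"
    unfolding hconv_def LIMSEQ_iff
  proof (intro allI impI)
    fix r :: real assume "r > 0"
    then obtain N where "\<forall>n\<ge>N. hnorm (l2sum H) (X n - x) \<le> r / 2" using tail[of "r / 2"] by auto
    then show "\<exists>no. \<forall>n\<ge>no. norm (hnorm (l2sum H) (X n - x) - 0) < r"
      using \<open>r > 0\<close> x_in L.hnorm_nonneg[OF L.diff_in[OF X x_in]]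
      by (intro exI[of _ N]) (auto intro: le_less_trans)
  qed
  with x_in show "\<exists>x\<in>vecs (l2sum H). hconv (l2sum H) X x" by blast
qed

lemma hseparable_l2sum: "hseparable (l2sum H :: ('i::countable \<Rightarrow> 'a) hspace)"
proof -
  interpret L: semi_hspace "l2sum H :: ('i \<Rightarrow> 'a) hspace" by (rule semi_hspace_l2sum)
  obtain D where D: "countable D" "D \<subseteq> vecs H" "\<And>x e. x \<in> vecs H \<Longrightarrow> e > 0 \<Longrightarrow> \<exists>d\<in>D. hnorm H (x - d) < e"
    using separable unfolding hseparable_def by blast
  \<comment> \<open>Finitely supported families with entries in D on the support. Extensional
    functions on a finite set keep each piece countable; the image then fills in zeros.\<close>
  define DD where "DD = (\<Union>A\<in>Collect finite. (\<lambda>g i. if i \<in> A then g i else 0) ` (PiE A (\<lambda>_::'i. D)))"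
  have fin: "(\<lambda>i. if i \<in> A then g i else 0) \<in> vecs (l2sum H)"
    if A: "finite A" and g: "\<And>i. i \<in> A \<Longrightarrow> g i \<in> vecs H" for A :: "'i set" and g
  proof (rule l2sum_boundedI(1))
    fix B :: "'i set" assume B: "finite B"
    have "(\<Sum>i\<in>B. (hnorm H (if i \<in> A then g i else 0))\<^sup>2) = (\<Sum>i\<in>B \<inter> A. (hnorm H (g i))\<^sup>2)"
      using B by (intro sum.mono_neutral_cong_right) auto
    also have "\<dots> \<le> (\<Sum>i\<in>A. (hnorm H (g i))\<^sup>2)" using A by (intro sum_mono2) auto
    finally show "(\<Sum>i\<in>B. (hnorm H (if i \<in> A then g i else 0))\<^sup>2) \<le> (\<Sum>i\<in>A. (hnorm H (g i))\<^sup>2)" .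
  qed (use g in simp)
  show ?thesis
    unfolding hseparable_def
  proof (intro exI conjI ballI allI impI)
    show "countable DD"
      unfolding DD_def using D(1) by (intro countable_UN countable_Collect_finite countable_image countable_PiE) auto
    show "DD \<subseteq> vecs (l2sum H)"
      unfolding DD_def using D(2) by (auto intro!: fin simp: PiE_def Pi_def)
    fix f :: "'i \<Rightarrow> 'a" and e :: real assume f: "f \<in> vecs (l2sum H)" and e: "0 < e"
    obtain A where A: "finite A" and tail: "hnorm (l2sum H) (f - (\<lambda>i. if i \<in> A then f i else 0)) < e / 2"
      and tail_in: "f - (\<lambda>i. if i \<in> A then f i else 0) \<in> vecs (l2sum H)"
      using l2sum_truncate[OF f, of "e / 2"] e by auto
    \<comment> \<open>Chosen so that (card A + 1) \<delta> = e / 2, which bounds the error on A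
      because card A \<le> (card A + 1)^2. The summand 1 keeps the quotient meaningful for empty
      A.\<close>
    define \<delta> where "\<delta> = e / (2 * (card A + 1))"
    have "\<delta> > 0" using e by (simp add: \<delta>_def)
    have "\<forall>i. \<exists>d\<in>D. hnorm H (f i - d) < \<delta>" using D(3) l2sum_component[OF f] \<open>\<delta> > 0\<close> by blast
    then obtain g where g: "\<And>i. g i \<in> D" "\<And>i. hnorm H (f i - g i) < \<delta>" by metis
    define h where "h = (\<lambda>i. if i \<in> A then g i else 0)"
    have h_DD: "h \<in> DD"
      unfolding DD_def h_def using A g
      by (auto intro!: bexI[of _ A] image_eqI[of _ _ "restrict g A"] simp: PiE_def fun_eq_iff)
    have diff: "(\<lambda>i. if i \<in> A then f i else 0) - h = (\<lambda>i. if i \<in> A then f i - g i else 0)"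
      by (auto simp: h_def fun_eq_iff)
    have fg: "f i - g i \<in> vecs H" for i by (rule diff_in[OF l2sum_component[OF f] subsetD[OF D(2) g(1)]])
    have "(hnorm (l2sum H) ((\<lambda>i. if i \<in> A then f i else 0) - h))\<^sup>2 \<le> (e / 2)\<^sup>2"
      unfolding diff
    proof (rule l2sum_boundedI(2))
      fix B :: "'i set" assume B: "finite B"
      have "(\<Sum>i\<in>B. (hnorm H (if i \<in> A then f i - g i else 0))\<^sup>2) = (\<Sum>i\<in>B \<inter> A. (hnorm H (f i - g i))\<^sup>2)"
        using B by (intro sum.mono_neutral_cong_right) auto
      also have "\<dots> \<le> (\<Sum>i\<in>A. (hnorm H (f i - g i))\<^sup>2)" using A by (intro sum_mono2) auto
      also have "\<dots> \<le> (\<Sum>i\<in>A. \<delta>\<^sup>2)"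
        using g(2) fg by (intro sum_mono power_mono) (auto intro: less_imp_le)
      also have "\<dots> = card A * \<delta>\<^sup>2" by simp
      also have "\<dots> \<le> (card A + 1)\<^sup>2 * \<delta>\<^sup>2"
        by (intro mult_right_mono) (auto simp: power2_eq_square)
      also have "\<dots> = (e / 2)\<^sup>2"
      proof -
        have "(1 + real (card A)) * \<delta> = e / 2" by (simp add: \<delta>_def field_simps)
        from arg_cong[OF this, of "\<lambda>x. x\<^sup>2"] show ?thesis by (simp add: power_mult_distrib)
      qed
      finally show "(\<Sum>i\<in>B. (hnorm H (if i \<in> A then f i - g i else 0))\<^sup>2) \<le> (e / 2)\<^sup>2" .
    qed (use fg in simp)
    then have "hnorm (l2sum H) ((\<lambda>i. if i \<in> A then f i else 0) - h) \<le> e / 2"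
      by (rule power2_le_imp_le) (use e in simp)
    moreover have "(\<lambda>i. if i \<in> A then f i else 0) \<in> vecs (l2sum H)" "h \<in> vecs (l2sum H)"
      using A g D(2) l2sum_component[OF f] unfolding h_def by (auto intro!: fin)
    ultimately have "hnorm (l2sum H) (f - h) < e"
      using L.hnorm_triangle_via[OF f, of "\<lambda>i. if i \<in> A then f i else 0" h] tail by linarith
    then show "\<exists>d\<in>DD. hnorm (l2sum H) (f - d) < e" using h_DD by blast
  qed
qed

lemma hilbert_l2sum: "hilbert (l2sum H :: ('i::countable \<Rightarrow> 'a) hspace)"
proof -
  interpret L: semi_hspace "l2sum H :: ('i \<Rightarrow> 'a) hspace" by (rule semi_hspace_l2sum)
  show ?thesis
  proof
    fix f :: "'i \<Rightarrow> 'a" assume f: "f \<in> vecs (l2sum H)" "ip (l2sum H) f f = 0"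
    then have "hnorm (l2sum H) f = 0" by (simp add: hnorm_def)
    then have "hnorm H (f i) = 0" for i
      using component_le_hnorm_l2sum[OF f(1), of i] hnorm_nonneg[OF l2sum_component[OF f(1)], of i] by linarith
    then show "f = 0" using hnorm_eq_0 l2sum_component[OF f(1)] by (auto simp: fun_eq_iff)
  qed (rule hcomplete_l2sum hseparable_l2sum)+
qed

end

section \<open>The Drury-Arveson space\<close>

text \<open>Moves a Hilbert space along an injective linear map J. An abstract construction thereby
  becomes a space of functions on the ball, as \<open>is_rkhs\<close> and \<open>is_tensor\<close>
  require.\<close>

definition transport :: "'a hspace \<Rightarrow> ('a \<Rightarrow> 'b) \<Rightarrow> 'b hspace" where
  "transport H J = \<lparr>vecs = J ` vecs H,
     ip = \<lambda>f g. ip H (inv_into (vecs H) J f) (inv_into (vecs H) J g)\<rparr>"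

lemma vecs_transport [simp]: "vecs (transport H J) = J ` vecs H"
  by (simp add: transport_def)

context hilbert
begin

context
  fixes J :: "'a \<Rightarrow> 'b::complex_vector"
  assumes J_add: "\<And>x y. x \<in> vecs H \<Longrightarrow> y \<in> vecs H \<Longrightarrow> J (x + y) = J x + J y"
    and J_scale: "\<And>c x. x \<in> vecs H \<Longrightarrow> J (c *\<^sub>C x) = c *\<^sub>C J x"
    and J_inj: "\<And>x. x \<in> vecs H \<Longrightarrow> J x = 0 \<Longrightarrow> x = 0"
begin

lemma transport_diff: "x \<in> vecs H \<Longrightarrow> y \<in> vecs H \<Longrightarrow> J (x - y) = J x - J y"
  using J_add[of "x - y" y] by simp

lemma inj_on_transport: "inj_on J (vecs H)"
proof (rule inj_onI)
  fix x y assume xy: "x \<in> vecs H" "y \<in> vecs H" "J x = J y"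
  then have "J (x - y) = 0" by (simp add: transport_diff)
  then show "x = y" using J_inj[of "x - y"] xy by simp
qed

lemma ip_transport: "x \<in> vecs H \<Longrightarrow> y \<in> vecs H \<Longrightarrow> ip (transport H J) (J x) (J y) = ip H x y"
  by (simp add: transport_def inv_into_f_f[OF inj_on_transport])

lemma hnorm_transport: "x \<in> vecs H \<Longrightarrow> hnorm (transport H J) (J x) = hnorm H x"
  by (simp add: hnorm_def ip_transport)

lemma hnorm_transport_diff:
  "x \<in> vecs H \<Longrightarrow> y \<in> vecs H \<Longrightarrow> hnorm (transport H J) (J x - J y) = hnorm H (x - y)"
  by (simp add: hnorm_transport flip: transport_diff)

lemma hilbert_transport: "hilbert (transport H J)"
proof
  show "cvs.subspace (vecs (transport H J))"
  proof (rule cvs.subspaceI)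
    have "J 0 = 0" using transport_diff[of 0 0] by simp
    then show "0 \<in> vecs (transport H J)" using zero_in by force
  qed (auto simp flip: J_add J_scale)
  show "hcomplete (transport H J)"
    unfolding hcomplete_def
  proof (intro allI impI, elim conjE)
    fix X assume "\<forall>k. X k \<in> vecs (transport H J)"
      and cauchy: "\<forall>e>0. \<exists>N::nat. \<forall>j\<ge>N. \<forall>k\<ge>N. hnorm (transport H J) (X j - X k) < e"
    then have "\<forall>k. \<exists>y. y \<in> vecs H \<and> X k = J y" by auto
    then obtain Y where Y: "\<And>k. Y k \<in> vecs H" "X = (\<lambda>k. J (Y k))" by metis
    have "\<exists>N::nat. \<forall>j\<ge>N. \<forall>k\<ge>N. hnorm H (Y j - Y k) < e" if "e > 0" for e
      using cauchy that by (simp add: Y hnorm_transport_diff)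
    from cauchy_convergent[of Y, OF Y(1) this] obtain y where "y \<in> vecs H" "hconv H Y y" by blast
    then show "\<exists>x\<in>vecs (transport H J). hconv (transport H J) X x"
      by (intro bexI[of _ "J y"]) (simp_all add: hconv_def Y hnorm_transport_diff)
  qed
  obtain D where D: "countable D" "D \<subseteq> vecs H" "\<And>x e. x \<in> vecs H \<Longrightarrow> e > 0 \<Longrightarrow> \<exists>d\<in>D. hnorm H (x - d) < e"
    using separable unfolding hseparable_def by blast
  show "hseparable (transport H J)"
    unfolding hseparable_def
  proof (intro exI conjI ballI allI impI)
    show "countable (J ` D)" using D(1) by simp
    show "J ` D \<subseteq> vecs (transport H J)" using D(2) by auto
    fix f and e :: real assume "f \<in> vecs (transport H J)" "0 < e"
    then obtain x where x: "x \<in> vecs H" "f = J x" by auto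
    obtain d where d: "d \<in> D" "hnorm H (x - d) < e" using D(3)[OF x(1) \<open>0 < e\<close>] by blast
    then have "hnorm (transport H J) (f - J d) < e"
      using x D(2) by (auto simp: hnorm_transport_diff)
    with d show "\<exists>d\<in>J ` D. hnorm (transport H J) (f - d) < e" by blast
  qed
next
  fix f g assume "f \<in> vecs (transport H J)" "g \<in> vecs (transport H J)"
  then obtain x y where xy: "x \<in> vecs H" "f = J x" "y \<in> vecs H" "g = J y" by auto
  show "ip (transport H J) (c *\<^sub>C f) g = c * ip (transport H J) f g" for c
    using xy by (simp add: ip_transport ip_scale_left flip: J_scale)
  show "ip (transport H J) g f = cnj (ip (transport H J) f g)"
    unfolding xy(2,4) ip_transport[OF xy(1,3)] ip_transport[OF xy(3,1)] by (rule ip_commute[OF xy(1,3)])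
  fix h assume "h \<in> vecs (transport H J)"
  then obtain z where z: "z \<in> vecs H" "h = J z" by auto
  show "ip (transport H J) (f + g) h = ip (transport H J) f h + ip (transport H J) g h"
    using xy z by (simp add: ip_transport ip_add_left flip: J_add)
next
  fix f assume "f \<in> vecs (transport H J)"
  then obtain x where x: "x \<in> vecs H" "f = J x" by auto
  show "0 \<le> Re (ip (transport H J) f f)"
    using x by (simp add: ip_transport ip_self_nonneg)
  assume "ip (transport H J) f f = 0"
  then have "x = 0" using x ip_definite[of x] by (simp add: ip_transport)
  then show "f = 0" using transport_diff[of 0 0] x by simp
qed

end

text \<open>Elements h become the functions z |-> <h, \<phi> z>. Passing to the double orthogonal
  complement M of the features, which still contains them, makes this map injective, and the
  function of \<open>\<phi> w\<close> is the kernel at w.\<close>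

lemma rkhs_of_features:
  fixes \<phi> :: "complex ^ 'n::finite \<Rightarrow> 'a"
  assumes \<phi>: "\<And>z. z \<in> unit_ball \<Longrightarrow> \<phi> z \<in> vecs H"
    and K: "\<And>z w. z \<in> unit_ball \<Longrightarrow> w \<in> unit_ball \<Longrightarrow> K z w = ip H (\<phi> w) (\<phi> z)"
  shows "\<exists>D. is_rkhs K D"
proof -
  define N where "N = {h \<in> vecs H. \<forall>a\<in>\<phi> ` unit_ball. ip H h a = 0}"
  define M where "M = {h \<in> vecs H. \<forall>a\<in>N. ip H h a = 0}"
  have M: "closed_csubspace H M"
    unfolding M_def by (rule closed_csubspace_orthogonal) (simp add: N_def)
  define G where "G = H\<lparr>vecs := M\<rparr>"
  have [simp]: "vecs G = M" "ip G = ip H" by (simp_all add: G_def)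
  interpret G: hilbert G unfolding G_def by (rule hilbert_closed_subspace[OF M])
  have M_in: "x \<in> M \<Longrightarrow> x \<in> vecs H" for x by (simp add: M_def)
  define J where "J h = (\<lambda>z. if z \<in> unit_ball then ip H h (\<phi> z) else 0)" for h
  have J_add: "J (x + y) = J x + J y" if "x \<in> vecs G" "y \<in> vecs G" for x y
    using that \<phi> by (auto simp: J_def fun_eq_iff ip_add_left M_in)
  have J_scale: "J (c *\<^sub>C x) = c *\<^sub>C J x" if "x \<in> vecs G" for c x
    using that \<phi> by (auto simp: J_def fun_eq_iff ip_scale_left M_in scaleC_fun_def scaleC_complex_def)
  have J_inj: "x = 0" if x: "x \<in> vecs G" and J: "J x = 0" for x
  proof -
    have "x \<in> M" using x by simp
    have "ip H x (\<phi> z) = 0" if "z \<in> unit_ball" for z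
      using fun_cong[OF J, of z] that by (simp add: J_def)
    then have "x \<in> N" using M_in[OF \<open>x \<in> M\<close>] by (simp add: N_def)
    then have "ip H x x = 0" using \<open>x \<in> M\<close> by (simp add: M_def)
    then show ?thesis using ip_definite M_in \<open>x \<in> M\<close> by blast
  qed
  note J = J_add J_scale J_inj
  have \<phi>_M: "\<phi> w \<in> M" if w: "w \<in> unit_ball" for w
  proof -
    have "ip H (\<phi> w) a = 0" if "a \<in> N" for a
    proof -
      have "ip H a (\<phi> w) = 0" "a \<in> vecs H" using that w by (auto simp: N_def)
      then show ?thesis using ip_commute[OF _ \<phi>[OF w], of a] by simp
    qed
    then show ?thesis using \<phi>[OF w] by (simp add: M_def)
  qed
  have kernel: "kernel_fun K w = J (\<phi> w)" if "w \<in> unit_ball" for w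
    using that K by (auto simp: kernel_fun_def J_def fun_eq_iff)
  have "is_rkhs K (transport G J)"
    unfolding is_rkhs_def hilbert_space_iff
  proof (intro conjI ballI allI impI)
    show "hilbert (transport G J)" by (rule G.hilbert_transport[OF J])
    show "f w = 0" if "f \<in> vecs (transport G J)" "w \<notin> unit_ball" for f w
      using that by (auto simp: J_def)
    fix w :: "complex ^ 'n" assume w: "w \<in> unit_ball"
    show "kernel_fun K w \<in> vecs (transport G J)" using kernel[OF w] \<phi>_M[OF w] by simp
    fix f assume "f \<in> vecs (transport G J)"
    then obtain h where h: "h \<in> M" "f = J h" by auto
    have "ip (transport G J) f (kernel_fun K w) = ip G h (\<phi> w)"
      unfolding h(2) kernel[OF w] using h(1) \<phi>_M[OF w] by (intro G.ip_transport[OF J]) simp_all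
    then show "ip (transport G J) f (kernel_fun K w) = f w" using h w by (simp add: J_def)
  qed
  then show ?thesis by blast
qed

end

section \<open>Scalars, square-summable families and sums over words\<close>

definition scalar_hspace :: "complex hspace" where
  "scalar_hspace = \<lparr>vecs = UNIV, ip = \<lambda>x y. x * cnj y\<rparr>"

lemma vecs_scalar [simp]: "vecs scalar_hspace = UNIV"
  and ip_scalar [simp]: "ip scalar_hspace x y = x * cnj y"
  by (simp_all add: scalar_hspace_def)

lemma hnorm_scalar [simp]: "hnorm scalar_hspace = cmod"
  by (simp add: fun_eq_iff hnorm_def cmod_def power2_eq_square)

lemma hilbert_scalar: "hilbert scalar_hspace"
proof
  show "hcomplete scalar_hspace"
    unfolding hcomplete_def
  proof (intro allI impI, elim conjE)
    fix X :: "nat \<Rightarrow> complex"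
    assume "\<forall>e>0. \<exists>N. \<forall>j\<ge>N. \<forall>k\<ge>N. hnorm scalar_hspace (X j - X k) < e"
    then have "Cauchy X" by (simp add: Cauchy_def dist_norm)
    then obtain x where "X \<longlonglongrightarrow> x" using Cauchy_convergent convergent_def by blast
    then show "\<exists>x\<in>vecs scalar_hspace. hconv scalar_hspace X x"
      by (auto simp: hconv_def tendsto_norm_zero_iff LIM_zero_iff)
  qed
  obtain D :: "complex set" where D: "countable D" "\<And>U. open U \<Longrightarrow> U \<noteq> {} \<Longrightarrow> \<exists>d\<in>D. d \<in> U"
    by (rule countable_dense_setE) blast
  show "hseparable scalar_hspace"
    unfolding hseparable_def
  proof (intro exI conjI ballI allI impI)
    show "countable D" by (rule D(1))
    fix x :: complex and e :: real assume "0 < e"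
    then show "\<exists>d\<in>D. hnorm scalar_hspace (x - d) < e"
      using D(2)[of "ball x e"] by (auto simp: dist_norm)
  qed simp
qed (auto simp: scaleC_complex_def algebra_simps cvs.subspace_UNIV)

definition ell2 :: "('i \<Rightarrow> complex) hspace" where
  "ell2 = l2sum scalar_hspace"

lemma hilbert_ell2: "hilbert (ell2 :: ('i::countable \<Rightarrow> complex) hspace)"
  unfolding ell2_def by (rule hilbert.hilbert_l2sum[OF hilbert_scalar])

lemma ell2_iff: "f \<in> vecs ell2 \<longleftrightarrow> (\<lambda>i. (cmod (f i))\<^sup>2) summable_on UNIV"
  by (simp add: ell2_def l2sum_def)

lemma ell2_ip_has_sum:
  assumes "f \<in> vecs ell2" "g \<in> vecs ell2"
  shows "((\<lambda>i. f i * cnj (g i)) has_sum ip ell2 f g) UNIV"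
proof -
  interpret S: hilbert scalar_hspace by (rule hilbert_scalar)
  show ?thesis using S.l2sum_ip_has_sum assms unfolding ell2_def by fastforce
qed

lemma sum_prod_list_le:
  fixes a :: "'n::finite \<Rightarrow> real"
  assumes a: "\<And>i. 0 \<le> a i" and a1: "(\<Sum>i\<in>UNIV. a i) < 1"
  shows "(\<Sum>ws | length ws \<le> m. prod_list (map a ws)) \<le> 1 / (1 - (\<Sum>i\<in>UNIV. a i))"
proof (induction m)
  case 0
  have "0 \<le> sum a UNIV" using a by (simp add: sum_nonneg)
  then show ?case using a1 by (simp add: field_simps)
next
  case (Suc m)
  let ?r = "\<Sum>i\<in>UNIV. a i"
  let ?L = "\<lambda>m. {ws :: 'n list. length ws \<le> m}"
  have fin: "finite (?L m)" using finite_lists_length_le[of "UNIV :: 'n set" m] by simp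
  \<comment> \<open>A word is empty or a letter followed by a shorter word. With r the sum of the
    letters the partial sums thus satisfy S(m + 1) = 1 + r S(m), and the bound 1 / (1 - r) is the
    fixed point of this recursion.\<close>
  have eq: "?L (Suc m) = insert [] ((\<lambda>(i, ws). i # ws) ` (UNIV \<times> ?L m))"
    by (auto simp: image_iff) (metis Suc_le_mono length_Cons neq_Nil_conv)
  have inj: "inj_on (\<lambda>(i, ws). i # ws) (UNIV \<times> ?L m)" by (auto simp: inj_on_def)
  have "(\<Sum>ws\<in>?L (Suc m). prod_list (map a ws)) = 1 + (\<Sum>p\<in>UNIV \<times> ?L m. a (fst p) * prod_list (map a (snd p)))"
    unfolding eq using fin by (subst sum.insert) (auto simp: sum.reindex[OF inj, unfolded case_prod_unfold] case_prod_unfold)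
  also have "(\<Sum>p\<in>UNIV \<times> ?L m. a (fst p) * prod_list (map a (snd p))) = ?r * (\<Sum>ws\<in>?L m. prod_list (map a ws))"
    by (simp add: sum_product sum.cartesian_product case_prod_unfold)
  also have "\<dots> \<le> ?r * (1 / (1 - ?r))"
    using a by (intro mult_left_mono Suc) (simp add: sum_nonneg)
  also have "1 + ?r * (1 / (1 - ?r)) = 1 / (1 - ?r)" using a1 by (simp add: field_simps)
  finally show ?case by simp
qed

lemma summable_prod_list:
  fixes a :: "'n::finite \<Rightarrow> real"
  assumes a: "\<And>i. 0 \<le> a i" and a1: "(\<Sum>i\<in>UNIV. a i) < 1"
  shows "(\<lambda>ws. prod_list (map a ws)) summable_on UNIV"
proof (rule nonneg_bdd_above_summable_on)
  have nonneg: "0 \<le> prod_list (map a ws)" for ws by (rule prod_list_nonneg) (use a in auto)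
  then show "0 \<le> prod_list (map a ws)" for ws .
  show "bdd_above (sum (\<lambda>ws. prod_list (map a ws)) ` {F. F \<subseteq> UNIV \<and> finite F})"
  proof (rule bdd_aboveI2)
    fix F :: "'n list set" assume "F \<in> {F. F \<subseteq> UNIV \<and> finite F}"
    then have F: "finite F" by simp
    define m where "m = Max (insert 0 (length ` F))"
    have "F \<subseteq> {ws. length ws \<le> m}" using F by (auto simp: m_def)
    moreover have "finite {ws :: 'n list. length ws \<le> m}"
      using finite_lists_length_le[of "UNIV :: 'n set" m] by simp
    ultimately have "(\<Sum>ws\<in>F. prod_list (map a ws)) \<le> (\<Sum>ws | length ws \<le> m. prod_list (map a ws))"
      using nonneg by (intro sum_mono2) auto
    also have "\<dots> \<le> 1 / (1 - (\<Sum>i\<in>UNIV. a i))" by (rule sum_prod_list_le[OF assms])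
    finally show "(\<Sum>ws\<in>F. prod_list (map a ws)) \<le> 1 / (1 - (\<Sum>i\<in>UNIV. a i))" .
  qed
qed

text \<open>Geometric series without multinomial coefficients, since words replace multi-indices.
  Splitting off the first letter of the absolutely convergent sum s gives s = 1 + r s, which
  determines s.\<close>

lemma infsum_prod_list:
  fixes a :: "'n::finite \<Rightarrow> complex"
  assumes a1: "(\<Sum>i\<in>UNIV. cmod (a i)) < 1"
  shows "(\<Sum>\<^sub>\<infinity>ws. prod_list (map a ws)) = inverse (1 - (\<Sum>i\<in>UNIV. a i))"
proof -
  let ?p = "\<lambda>ws. prod_list (map a ws)"
  have norm_p: "norm (?p ws) = prod_list (map (\<lambda>i. cmod (a i)) ws)" for ws
    by (induction ws) (simp_all add: norm_mult)
  have "(\<lambda>ws. norm (?p ws)) summable_on UNIV"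
    unfolding norm_p using a1 by (intro summable_prod_list) simp_all
  then have p: "?p summable_on UNIV" by (rule abs_summable_summable)
  have inj: "inj_on (\<lambda>(i :: 'n, ws). i # ws) UNIV" by (auto simp: inj_on_def)
  have UNIV_eq: "(UNIV :: 'n list set) = insert [] (range (\<lambda>(i, ws). i # ws))"
    by (auto simp: image_iff) (metis neq_Nil_conv)
  have sub: "?p summable_on range (\<lambda>(i, ws). i # ws)"
    by (rule summable_on_subset_banach[OF p]) simp
  then have prod: "(\<lambda>(i, ws). a i * ?p ws) summable_on UNIV \<times> UNIV"
    using summable_on_reindex[OF inj, of ?p] by (simp add: o_def case_prod_unfold)
  have "infsum ?p UNIV = 1 + infsum ?p (range (\<lambda>(i, ws). i # ws))"
  proof -
    have "[] \<notin> range (\<lambda>(i :: 'n, ws). i # ws)" by auto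
    from infsum_insert[OF sub this] show ?thesis by (subst UNIV_eq) simp
  qed
  also have "infsum ?p (range (\<lambda>(i, ws). i # ws)) = (\<Sum>\<^sub>\<infinity>(i, ws)\<in>UNIV \<times> UNIV. a i * ?p ws)"
    by (simp add: infsum_reindex[OF inj, unfolded case_prod_unfold] o_def case_prod_unfold)
  also have "\<dots> = (\<Sum>\<^sub>\<infinity>i. \<Sum>\<^sub>\<infinity>ws. a i * ?p ws)"
    by (rule infsum_Sigma'_banach[OF prod, symmetric])
  also have "\<dots> = (\<Sum>i\<in>UNIV. a i) * infsum ?p UNIV"
    by (simp add: infsum_cmult_right' sum_distrib_right)
  finally have rec: "infsum ?p UNIV = 1 + (\<Sum>i\<in>UNIV. a i) * infsum ?p UNIV" .
  have "s = 1 + r * s \<Longrightarrow> (1 - r) * s = 1" for s r :: complex by algebra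
  from inverse_unique[OF this[OF rec]] show ?thesis by (rule sym)
qed

lemma sum_cmod_mult_less_1:
  fixes z w :: "complex ^ 'n::finite"
  assumes "z \<in> unit_ball" "w \<in> unit_ball"
  shows "(\<Sum>i\<in>UNIV. cmod (z $ i) * cmod (w $ i)) < 1"
proof -
  have "(\<Sum>i\<in>UNIV. cmod (z $ i) * cmod (w $ i)) \<le> norm z * norm w"
    using L2_set_mult_ineq[of "\<lambda>i. cmod (z $ i)" "\<lambda>i. cmod (w $ i)" UNIV]
    by (simp add: norm_vec_def)
  also have "\<dots> < 1" using assms mult_strict_mono'[of "norm z" 1 "norm w" 1] by simp
  finally show ?thesis .
qed

lemma drury_arveson_denominator:
  fixes z w :: "complex ^ 'n::finite"
  assumes "z \<in> unit_ball" "w \<in> unit_ball"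
  shows "1 - (\<Sum>i\<in>UNIV. z $ i * cnj (w $ i)) \<noteq> 0"
proof -
  have "cmod (\<Sum>i\<in>UNIV. z $ i * cnj (w $ i)) \<le> (\<Sum>i\<in>UNIV. cmod (z $ i) * cmod (w $ i))"
    by (intro order.trans[OF norm_sum]) (simp add: norm_mult)
  then have "cmod (\<Sum>i\<in>UNIV. z $ i * cnj (w $ i)) < 1"
    using sum_cmod_mult_less_1[OF assms] by simp
  then show ?thesis by auto
qed

text \<open>The features are the words in the coordinates, i.e. the Drury-Arveson space is the symmetric
  part of the full Fock space.\<close>

lemma ex_drury_arveson_rkhs:
  "\<exists>D :: (complex ^ 'n::finite \<Rightarrow> complex) hspace. is_rkhs drury_arveson_kernel D"
proof -
  \<comment> \<open>The conjugate is forced by the convention K(z, w) = <\<phi> w, \<phi> z> with an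
    inner product linear in its first argument: it makes the kernel holomorphic in z.\<close>
  define \<phi> where "\<phi> z ws = cnj (prod_list (map (\<lambda>i. z $ i) ws))" for z :: "complex ^ 'n" and ws
  interpret L: hilbert "ell2 :: ('n list \<Rightarrow> complex) hspace" by (rule hilbert_ell2)
  have \<phi>: "\<phi> z \<in> vecs ell2" if z: "z \<in> unit_ball" for z :: "complex ^ 'n"
  proof -
    have "(cmod (\<phi> z ws))\<^sup>2 = prod_list (map (\<lambda>i. cmod (z $ i) * cmod (z $ i)) ws)" for ws
      by (induction ws) (simp_all add: \<phi>_def norm_mult power2_eq_square mult_ac)
    then show ?thesis
      unfolding ell2_iff using summable_prod_list[OF _ sum_cmod_mult_less_1[OF z z]] by simp
  qed
  show ?thesis
  proof (rule L.rkhs_of_features[of \<phi>])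
    fix z w :: "complex ^ 'n" assume z: "z \<in> unit_ball" and w: "w \<in> unit_ball"
    have "\<phi> w ws * cnj (\<phi> z ws) = prod_list (map (\<lambda>i. z $ i * cnj (w $ i)) ws)" for ws
      by (induction ws) (simp_all add: \<phi>_def mult_ac)
    then have "ip ell2 (\<phi> w) (\<phi> z) = (\<Sum>\<^sub>\<infinity>ws. prod_list (map (\<lambda>i. z $ i * cnj (w $ i)) ws))"
      using infsumI[OF ell2_ip_has_sum[OF \<phi>[OF w] \<phi>[OF z]]] by simp
    also have "\<dots> = drury_arveson_kernel z w"
      using sum_cmod_mult_less_1[OF z w]
      by (subst infsum_prod_list) (simp_all add: norm_mult drury_arveson_kernel_def)
    finally show "drury_arveson_kernel z w = ip ell2 (\<phi> w) (\<phi> z)" ..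
  qed (rule \<phi>)
qed

section \<open>The tensor product with square-summable sequences\<close>

lemma sum_fun_apply: "(\<Sum>i\<in>A. f i) x = (\<Sum>i\<in>A. f i x)" for f :: "'i \<Rightarrow> 'x \<Rightarrow> 'a::ab_group_add"
  by (induction A rule: infinite_finite_induct) simp_all

lemma is_rkhs_hilbert: "is_rkhs K D \<Longrightarrow> hilbert D"
  by (simp add: is_rkhs_def hilbert_space_iff)

lemma is_rkhs_kernel: "is_rkhs K D \<Longrightarrow> w \<in> unit_ball \<Longrightarrow> kernel_fun K w \<in> vecs D"
  unfolding is_rkhs_def by blast

lemma is_rkhs_reproducing:
  "is_rkhs K D \<Longrightarrow> f \<in> vecs D \<Longrightarrow> w \<in> unit_ball \<Longrightarrow> ip D f (kernel_fun K w) = f w"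
  unfolding is_rkhs_def by blast

lemma is_rkhs_outside: "is_rkhs K D \<Longrightarrow> f \<in> vecs D \<Longrightarrow> w \<notin> unit_ball \<Longrightarrow> f w = 0"
  unfolding is_rkhs_def by blast

text \<open>The tensor product is the Hilbert sum of countably many copies of D, transposed by J: a
  sequence of scalar functions is read as one sequence-valued function.\<close>

lemma ex_tensor_ell2:
  assumes rkhs: "is_rkhs K (D :: (complex ^ 'n::finite \<Rightarrow> complex) hspace)"
  shows "\<exists>F. is_tensor D (ell2 :: (nat \<Rightarrow> complex) hspace) F"
proof -
  interpret D: hilbert D by (rule is_rkhs_hilbert[OF rkhs])
  interpret S: hilbert scalar_hspace by (rule hilbert_scalar)
  interpret E: hilbert "ell2 :: (nat \<Rightarrow> complex) hspace" by (rule hilbert_ell2)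
  define L where "L = (l2sum D :: (nat \<Rightarrow> complex ^ 'n \<Rightarrow> complex) hspace)"
  interpret L: hilbert L unfolding L_def by (rule D.hilbert_l2sum)
  define J :: "(nat \<Rightarrow> complex ^ 'n \<Rightarrow> complex) \<Rightarrow> complex ^ 'n \<Rightarrow> nat \<Rightarrow> complex"
    where "J G = (\<lambda>z k. G k z)" for G
  have J_add: "J (x + y) = J x + J y" if "x \<in> vecs L" "y \<in> vecs L" for x y by (simp add: J_def fun_eq_iff)
  have J_scale: "J (c *\<^sub>C x) = c *\<^sub>C J x" if "x \<in> vecs L" for c x by (simp add: J_def fun_eq_iff scaleC_fun_def)
  have J_inj: "x = 0" if "x \<in> vecs L" "J x = 0" for x
    using that(2) by (metis J_def ext zero_fun_apply)
  note J = J_add J_scale J_inj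
  have ip_J: "ip (transport L J) (J x) (J y) = ip L x y" if "x \<in> vecs L" "y \<in> vecs L" for x y
    using that by (intro L.ip_transport[OF J])
  have hnorm_J: "hnorm (transport L J) (J x) = hnorm L x" if "x \<in> vecs L" for x
    using that by (intro L.hnorm_transport[OF J])
  define F where "F = transport L J"
  have comp: "G k \<in> vecs D" if "G \<in> vecs L" for G k
    using that unfolding L_def by (rule l2sum_component)
  have tensor_eq: "elementary_tensor f \<eta> = J (\<lambda>k. \<eta> k *\<^sub>C f)"
    for f :: "complex ^ 'n \<Rightarrow> complex" and \<eta> :: "nat \<Rightarrow> complex"
    by (simp add: elementary_tensor_def J_def fun_eq_iff scaleC_fun_def scaleC_complex_def mult.commute)
  have tensor_in: "(\<lambda>k. \<eta> k *\<^sub>C f) \<in> vecs L" if f: "f \<in> vecs D" and \<eta>: "\<eta> \<in> vecs ell2" for f and \<eta> :: "nat \<Rightarrow> complex"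
    unfolding L_def
  proof (rule D.l2sum_boundedI(1))
    show "\<eta> k *\<^sub>C f \<in> vecs D" for k using f by simp
    fix A :: "nat set" assume A: "finite A"
    have "(\<Sum>k\<in>A. (cmod (\<eta> k))\<^sup>2) \<le> (hnorm ell2 \<eta>)\<^sup>2"
      using S.sum_le_hnorm_l2sum[OF \<eta>[unfolded ell2_def] A] by (simp add: ell2_def)
    then have "(\<Sum>k\<in>A. (cmod (\<eta> k))\<^sup>2) * (hnorm D f)\<^sup>2 \<le> (hnorm ell2 \<eta>)\<^sup>2 * (hnorm D f)\<^sup>2"
      by (intro mult_right_mono) simp_all
    then show "(\<Sum>k\<in>A. (hnorm D (\<eta> k *\<^sub>C f))\<^sup>2) \<le> (hnorm ell2 \<eta>)\<^sup>2 * (hnorm D f)\<^sup>2"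
      using f by (simp add: D.hnorm_scale power_mult_distrib sum_distrib_right)
  qed
  have "is_tensor D ell2 F"
    unfolding is_tensor_def hilbert_space_iff
  proof (intro conjI ballI allI impI)
    show "hilbert F" unfolding F_def by (rule L.hilbert_transport[of J, OF J])
    fix G and w :: "complex ^ 'n" assume "G \<in> vecs F" and w: "w \<notin> unit_ball"
    then obtain g where g: "g \<in> vecs L" "G = J g" unfolding F_def by auto
    show "G w = 0"
      using is_rkhs_outside[OF rkhs comp[OF g(1)] w] unfolding g(2) J_def by (simp add: fun_eq_iff)
  next
    fix f g and \<eta> \<zeta> :: "nat \<Rightarrow> complex" assume f: "f \<in> vecs D" and \<eta>: "\<eta> \<in> vecs ell2"
    show "elementary_tensor f \<eta> \<in> vecs F"
      using tensor_in[OF f \<eta>] by (simp add: F_def tensor_eq)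
    assume g: "g \<in> vecs D" and \<zeta>: "\<zeta> \<in> vecs ell2"
    have "ip F (elementary_tensor f \<eta>) (elementary_tensor g \<zeta>) = (\<Sum>\<^sub>\<infinity>k. ip D (\<eta> k *\<^sub>C f) (\<zeta> k *\<^sub>C g))"
      unfolding F_def tensor_eq ip_J[OF tensor_in[OF f \<eta>] tensor_in[OF g \<zeta>]] by (simp add: L_def ip_l2sum)
    also have "\<dots> = (\<Sum>\<^sub>\<infinity>k. ip D f g * (\<eta> k * cnj (\<zeta> k)))"
      using f g by (simp add: D.ip_scale_left D.ip_scale_right mult_ac)
    also have "\<dots> = ip D f g * ip ell2 \<eta> \<zeta>"
      using infsumI[OF ell2_ip_has_sum[OF \<eta> \<zeta>]] by (simp add: infsum_cmult_right')
    finally show "ip F (elementary_tensor f \<eta>) (elementary_tensor g \<zeta>) = ip D f g * ip ell2 \<eta> \<zeta>" .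
  next
    fix G and e :: real assume "G \<in> vecs F" and e: "0 < e"
    then obtain g where g: "g \<in> vecs L" "G = J g" unfolding F_def by auto
    obtain A where A: "finite A" "hnorm L (g - (\<lambda>i. if i \<in> A then g i else 0)) < e"
      "g - (\<lambda>i. if i \<in> A then g i else 0) \<in> vecs L"
      using D.l2sum_truncate[OF g(1)[unfolded L_def] e] unfolding L_def by blast
    obtain m where m: "A \<subseteq> {..<m}"
      using A(1) finite_nat_iff_bounded by blast
    \<comment> \<open>With the unit vectors \<eta> defined next, the truncation of g to A is the sum
      of the elementary tensors of \<open>f j\<close> and \<open>\<eta> j\<close>. The sum runs over
      an initial segment, so indices outside A receive 0.\<close>
    define f where "f j = (if j \<in> A then g j else 0)" for j
    define \<eta> :: "nat \<Rightarrow> nat \<Rightarrow> complex" where "\<eta> j = (\<lambda>k. if k = j then 1 else 0)" for j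
    have \<eta>: "\<eta> j \<in> vecs ell2" for j
      unfolding ell2_iff \<eta>_def by (rule finite_nonzero_values_imp_summable_on) auto
    have "(\<Sum>j<m. elementary_tensor (f j) (\<eta> j)) z k = (if k < m then f k z else 0)" for z k
    proof -
      have "(\<Sum>j<m. elementary_tensor (f j) (\<eta> j)) z k = (\<Sum>j<m. if j = k then f j z else 0)"
        unfolding sum_fun_apply
        by (intro sum.cong) (auto simp: elementary_tensor_def scaleC_fun_def scaleC_complex_def \<eta>_def)
      then show ?thesis by (simp add: sum.delta)
    qed
    moreover have "(if k < m then f k z else 0) = (if k \<in> A then g k else 0) z" for k z
      using m by (auto simp: f_def)
    ultimately have "(\<Sum>j<m. elementary_tensor (f j) (\<eta> j)) = J (\<lambda>i. if i \<in> A then g i else 0)"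
      by (simp add: J_def fun_eq_iff)
    then have "G - (\<Sum>j<m. elementary_tensor (f j) (\<eta> j)) = J (g - (\<lambda>i. if i \<in> A then g i else 0))"
      by (simp add: g(2) J_def fun_eq_iff)
    then have "hnorm F (G - (\<Sum>j<m. elementary_tensor (f j) (\<eta> j))) < e"
      using A(2) hnorm_J[OF A(3)] by (simp add: F_def)
    moreover have "f j \<in> vecs D" for j using comp[OF g(1)] by (simp add: f_def)
    ultimately show "\<exists>(m::nat) f \<eta>. (\<forall>j<m. f j \<in> vecs D \<and> \<eta> j \<in> vecs ell2) \<and>
        hnorm F (G - (\<Sum>j<m. elementary_tensor (f j) (\<eta> j))) < e"
      using \<eta> by (intro exI[of _ m] exI[of _ f] exI[of _ \<eta>]) simp
  next
    fix w :: "complex ^ 'n" assume w: "w \<in> unit_ball"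
    define C where "C = hnorm D (kernel_fun K w)"
    have kw: "kernel_fun K w \<in> vecs D" by (rule is_rkhs_kernel[OF rkhs w])
    have eval: "G w \<in> vecs ell2 \<and> hnorm ell2 (G w) \<le> C * hnorm F G" if G: "G \<in> vecs F" for G
    proof -
      obtain g where g: "g \<in> vecs L" "G = J g" using G unfolding F_def by auto
      have bound: "(\<Sum>k\<in>A. (hnorm scalar_hspace (G w k))\<^sup>2) \<le> (C * hnorm F G)\<^sup>2" if A: "finite A" for A
      proof -
        \<comment> \<open>Each coordinate is controlled by the same constant, the norm of the kernel
          function at w, so the squared estimates can be summed over k.\<close>
        have "(cmod (G w k))\<^sup>2 \<le> C\<^sup>2 * (hnorm D (g k))\<^sup>2" for k
        proof -
          have "cmod (G w k) = cmod (ip D (g k) (kernel_fun K w))"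
            using is_rkhs_reproducing[OF rkhs comp[OF g(1)] w] by (simp add: g(2) J_def)
          also have "\<dots> \<le> C * hnorm D (g k)"
            using D.cauchy_schwarz[OF comp[OF g(1)] kw] by (simp add: C_def mult.commute)
          finally show ?thesis by (simp add: power_mono flip: power_mult_distrib)
        qed
        then have "(\<Sum>k\<in>A. (cmod (G w k))\<^sup>2) \<le> (\<Sum>k\<in>A. C\<^sup>2 * (hnorm D (g k))\<^sup>2)" by (intro sum_mono)
        also have "\<dots> \<le> C\<^sup>2 * (hnorm L g)\<^sup>2"
          using D.sum_le_hnorm_l2sum[OF g(1)[unfolded L_def] A]
          by (simp add: L_def mult_left_mono flip: sum_distrib_left)
        also have "hnorm L g = hnorm F G" using hnorm_J[OF g(1)] by (simp add: F_def g(2))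
        finally show ?thesis by (simp add: power_mult_distrib)
      qed
      have "G w \<in> vecs ell2" "(hnorm ell2 (G w))\<^sup>2 \<le> (C * hnorm F G)\<^sup>2"
        using S.l2sum_boundedI[OF _ bound] by (simp_all add: ell2_def)
      moreover have "0 \<le> C * hnorm F G"
        using hnorm_J[OF g(1)] g(1) kw by (simp add: C_def F_def g(2))
      ultimately show ?thesis using power2_le_imp_le by blast
    qed
    then show "bounded_op F ell2 (\<lambda>G. G w)"
      unfolding bounded_op_def by (auto simp: scaleC_fun_def intro!: exI[of _ C])
  qed
  then show ?thesis by blast
qed

section \<open>Formal linear combinations\<close>

definition fin_supp :: "'x set \<Rightarrow> 'b::complex_vector hspace \<Rightarrow> ('x \<Rightarrow> 'b) set" where
  "fin_supp X E = {\<eta>. finite {x. \<eta> x \<noteq> 0} \<and> {x. \<eta> x \<noteq> 0} \<subseteq> X \<and> (\<forall>x. \<eta> x \<in> vecs E)}"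

definition fin_single :: "'x \<Rightarrow> 'b \<Rightarrow> 'x \<Rightarrow> 'b::zero" where
  "fin_single x b = (\<lambda>y. if y = x then b else 0)"

text \<open>The vector represented by the formal combination \<eta>. Summing over the support alone
  is compatible with addition because an additive \<open>c x\<close> sends 0 to 0.\<close>

definition fin_sum :: "('x \<Rightarrow> 'b \<Rightarrow> 'a) \<Rightarrow> ('x \<Rightarrow> 'b::zero) \<Rightarrow> 'a::comm_monoid_add" where
  "fin_sum c \<eta> = (\<Sum>x | \<eta> x \<noteq> 0. c x (\<eta> x))"

lemma (in semi_hspace) fin_supp_subspace: "cvs.subspace (fin_supp X H)"
proof (rule cvs.subspaceI)
  show "0 \<in> fin_supp X H" by (simp add: fin_supp_def)
  fix \<eta> \<zeta> c assume \<eta>: "\<eta> \<in> fin_supp X H"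
  have "{x. (c *\<^sub>C \<eta>) x \<noteq> 0} \<subseteq> {x. \<eta> x \<noteq> 0}" by (auto simp: scaleC_fun_def)
  then show "c *\<^sub>C \<eta> \<in> fin_supp X H"
    using \<eta> unfolding fin_supp_def by (auto simp: scaleC_fun_def intro: finite_subset)
  assume \<zeta>: "\<zeta> \<in> fin_supp X H"
  have sub: "{x. (\<eta> + \<zeta>) x \<noteq> 0} \<subseteq> {x. \<eta> x \<noteq> 0} \<union> {x. \<zeta> x \<noteq> 0}" by auto
  then have "finite {x. (\<eta> + \<zeta>) x \<noteq> 0}"
    by (rule finite_subset) (use \<eta> \<zeta> in \<open>simp add: fin_supp_def\<close>)
  moreover have "{x. (\<eta> + \<zeta>) x \<noteq> 0} \<subseteq> X"
    using sub \<eta> \<zeta> unfolding fin_supp_def by blast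
  ultimately show "\<eta> + \<zeta> \<in> fin_supp X H"
    using \<eta> \<zeta> by (simp add: fin_supp_def)
qed

lemma fin_suppD: "\<eta> \<in> fin_supp X E \<Longrightarrow> \<eta> x \<in> vecs E"
  by (simp add: fin_supp_def)

text \<open>Linearity is demanded in the coefficient b only. X is a bare index set, later the unit
  ball, and vectors belonging to different indices may satisfy arbitrary linear relations.\<close>

locale lin_family = E: semi_hspace E + H: semi_hspace H
  for E :: "'b::complex_vector hspace" and H :: "'a::complex_vector hspace" +
  fixes X :: "'x set" and c :: "'x \<Rightarrow> 'b \<Rightarrow> 'a"
  assumes c_in [simp]: "x \<in> X \<Longrightarrow> b \<in> vecs E \<Longrightarrow> c x b \<in> vecs H"
    and c_add: "x \<in> X \<Longrightarrow> b \<in> vecs E \<Longrightarrow> b' \<in> vecs E \<Longrightarrow> c x (b + b') = c x b + c x b'"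
    and c_scale: "x \<in> X \<Longrightarrow> b \<in> vecs E \<Longrightarrow> c x (a *\<^sub>C b) = a *\<^sub>C c x b"
begin

lemma c_zero [simp]: "x \<in> X \<Longrightarrow> c x 0 = 0"
  using c_add[of x 0 0] by simp

lemma fin_sum_eq:
  assumes "finite A" "A \<subseteq> X" "{x. \<eta> x \<noteq> 0} \<subseteq> A"
  shows "fin_sum c \<eta> = (\<Sum>x\<in>A. c x (\<eta> x))"
  unfolding fin_sum_def using assms by (intro sum.mono_neutral_left) auto

lemma fin_sum_in [simp]: "\<eta> \<in> fin_supp X E \<Longrightarrow> fin_sum c \<eta> \<in> vecs H"
  unfolding fin_sum_def by (intro H.sum_in c_in) (auto simp: fin_supp_def)

lemma fin_sum_add:
  assumes "\<eta> \<in> fin_supp X E" "\<zeta> \<in> fin_supp X E"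
  shows "fin_sum c (\<eta> + \<zeta>) = fin_sum c \<eta> + fin_sum c \<zeta>"
proof -
  let ?A = "{x. \<eta> x \<noteq> 0} \<union> {x. \<zeta> x \<noteq> 0}"
  have A: "finite ?A" "?A \<subseteq> X" using assms by (auto simp: fin_supp_def)
  have "fin_sum c (\<eta> + \<zeta>) = (\<Sum>x\<in>?A. c x ((\<eta> + \<zeta>) x))"
    by (rule fin_sum_eq[OF A]) auto
  also have "\<dots> = (\<Sum>x\<in>?A. c x (\<eta> x)) + (\<Sum>x\<in>?A. c x (\<zeta> x))"
    unfolding sum.distrib[symmetric]
    using A(2) fin_suppD[OF assms(1)] fin_suppD[OF assms(2)] by (intro sum.cong) (auto simp: c_add)
  finally show ?thesis by (subst (1 2) fin_sum_eq[OF A]) auto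
qed

lemma fin_sum_scale:
  assumes "\<eta> \<in> fin_supp X E"
  shows "fin_sum c (a *\<^sub>C \<eta>) = a *\<^sub>C fin_sum c \<eta>"
proof -
  let ?A = "{x. \<eta> x \<noteq> 0}"
  have A: "finite ?A" "?A \<subseteq> X" using assms by (auto simp: fin_supp_def)
  have "fin_sum c (a *\<^sub>C \<eta>) = (\<Sum>x\<in>?A. c x ((a *\<^sub>C \<eta>) x))"
    by (rule fin_sum_eq[OF A]) (auto simp: scaleC_fun_def)
  also have "\<dots> = a *\<^sub>C (\<Sum>x\<in>?A. c x (\<eta> x))"
    unfolding cvs.scale_sum_right
    using A(2) fin_suppD[OF assms] by (intro sum.cong) (auto simp: c_scale scaleC_fun_def)
  finally show ?thesis by (simp add: fin_sum_def)
qed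

lemma fin_single_in: "x \<in> X \<Longrightarrow> b \<in> vecs E \<Longrightarrow> fin_single x b \<in> fin_supp X E"
  by (auto simp: fin_supp_def fin_single_def)

lemma fin_sum_single: "x \<in> X \<Longrightarrow> fin_sum c (fin_single x b) = c x b"
  by (subst fin_sum_eq[of "{x}"]) (auto simp: fin_single_def)

lemma ip_fin_sum_left:
  assumes "\<eta> \<in> fin_supp X E" "g \<in> vecs H"
  shows "ip H (fin_sum c \<eta>) g = (\<Sum>x | \<eta> x \<noteq> 0. ip H (c x (\<eta> x)) g)"
  unfolding fin_sum_def using assms by (intro H.ip_sum_left) (auto simp: fin_supp_def)

lemma ip_fin_sum_right:
  assumes "\<eta> \<in> fin_supp X E" "g \<in> vecs H"
  shows "ip H g (fin_sum c \<eta>) = (\<Sum>x | \<eta> x \<noteq> 0. ip H g (c x (\<eta> x)))"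
  unfolding fin_sum_def using assms by (intro H.ip_sum_right) (auto simp: fin_supp_def)

lemma hnorm_fin_sum_sq:
  assumes "\<eta> \<in> fin_supp X E"
  shows "complex_of_real ((hnorm H (fin_sum c \<eta>))\<^sup>2) =
    (\<Sum>x | \<eta> x \<noteq> 0. \<Sum>y | \<eta> y \<noteq> 0. ip H (c x (\<eta> x)) (c y (\<eta> y)))"
proof -
  have "ip H (c x (\<eta> x)) (fin_sum c \<eta>) = (\<Sum>y | \<eta> y \<noteq> 0. ip H (c x (\<eta> x)) (c y (\<eta> y)))"
    if "\<eta> x \<noteq> 0" for x
    using that assms by (intro ip_fin_sum_right) (auto simp: fin_supp_def)
  then show ?thesis
    unfolding H.ip_self[OF fin_sum_in[OF assms], symmetric] ip_fin_sum_left[OF assms fin_sum_in[OF assms]]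
    by (intro sum.cong) auto
qed

text \<open>The vector h plays the role of the adjoint, applied to g, of an operator sending
  \<open>c x b\<close> to \<open>c' x b\<close>. The estimate for this one g suffices, so such an
  operator does not have to be constructed first.\<close>

lemma family_representation:
  assumes H: "hilbert H" and c': "lin_family E G X c'" and g: "g \<in> vecs G" and "0 \<le> C"
    and bound: "\<And>\<eta>. \<eta> \<in> fin_supp X E \<Longrightarrow> cmod (ip G (fin_sum c' \<eta>) g) \<le> C * hnorm H (fin_sum c \<eta>)"
  obtains h where "h \<in> vecs H" "hnorm H h \<le> C"
    "\<And>x b. x \<in> X \<Longrightarrow> b \<in> vecs E \<Longrightarrow> ip G (c' x b) g = ip H (c x b) h"
proof -
  interpret c': lin_family E G X c' by (rule c')
  have "\<exists>h (Y :: nat \<Rightarrow> 'x \<Rightarrow> 'b). h \<in> vecs H \<and> (\<forall>n. Y n \<in> fin_supp X E) \<and> hconv H (\<lambda>n. fin_sum c (Y n)) h \<and>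
    (\<forall>\<eta>\<in>fin_supp X E. ip G (fin_sum c' \<eta>) g = ip H (fin_sum c \<eta>) h) \<and> hnorm H h \<le> C"
    by (rule hilbert.representation[OF H E.fin_supp_subspace, of _ "fin_sum c" "\<lambda>\<eta>. ip G (fin_sum c' \<eta>) g", OF _ _ _ _ _ bound \<open>0 \<le> C\<close>])
      (simp_all add: fin_sum_add fin_sum_scale c'.fin_sum_add c'.fin_sum_scale g
        c'.H.ip_add_left c'.H.ip_scale_left)
  then obtain h where h: "h \<in> vecs H" "hnorm H h \<le> C"
    and repr: "\<forall>\<eta>\<in>fin_supp X E. ip G (fin_sum c' \<eta>) g = ip H (fin_sum c \<eta>) h"
    by (elim exE conjE) (rule that)
  have "ip G (c' x b) g = ip H (c x b) h" if "x \<in> X" "b \<in> vecs E" for x b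
    using bspec[OF repr fin_single_in[OF that]] that by (simp add: fin_sum_single c'.fin_sum_single)
  with h that show ?thesis by blast
qed

end

section \<open>Kernel functions of a tensor product\<close>

text \<open>The bound turns a countable set dense for H into one dense for the seminorm of Q, and
  the Cholesky coefficients along it supply e.\<close>

lemma (in hilbert) ex_factorization:
  assumes Q: "semi_hspace Q" and vecs_Q: "vecs Q = vecs H"
    and bound: "\<And>x. x \<in> vecs H \<Longrightarrow> hnorm Q x \<le> hnorm H x"
  obtains e :: "'a \<Rightarrow> nat \<Rightarrow> complex" where
    "\<And>x y. x \<in> vecs H \<Longrightarrow> y \<in> vecs H \<Longrightarrow> e (x + y) = e x + e y"
    "\<And>c x. x \<in> vecs H \<Longrightarrow> e (c *\<^sub>C x) = c *\<^sub>C e x"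
    "\<And>x y. x \<in> vecs H \<Longrightarrow> y \<in> vecs H \<Longrightarrow> (\<lambda>k. e x k * cnj (e y k)) sums ip Q x y"
proof -
  interpret Q: semi_hspace Q by (rule Q)
  obtain D where D: "countable D" "D \<subseteq> vecs H" "\<And>x e. x \<in> vecs H \<Longrightarrow> e > 0 \<Longrightarrow> \<exists>d\<in>D. hnorm H (x - d) < e"
    using separable unfolding hseparable_def by blast
  have "D \<noteq> {}" using D(3)[OF zero_in, of 1] by auto
  define d where "d = from_nat_into D"
  have range_d: "range d = D" unfolding d_def using \<open>D \<noteq> {}\<close> D(1) by (rule range_from_nat_into)
  then have d: "d k \<in> vecs Q" for k using D(2) vecs_Q by auto
  have dense: "\<exists>k. hnorm Q (x - d k) < r" if x: "x \<in> vecs Q" and r: "r > 0" for x r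
  proof -
    obtain k where "hnorm H (x - d k) < r" using D(3)[OF x[unfolded vecs_Q] r] range_d by auto
    moreover have "hnorm Q (x - d k) \<le> hnorm H (x - d k)"
      using x d[of k] unfolding vecs_Q by (intro bound) simp
    ultimately show ?thesis by (intro exI[of _ k]) linarith
  qed
  show ?thesis
  proof (rule that[of "residual_coeff Q d"])
    show "residual_coeff Q d (x + y) = residual_coeff Q d x + residual_coeff Q d y"
      if "x \<in> vecs H" "y \<in> vecs H" for x y
      using that by (intro Q.residual_coeff_add d) (simp_all add: vecs_Q)
    show "residual_coeff Q d (c *\<^sub>C x) = c *\<^sub>C residual_coeff Q d x" if "x \<in> vecs H" for c x
      using that by (intro Q.residual_coeff_scale d) (simp_all add: vecs_Q)
    show "(\<lambda>k. residual_coeff Q d x k * cnj (residual_coeff Q d y k)) sums ip Q x y"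
      if "x \<in> vecs H" "y \<in> vecs H" for x y
      using that by (intro Q.residual_coeff_sums[OF d dense]) (simp_all add: vecs_Q)
  qed
qed

locale tensor_rkhs =
  fixes K :: "complex ^ 'n::finite \<Rightarrow> complex ^ 'n \<Rightarrow> complex"
    and D :: "(complex ^ 'n \<Rightarrow> complex) hspace"
    and E :: "'e::complex_vector hspace"
    and F :: "(complex ^ 'n \<Rightarrow> 'e) hspace"
  assumes rkhs: "is_rkhs K D" and hilbert_E: "hilbert E" and tensor: "is_tensor D E F"
begin

sublocale D: hilbert D by (rule is_rkhs_hilbert[OF rkhs])
sublocale E: hilbert E by (rule hilbert_E)
sublocale F: hilbert F using tensor by (simp add: is_tensor_def hilbert_space_iff)

definition kt :: "complex ^ 'n \<Rightarrow> 'e \<Rightarrow> complex ^ 'n \<Rightarrow> 'e" where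
  "kt w b = elementary_tensor (kernel_fun K w) b"

lemma F_outside: "G \<in> vecs F \<Longrightarrow> w \<notin> unit_ball \<Longrightarrow> G w = 0"
  using tensor unfolding is_tensor_def by blast

lemma elementary_in: "f \<in> vecs D \<Longrightarrow> b \<in> vecs E \<Longrightarrow> elementary_tensor f b \<in> vecs F"
  using tensor unfolding is_tensor_def by blast

lemma ip_elementary:
  "f \<in> vecs D \<Longrightarrow> g \<in> vecs D \<Longrightarrow> a \<in> vecs E \<Longrightarrow> b \<in> vecs E \<Longrightarrow>
    ip F (elementary_tensor f a) (elementary_tensor g b) = ip D f g * ip E a b"
  using tensor unfolding is_tensor_def by blast

lemma elementary_dense:
  assumes "G \<in> vecs F" "0 < r"
  obtains m :: nat and f b where "\<And>j. j < m \<Longrightarrow> f j \<in> vecs D" "\<And>j. j < m \<Longrightarrow> b j \<in> vecs E"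
    "hnorm F (G - (\<Sum>j<m. elementary_tensor (f j) (b j))) < r"
proof -
  have "\<exists>(m::nat) f b. (\<forall>j<m. f j \<in> vecs D \<and> b j \<in> vecs E) \<and>
      hnorm F (G - (\<Sum>j<m. elementary_tensor (f j) (b j))) < r"
    using tensor assms unfolding is_tensor_def by blast
  then show ?thesis using that by blast
qed

lemma eval_bounded: "w \<in> unit_ball \<Longrightarrow> bounded_op F E (\<lambda>G. G w)"
  using tensor unfolding is_tensor_def by blast

lemma eval_in: "G \<in> vecs F \<Longrightarrow> G w \<in> vecs E"
  using eval_bounded[of w] F_outside[of G w] unfolding bounded_op_def
  by (cases "w \<in> unit_ball") auto

lemma kt_in [simp]: "w \<in> unit_ball \<Longrightarrow> b \<in> vecs E \<Longrightarrow> kt w b \<in> vecs F"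
  unfolding kt_def by (intro elementary_in is_rkhs_kernel[OF rkhs])

text \<open>On sums of elementary tensors this is the reproducing property of K. Both sides are
  continuous in G, the right one by boundedness of evaluation, so approximation extends it.\<close>

lemma ip_kt_right:
  assumes G: "G \<in> vecs F" and w: "w \<in> unit_ball" and b: "b \<in> vecs E"
  shows "ip F G (kt w b) = ip E (G w) b"
proof -
  note kw = is_rkhs_kernel[OF rkhs w]
  obtain C where C: "\<And>G. G \<in> vecs F \<Longrightarrow> hnorm E (G w) \<le> C * hnorm F G"
    using eval_bounded[OF w] unfolding bounded_op_def by blast
  \<comment> \<open>The two sides differ by at most ||G - T|| B for an approximant T. The summand 1
    makes B positive, so r / B is an admissible accuracy.\<close>
  define B where "B = hnorm F (kt w b) + \<bar>C\<bar> * hnorm E b + 1"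
  have B: "B > 0" using w b by (simp add: B_def add_nonneg_pos)
  have "cmod (ip F G (kt w b) - ip E (G w) b) \<le> 0 + r" if r: "r > 0" for r
  proof -
    obtain m :: nat and f c where f: "\<And>j. j < m \<Longrightarrow> f j \<in> vecs D" and c: "\<And>j. j < m \<Longrightarrow> c j \<in> vecs E"
      and close: "hnorm F (G - (\<Sum>j<m. elementary_tensor (f j) (c j))) < r / B"
      by (rule elementary_dense[OF G, of "r / B"]) (use r B in auto)
    define T where "T = (\<Sum>j<m. elementary_tensor (f j) (c j))"
    have T: "T \<in> vecs F" unfolding T_def by (intro F.sum_in elementary_in f c) auto
    have Tw: "T w = (\<Sum>j<m. f j w *\<^sub>C c j)"
      by (simp add: T_def sum_fun_apply elementary_tensor_def)
    have "ip F T (kt w b) = (\<Sum>j<m. ip D (f j) (kernel_fun K w) * ip E (c j) b)"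
      unfolding T_def kt_def using f c b kw
      by (subst F.ip_sum_left) (auto simp: elementary_in ip_elementary)
    also have "\<dots> = ip E (T w) b"
      unfolding Tw using f c b
      by (subst E.ip_sum_left) (auto simp: E.ip_scale_left is_rkhs_reproducing[OF rkhs _ w])
    finally have T_eq: "ip F T (kt w b) = ip E (T w) b" .
    have GT: "G - T \<in> vecs F" using G T by simp
    have "ip F G (kt w b) - ip E (G w) b = ip F (G - T) (kt w b) - ip E ((G - T) w) b"
      using G T w b T_eq eval_in[OF G] eval_in[OF T] by (simp add: F.ip_diff_left E.ip_diff_left)
    also have "cmod \<dots> \<le> hnorm F (G - T) * hnorm F (kt w b) + hnorm E ((G - T) w) * hnorm E b"
      using F.cauchy_schwarz[OF GT kt_in[OF w b]] E.cauchy_schwarz[OF eval_in[OF GT] b, of w]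
      by (intro order.trans[OF norm_triangle_ineq4]) linarith
    also have "hnorm E ((G - T) w) \<le> \<bar>C\<bar> * hnorm F (G - T)"
      using C[OF GT] mult_right_mono[OF abs_ge_self[of C] F.hnorm_nonneg[OF GT]] by linarith
    also have "hnorm F (G - T) * hnorm F (kt w b) + \<bar>C\<bar> * hnorm F (G - T) * hnorm E b \<le> hnorm F (G - T) * B"
      using F.hnorm_nonneg[OF GT] by (simp add: B_def algebra_simps)
    also have "\<dots> \<le> r" using close B by (simp add: T_def pos_less_divide_eq)
    finally show ?thesis using b E.hnorm_nonneg[OF b] by (simp add: mult_right_mono)
  qed
  then have "cmod (ip F G (kt w b) - ip E (G w) b) \<le> 0" by (rule field_le_epsilon)
  then show ?thesis by simp
qed

lemma ip_kt_left:
  assumes "G \<in> vecs F" "w \<in> unit_ball" "b \<in> vecs E"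
  shows "ip F (kt w b) G = ip E b (G w)"
  using ip_kt_right[OF assms] F.ip_commute[OF assms(1) kt_in[OF assms(2,3)]]
    E.ip_commute[OF eval_in[OF assms(1)] assms(3), of w] by simp

lemma kt_apply: "z \<in> unit_ball \<Longrightarrow> kt w b z = K z w *\<^sub>C b"
  by (simp add: kt_def elementary_tensor_def kernel_fun_def)

lemma ip_kt_kt:
  assumes "w \<in> unit_ball" "z \<in> unit_ball" "a \<in> vecs E" "b \<in> vecs E"
  shows "ip F (kt w a) (kt z b) = K z w * ip E a b"
  using assms by (simp add: ip_kt_right kt_apply E.ip_scale_left)

lemma eq_if_ip_kt_eq:
  assumes G: "G \<in> vecs F" and G': "G' \<in> vecs F"
    and eq: "\<And>w b. w \<in> unit_ball \<Longrightarrow> b \<in> vecs E \<Longrightarrow> ip F (kt w b) G = ip F (kt w b) G'"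
  shows "G = G'"
proof
  fix w
  show "G w = G' w"
  proof (cases "w \<in> unit_ball")
    case True
    have "ip E b (G w) = ip E b (G' w)" if b: "b \<in> vecs E" for b
      using eq[OF True b] unfolding ip_kt_left[OF G True b] ip_kt_left[OF G' True b] .
    then show ?thesis by (intro E.ip_eqI eval_in G G')
  qed (simp add: F_outside G G')
qed

lemma kt_add: "kt w (a + b) = kt w a + kt w b"
  by (simp add: kt_def elementary_tensor_def fun_eq_iff scaleC_add_right)

lemma kt_scale: "kt w (c *\<^sub>C b) = c *\<^sub>C kt w b"
  by (simp add: kt_def elementary_tensor_def fun_eq_iff scaleC_fun_def scaleC_scaleC mult.commute)

lemma hnorm_kt:
  assumes w: "w \<in> unit_ball" and b: "b \<in> vecs E"
  shows "hnorm F (kt w b) = hnorm D (kernel_fun K w) * hnorm E b"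
proof (rule power2_eq_imp_eq)
  note kw = is_rkhs_kernel[OF rkhs w]
  have "complex_of_real ((hnorm F (kt w b))\<^sup>2) = complex_of_real ((hnorm D (kernel_fun K w) * hnorm E b)\<^sup>2)"
    using ip_elementary[OF kw kw b b]
    unfolding kt_def[symmetric] F.ip_self[OF kt_in[OF w b]] D.ip_self[OF kw] E.ip_self[OF b]
    by (simp add: power_mult_distrib)
  then show "(hnorm F (kt w b))\<^sup>2 = (hnorm D (kernel_fun K w) * hnorm E b)\<^sup>2"
    by (simp only: of_real_eq_iff)
  show "0 \<le> hnorm D (kernel_fun K w) * hnorm E b" using kw b by simp
qed (use w b in simp)

sublocale kt: lin_family E F unit_ball kt
  by unfold_locales (simp_all add: kt_add kt_scale)

text \<open>What the adjoint of multiplication by the i-th coordinate does to \<open>kt w b\<close>.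
  Written out explicitly, it makes sense before that multiplication is known to act on F.\<close>

definition shifted :: "'n \<Rightarrow> complex ^ 'n \<Rightarrow> 'e \<Rightarrow> complex ^ 'n \<Rightarrow> 'e" where
  "shifted i w b = cnj (w $ i) *\<^sub>C kt w b"

lemma lin_family_shifted: "lin_family E F unit_ball (shifted i)"
  by unfold_locales
    (simp_all add: shifted_def kt_add kt_scale scaleC_add_right scaleC_scaleC mult.commute)

lemma ip_shifted_left:
  assumes "G \<in> vecs F" "mult_coord i G \<in> vecs F" "w \<in> unit_ball" "b \<in> vecs E"
  shows "ip F (shifted i w b) G = ip F (kt w b) (mult_coord i G)"
  using assms eval_in[OF assms(1)]
  by (simp add: shifted_def F.ip_scale_left ip_kt_left mult_coord_def E.ip_scale_right)

lemma ip_fin_sum_shifted: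
  assumes \<eta>: "\<eta> \<in> fin_supp unit_ball E" and u: "u \<in> vecs F" and zu: "mult_coord i u \<in> vecs F"
  shows "ip F (fin_sum kt \<eta>) (mult_coord i u) = ip F (fin_sum (shifted i) \<eta>) u"
  unfolding kt.ip_fin_sum_left[OF \<eta> zu] lin_family.ip_fin_sum_left[OF lin_family_shifted \<eta> u]
  using \<eta> fin_suppD[OF \<eta>]
  by (intro sum.cong refl ip_shifted_left[symmetric] u zu) (auto simp: fin_supp_def)

lemma hnorm_shifted_sq:
  assumes "\<eta> \<in> fin_supp unit_ball E"
  shows "complex_of_real ((hnorm F (fin_sum (shifted i) \<eta>))\<^sup>2) =
    (\<Sum>w | \<eta> w \<noteq> 0. \<Sum>z | \<eta> z \<noteq> 0. z $ i * cnj (w $ i) * K z w * ip E (\<eta> w) (\<eta> z))"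
  unfolding lin_family.hnorm_fin_sum_sq[OF lin_family_shifted assms]
  using assms fin_suppD[OF assms]
  by (intro sum.cong refl)
    (auto simp: fin_supp_def shifted_def F.ip_scale_left F.ip_scale_right ip_kt_kt subset_iff)

lemma hnorm_kt_sum_sq:
  assumes "\<eta> \<in> fin_supp unit_ball E"
  shows "complex_of_real ((hnorm F (fin_sum kt \<eta>))\<^sup>2) =
    (\<Sum>w | \<eta> w \<noteq> 0. \<Sum>z | \<eta> z \<noteq> 0. K z w * ip E (\<eta> w) (\<eta> z))"
  unfolding kt.hnorm_fin_sum_sq[OF assms]
  using assms fin_suppD[OF assms]
  by (intro sum.cong refl) (auto simp: fin_supp_def ip_kt_kt subset_iff)

text \<open>Identifies the defect of the column of adjoints with the quadratic form of the kernel (1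
  - <z, w>) K(z, w), so that contractivity becomes positivity of a kernel.\<close>

lemma defect_eq:
  assumes "\<eta> \<in> fin_supp unit_ball E"
  shows "(hnorm F (fin_sum kt \<eta>))\<^sup>2 - (\<Sum>i\<in>UNIV. (hnorm F (fin_sum (shifted i) \<eta>))\<^sup>2) =
    Re (\<Sum>w | \<eta> w \<noteq> 0. \<Sum>z | \<eta> z \<noteq> 0.
      (1 - (\<Sum>i\<in>UNIV. z $ i * cnj (w $ i))) * K z w * ip E (\<eta> w) (\<eta> z))"
proof -
  have "complex_of_real ((hnorm F (fin_sum kt \<eta>))\<^sup>2 - (\<Sum>i\<in>UNIV. (hnorm F (fin_sum (shifted i) \<eta>))\<^sup>2)) =
    (\<Sum>w | \<eta> w \<noteq> 0. \<Sum>z | \<eta> z \<noteq> 0. K z w * ip E (\<eta> w) (\<eta> z)) -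
    (\<Sum>i\<in>UNIV. \<Sum>w | \<eta> w \<noteq> 0. \<Sum>z | \<eta> z \<noteq> 0. z $ i * cnj (w $ i) * K z w * ip E (\<eta> w) (\<eta> z))"
    unfolding of_real_diff of_real_sum hnorm_shifted_sq[OF assms] hnorm_kt_sum_sq[OF assms] ..
  also have "(\<Sum>i\<in>UNIV. \<Sum>w | \<eta> w \<noteq> 0. \<Sum>z | \<eta> z \<noteq> 0. z $ i * cnj (w $ i) * K z w * ip E (\<eta> w) (\<eta> z)) =
    (\<Sum>w | \<eta> w \<noteq> 0. \<Sum>z | \<eta> z \<noteq> 0. \<Sum>i\<in>UNIV. z $ i * cnj (w $ i) * K z w * ip E (\<eta> w) (\<eta> z))"
    by (subst sum.swap, intro sum.cong refl, rule sum.swap)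
  also have "(\<Sum>w | \<eta> w \<noteq> 0. \<Sum>z | \<eta> z \<noteq> 0. K z w * ip E (\<eta> w) (\<eta> z)) - \<dots> =
    (\<Sum>w | \<eta> w \<noteq> 0. \<Sum>z | \<eta> z \<noteq> 0.
      (1 - (\<Sum>i\<in>UNIV. z $ i * cnj (w $ i))) * K z w * ip E (\<eta> w) (\<eta> z))"
    by (simp add: sum_subtractf[symmetric] left_diff_distrib sum_distrib_right)
  finally show ?thesis by (metis Re_complex_of_real)
qed

text \<open>The row contraction property in dual form: the column of adjoints is contractive on
  combinations of kernel vectors. It involves only the kernel and E, which allows it to be
  transferred between spaces.\<close>

definition contractive :: bool where
  "contractive \<longleftrightarrow> (\<forall>\<eta>\<in>fin_supp unit_ball E.
     (\<Sum>i\<in>UNIV. (hnorm F (fin_sum (shifted i) \<eta>))\<^sup>2) \<le> (hnorm F (fin_sum kt \<eta>))\<^sup>2)"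

lemma contractive_hnorm_shifted_le:
  assumes "contractive" "\<eta> \<in> fin_supp unit_ball E"
  shows "hnorm F (fin_sum (shifted i) \<eta>) \<le> hnorm F (fin_sum kt \<eta>)"
proof (rule power2_le_imp_le)
  have "(hnorm F (fin_sum (shifted i) \<eta>))\<^sup>2 \<le> (\<Sum>i\<in>UNIV. (hnorm F (fin_sum (shifted i) \<eta>))\<^sup>2)"
    by (rule member_le_sum) simp_all
  then show "(hnorm F (fin_sum (shifted i) \<eta>))\<^sup>2 \<le> (hnorm F (fin_sum kt \<eta>))\<^sup>2"
    using assms unfolding contractive_def by fastforce
qed (use assms(2) in simp)

text \<open>The shifted sums are dominated by the kernel sums, so pairing them with G is represented
  by some h in F. Evaluation at each point identifies h with the product of G and the
  coordinate.\<close>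

lemma contractive_mult_coord:
  assumes "contractive" and G: "G \<in> vecs F"
  shows "mult_coord i G \<in> vecs F"
proof -
  interpret S: lin_family E F unit_ball "shifted i" by (rule lin_family_shifted)
  obtain h where h: "h \<in> vecs F"
    and eq: "\<And>w b. w \<in> unit_ball \<Longrightarrow> b \<in> vecs E \<Longrightarrow> ip F (shifted i w b) G = ip F (kt w b) h"
  proof (rule kt.family_representation[OF F.hilbert_axioms lin_family_shifted G F.hnorm_nonneg[OF G]])
    fix \<eta> :: "complex ^ 'n \<Rightarrow> 'e" assume \<eta>: "\<eta> \<in> fin_supp unit_ball E"
    have "cmod (ip F (fin_sum (shifted i) \<eta>) G) \<le> hnorm F (fin_sum (shifted i) \<eta>) * hnorm F G"
      by (intro F.cauchy_schwarz S.fin_sum_in \<eta> G)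
    also have "\<dots> \<le> hnorm F G * hnorm F (fin_sum kt \<eta>)"
      using contractive_hnorm_shifted_le[OF assms(1) \<eta>, of i] F.hnorm_nonneg[OF G]
      by (simp add: mult.commute mult_left_mono)
    finally show "cmod (ip F (fin_sum (shifted i) \<eta>) G) \<le> hnorm F G * hnorm F (fin_sum kt \<eta>)" .
  qed blast
  have "h w = mult_coord i G w" for w
  proof (cases "w \<in> unit_ball")
    case True
    have "ip E b (h w) = ip E b (mult_coord i G w)" if b: "b \<in> vecs E" for b
      using eq[OF True b] True b G h eval_in[OF G]
      by (simp add: shifted_def F.ip_scale_left ip_kt_left mult_coord_def E.ip_scale_right)
    then show ?thesis using eval_in[OF G] by (intro E.ip_eqI[OF eval_in[OF h]]) (simp_all add: mult_coord_def)
  next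
    case False
    then show ?thesis by (simp add: F_outside G h mult_coord_def)
  qed
  then show ?thesis using h by (metis ext)
qed

text \<open>The bound for v on kernel sums is represented by a vector h of norm at most C. The
  kernel vectors separate elements of F, so h is v itself and v inherits the norm bound.\<close>

lemma row_contraction:
  assumes con: "contractive" and u: "\<And>i. u i \<in> vecs F" and zu: "\<And>i. mult_coord i (u i) \<in> vecs F"
  shows "hnorm F (\<Sum>i\<in>UNIV. mult_coord i (u i)) \<le> sqrt (\<Sum>i\<in>UNIV. (hnorm F (u i))\<^sup>2)"
proof -
  define v where "v = (\<Sum>i\<in>UNIV. mult_coord i (u i))"
  have v: "v \<in> vecs F" unfolding v_def by (intro F.sum_in zu)
  define C where "C = sqrt (\<Sum>i\<in>UNIV. (hnorm F (u i))\<^sup>2)"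
  have C: "0 \<le> C" by (simp add: C_def sum_nonneg)
  have bound: "cmod (ip F (fin_sum kt \<eta>) v) \<le> C * hnorm F (fin_sum kt \<eta>)"
    if \<eta>: "\<eta> \<in> fin_supp unit_ball E" for \<eta>
  proof -
    have "ip F (fin_sum kt \<eta>) v = (\<Sum>i\<in>UNIV. ip F (fin_sum (shifted i) \<eta>) (u i))"
      unfolding v_def using \<eta> zu by (subst F.ip_sum_right) (simp_all add: ip_fin_sum_shifted u)
    also have "cmod \<dots> \<le> (\<Sum>i\<in>UNIV. \<bar>hnorm F (fin_sum (shifted i) \<eta>)\<bar> * \<bar>hnorm F (u i)\<bar>)"
    proof (intro order.trans[OF norm_sum] sum_mono)
      fix i
      have s: "fin_sum (shifted i) \<eta> \<in> vecs F" by (rule lin_family.fin_sum_in[OF lin_family_shifted \<eta>])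
      show "cmod (ip F (fin_sum (shifted i) \<eta>) (u i)) \<le> \<bar>hnorm F (fin_sum (shifted i) \<eta>)\<bar> * \<bar>hnorm F (u i)\<bar>"
        using F.cauchy_schwarz[OF s u[of i]] s u[of i] by simp
    qed
    \<comment> \<open>Cauchy-Schwarz in the finite index i.\<close>
    also have "\<dots> \<le> sqrt (\<Sum>i\<in>UNIV. (hnorm F (fin_sum (shifted i) \<eta>))\<^sup>2) * C"
      using L2_set_mult_ineq[of "\<lambda>i. hnorm F (fin_sum (shifted i) \<eta>)" "\<lambda>i. hnorm F (u i)" UNIV]
      by (simp add: L2_set_def C_def)
    also have "sqrt (\<Sum>i\<in>UNIV. (hnorm F (fin_sum (shifted i) \<eta>))\<^sup>2) \<le> hnorm F (fin_sum kt \<eta>)"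
      using con \<eta> unfolding contractive_def by (intro real_le_lsqrt) auto
    finally show ?thesis using C by (simp add: mult_right_mono mult.commute)
  qed
  obtain h where h: "h \<in> vecs F" "hnorm F h \<le> C"
    and eq: "\<And>w b. w \<in> unit_ball \<Longrightarrow> b \<in> vecs E \<Longrightarrow> ip F (kt w b) v = ip F (kt w b) h"
    by (rule kt.family_representation[OF F.hilbert_axioms kt.lin_family_axioms v C bound])
      (assumption, rule that)
  have "v = h" by (rule eq_if_ip_kt_eq[OF v h(1) eq])
  then show ?thesis using h(2) by (simp add: v_def C_def)
qed

end

section \<open>Contractivity of coordinate multiplication\<close>

lemma drury_arveson_contractive:
  fixes F :: "(complex ^ 'n::finite \<Rightarrow> 'e::complex_vector) hspace"
  assumes "tensor_rkhs drury_arveson_kernel D E F"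
  shows "tensor_rkhs.contractive drury_arveson_kernel E F"
proof -
  interpret tensor_rkhs drury_arveson_kernel D E F by (rule assms)
  show ?thesis
    unfolding contractive_def
  proof
    fix \<eta> :: "complex ^ 'n \<Rightarrow> 'e" assume \<eta>: "\<eta> \<in> fin_supp unit_ball E"
    \<comment> \<open>The defect kernel is constantly 1, so the defect is the squared norm of the
      sum of all coefficients.\<close>
    have "(1 - (\<Sum>i\<in>UNIV. z $ i * cnj (w $ i))) * drury_arveson_kernel z w = 1"
      if "\<eta> w \<noteq> 0" "\<eta> z \<noteq> 0" for z w
      using that \<eta> drury_arveson_denominator[of z w]
      by (auto simp: fin_supp_def drury_arveson_kernel_def subset_iff)
    then have "(\<Sum>w | \<eta> w \<noteq> 0. \<Sum>z | \<eta> z \<noteq> 0.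
        (1 - (\<Sum>i\<in>UNIV. z $ i * cnj (w $ i))) * drury_arveson_kernel z w * ip E (\<eta> w) (\<eta> z)) =
      (\<Sum>w | \<eta> w \<noteq> 0. \<Sum>z | \<eta> z \<noteq> 0. ip E (\<eta> w) (\<eta> z))"
      by (intro sum.cong refl) simp
    also have "\<dots> = ip E (\<Sum>w | \<eta> w \<noteq> 0. \<eta> w) (\<Sum>w | \<eta> w \<noteq> 0. \<eta> w)"
      using fin_suppD[OF \<eta>] by (simp add: E.ip_sum_left E.ip_sum_right) (rule sum.swap)
    finally show "(\<Sum>i\<in>UNIV. (hnorm F (fin_sum (shifted i) \<eta>))\<^sup>2) \<le> (hnorm F (fin_sum kt \<eta>))\<^sup>2"
      using defect_eq[OF \<eta>] E.ip_self_nonneg[of "\<Sum>w | \<eta> w \<noteq> 0. \<eta> w"] fin_suppD[OF \<eta>] by simp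
  qed
qed

text \<open>D is its own tensor product with the scalars, so the scalar space falls under the same
  theory as the vector-valued ones.\<close>

lemma tensor_rkhs_scalar:
  fixes D :: "(complex ^ 'n::finite \<Rightarrow> complex) hspace"
  assumes rkhs: "is_rkhs K D"
  shows "tensor_rkhs K D scalar_hspace D"
proof (intro tensor_rkhs.intro rkhs hilbert_scalar)
  interpret D: hilbert D by (rule is_rkhs_hilbert[OF rkhs])
  have elementary: "elementary_tensor f c = c *\<^sub>C f" for f :: "complex ^ 'n \<Rightarrow> complex" and c
    by (simp add: elementary_tensor_def fun_eq_iff scaleC_fun_def scaleC_complex_def)
  show "is_tensor D scalar_hspace D"
    unfolding is_tensor_def
  proof (intro conjI ballI allI impI)
    show "hilbert_space D" by (simp add: hilbert_space_iff D.hilbert_axioms)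
    show "G w = 0" if "G \<in> vecs D" "w \<notin> unit_ball" for G w by (rule is_rkhs_outside[OF rkhs that])
    show "elementary_tensor f c \<in> vecs D" if "f \<in> vecs D" for f c using that by (simp add: elementary)
    show "ip D (elementary_tensor f a) (elementary_tensor g b) = ip D f g * ip scalar_hspace a b"
      if "f \<in> vecs D" "g \<in> vecs D" for f g a b
      using that by (simp add: elementary D.ip_scale_left D.ip_scale_right)
    show "\<exists>(m::nat) f \<eta>. (\<forall>j<m. f j \<in> vecs D \<and> \<eta> j \<in> vecs scalar_hspace) \<and>
        hnorm D (G - (\<Sum>j<m. elementary_tensor (f j) (\<eta> j))) < e" if "G \<in> vecs D" "0 < e" for G e
      using that by (intro exI[of _ 1] exI[of _ "\<lambda>_. G"] exI[of _ "\<lambda>_. 1"]) (simp add: elementary)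
    fix w :: "complex ^ 'n" assume w: "w \<in> unit_ball"
    have "cmod (G w) \<le> hnorm D (kernel_fun K w) * hnorm D G" if "G \<in> vecs D" for G
      using D.cauchy_schwarz[OF that is_rkhs_kernel[OF rkhs w]] is_rkhs_reproducing[OF rkhs that w]
      by (simp add: mult.commute)
    then show "bounded_op D scalar_hspace (\<lambda>G. G w)"
      unfolding bounded_op_def by (auto simp: scaleC_fun_def)
  qed
qed

text \<open>On D the coordinate operators are bounded, and their adjoints send kernel sums to
  shifted sums. The operator inequality evaluated at a kernel sum is then the claim.\<close>

lemma analytic_hilbert_space_contractive:
  fixes D :: "(complex ^ 'n::finite \<Rightarrow> complex) hspace"
  assumes analytic: "analytic_hilbert_space K D"
  shows "tensor_rkhs.contractive K scalar_hspace D"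
proof -
  have rkhs: "is_rkhs K D" using analytic by (simp add: analytic_hilbert_space_def)
  interpret tensor_rkhs K D scalar_hspace D by (rule tensor_rkhs_scalar[OF rkhs])
  have bdd: "bounded_op D D (mult_coord i)" for i
    using analytic unfolding analytic_hilbert_space_def by blast
  have op_le: "op_le D (\<lambda>x. \<Sum>i\<in>UNIV. mult_coord i (hadj D D (mult_coord i) x)) (\<lambda>x. x)"
    using analytic unfolding analytic_hilbert_space_def pure_cospherically_contractive_def
      cospherically_contractive_def by blast
  have zin: "mult_coord i u \<in> vecs D" if "u \<in> vecs D" for i u
    using bdd[of i] that unfolding bounded_op_def by blast
  show ?thesis
    unfolding contractive_def
  proof
    fix \<eta> :: "complex ^ 'n \<Rightarrow> complex" assume \<eta>: "\<eta> \<in> fin_supp unit_ball scalar_hspace"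
    let ?f = "fin_sum kt \<eta>" and ?g = "\<lambda>i. fin_sum (shifted i) \<eta>"
    have f: "?f \<in> vecs D" by (rule kt.fin_sum_in[OF \<eta>])
    have g: "?g i \<in> vecs D" for i by (rule lin_family.fin_sum_in[OF lin_family_shifted \<eta>])
    have ip_g: "ip D (mult_coord i u) ?f = ip D u (?g i)" if u: "u \<in> vecs D" for u i
      using ip_fin_sum_shifted[OF \<eta> u zin[OF u]] D.ip_commute[OF f zin[OF u]] D.ip_commute[OF g u]
      by simp
    have adj: "hadj D D (mult_coord i) ?f = ?g i" for i
      by (rule D.adjoint_eqI[OF bdd D.semi_hspace_axioms f g ip_g])
    have "0 \<le> Re (ip D (?f - (\<Sum>i\<in>UNIV. mult_coord i (?g i))) ?f)"
      using op_le f unfolding op_le_def adj[symmetric] by blast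
    also have "ip D (?f - (\<Sum>i\<in>UNIV. mult_coord i (?g i))) ?f = ip D ?f ?f - (\<Sum>i\<in>UNIV. ip D (?g i) (?g i))"
      using f g zin by (simp add: D.ip_diff_left D.ip_sum_left ip_g)
    finally show "(\<Sum>i\<in>UNIV. (hnorm D (?g i))\<^sup>2) \<le> (hnorm D ?f)\<^sup>2"
      using f g by (simp add: D.hnorm_sq)
  qed
qed

text \<open>This is the Schur product theorem: the Gram matrix of \<open>E\<close>-vectors is a sum of rank one matrices.\<close>

lemma contractive_tensor:
  fixes F :: "(complex ^ 'n::finite \<Rightarrow> 'e::complex_vector) hspace"
  assumes T: "tensor_rkhs K D E F" and scalar: "tensor_rkhs.contractive K scalar_hspace D"
  shows "tensor_rkhs.contractive K E F"
proof -
  interpret tensor_rkhs K D E F by (rule T)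
  interpret S: tensor_rkhs K D scalar_hspace D by (rule tensor_rkhs_scalar[OF rkhs])
  obtain e :: "'e \<Rightarrow> nat \<Rightarrow> complex" where
    e_add: "\<And>x y. x \<in> vecs E \<Longrightarrow> y \<in> vecs E \<Longrightarrow> e (x + y) = e x + e y"
    and e_sums: "\<And>x y. x \<in> vecs E \<Longrightarrow> y \<in> vecs E \<Longrightarrow> (\<lambda>k. e x k * cnj (e y k)) sums ip E x y"
    by (rule E.ex_factorization[OF E.semi_hspace_axioms]) auto
  have e_0: "e 0 k = 0" for k using e_add[of 0 0] by simp
  show ?thesis
    unfolding contractive_def
  proof
    fix \<eta> :: "complex ^ 'n \<Rightarrow> 'e" assume \<eta>: "\<eta> \<in> fin_supp unit_ball E"
    let ?A = "{w. \<eta> w \<noteq> 0}"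
    have fin: "finite ?A" "?A \<subseteq> unit_ball" using \<eta> by (auto simp: fin_supp_def)
    define c where "c z w = (1 - (\<Sum>i\<in>UNIV. z $ i * cnj (w $ i))) * K z w" for z w
    \<comment> \<open>The k-th entries of the sequences \<open>e (\<eta> w)\<close> are scalar
      coefficients on the ball, so scalar contractivity makes the k-th rank one contribution
      nonnegative.\<close>
    have nonneg: "0 \<le> Re (\<Sum>w\<in>?A. \<Sum>z\<in>?A. c z w * (e (\<eta> w) k * cnj (e (\<eta> z) k)))" for k
    proof -
      define \<alpha> where "\<alpha> w = e (\<eta> w) k" for w
      have sub: "{w. \<alpha> w \<noteq> 0} \<subseteq> ?A" by (auto simp: \<alpha>_def e_0)
      then have \<alpha>: "\<alpha> \<in> fin_supp unit_ball scalar_hspace"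
        using fin finite_subset[OF sub] by (auto simp: fin_supp_def)
      \<comment> \<open>A nonzero vector can have k-th entry 0, so the sums must first be cut down
        to the support of \<alpha>.\<close>
      have "(\<Sum>w\<in>?A. \<Sum>z\<in>?A. c z w * (\<alpha> w * cnj (\<alpha> z))) =
        (\<Sum>w | \<alpha> w \<noteq> 0. \<Sum>z\<in>?A. c z w * (\<alpha> w * cnj (\<alpha> z)))"
        using fin sub by (intro sum.mono_neutral_right) auto
      also have "\<dots> = (\<Sum>w | \<alpha> w \<noteq> 0. \<Sum>z | \<alpha> z \<noteq> 0. c z w * (\<alpha> w * cnj (\<alpha> z)))"
        using fin sub by (intro sum.cong refl sum.mono_neutral_right) auto
      finally have "Re (\<Sum>w\<in>?A. \<Sum>z\<in>?A. c z w * (\<alpha> w * cnj (\<alpha> z))) =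
        (hnorm D (fin_sum S.kt \<alpha>))\<^sup>2 - (\<Sum>i\<in>UNIV. (hnorm D (fin_sum (S.shifted i) \<alpha>))\<^sup>2)"
        unfolding S.defect_eq[OF \<alpha>] c_def by simp
      moreover have "0 \<le> (hnorm D (fin_sum S.kt \<alpha>))\<^sup>2 - (\<Sum>i\<in>UNIV. (hnorm D (fin_sum (S.shifted i) \<alpha>))\<^sup>2)"
        using scalar \<alpha> unfolding S.contractive_def by simp
      ultimately show ?thesis unfolding \<alpha>_def by linarith
    qed
    have "(\<lambda>k. \<Sum>w\<in>?A. \<Sum>z\<in>?A. c z w * (e (\<eta> w) k * cnj (e (\<eta> z) k))) sums
      (\<Sum>w\<in>?A. \<Sum>z\<in>?A. c z w * ip E (\<eta> w) (\<eta> z))"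
      by (intro sums_sum sums_mult e_sums fin_suppD[OF \<eta>])
    then have re_sums: "(\<lambda>k. Re (\<Sum>w\<in>?A. \<Sum>z\<in>?A. c z w * (e (\<eta> w) k * cnj (e (\<eta> z) k)))) sums
      Re (\<Sum>w\<in>?A. \<Sum>z\<in>?A. c z w * ip E (\<eta> w) (\<eta> z))"
      by (rule sums_Re)
    have "0 \<le> Re (\<Sum>w\<in>?A. \<Sum>z\<in>?A. c z w * ip E (\<eta> w) (\<eta> z))"
      by (rule sums_le[OF nonneg sums_zero re_sums])
    then show "(\<Sum>i\<in>UNIV. (hnorm F (fin_sum (shifted i) \<eta>))\<^sup>2) \<le> (hnorm F (fin_sum kt \<eta>))\<^sup>2"
      using defect_eq[OF \<eta>] by (simp add: c_def)
  qed
qed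

section \<open>Ranges of multipliers are invariant\<close>

lemma mult_op_range_invariant:
  assumes E: "hilbert_space E" and F: "is_drury_arveson E F" and \<Theta>: "multiplier E F Es R \<Theta>"
  shows "joint_invariant (mult_op \<Theta> ` vecs F)"
  unfolding joint_invariant_def
proof (intro allI ballI)
  fix i G assume "G \<in> mult_op \<Theta> ` vecs F"
  then obtain f where f: "f \<in> vecs F" "G = mult_op \<Theta> f" by blast
  obtain D where "is_rkhs drury_arveson_kernel D" "is_tensor D E F"
    using F unfolding is_drury_arveson_def by blast
  then have T: "tensor_rkhs drury_arveson_kernel D E F"
    using E by (simp add: tensor_rkhs_def hilbert_space_iff)
  interpret tensor_rkhs drury_arveson_kernel D E F by (rule T)
  \<comment> \<open>Linearity of each \<open>\<Theta> w\<close> lets the scalar coordinate pass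
    through.\<close>
  have "mult_op \<Theta> (mult_coord i f) = mult_coord i G"
  proof
    fix w
    show "mult_op \<Theta> (mult_coord i f) w = mult_coord i G w"
    proof (cases "w \<in> unit_ball")
      case True
      then have "\<Theta> w (w $ i *\<^sub>C f w) = w $ i *\<^sub>C \<Theta> w (f w)"
        using \<Theta> eval_in[OF f(1)] unfolding multiplier_def bounded_op_def by blast
      then show ?thesis by (simp add: mult_op_def mult_coord_def f(2))
    qed (simp add: mult_op_def mult_coord_def f(2))
  qed
  \<comment> \<open>The source space is stable under the coordinates because its kernel is
    contractive.\<close>
  moreover have "mult_coord i f \<in> vecs F"
    by (rule contractive_mult_coord[OF drury_arveson_contractive[OF T] f(1)])
  ultimately show "mult_coord i G \<in> mult_op \<Theta> ` vecs F" by (metis image_eqI)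
qed

section \<open>Invariant subspaces\<close>

context tensor_rkhs
begin

context
  fixes S
  assumes con: "contractive" and S: "closed_csubspace F S" and inv: "joint_invariant S"
begin

definition skt :: "complex ^ 'n \<Rightarrow> 'e \<Rightarrow> complex ^ 'n \<Rightarrow> 'e" where
  "skt w b = hproj F S (kt w b)"

lemma S_in: "u \<in> S \<Longrightarrow> u \<in> vecs F"
  using closed_csubspaceD(2)[OF S] by blast

lemma coord_in: "u \<in> S \<Longrightarrow> mult_coord i u \<in> S"
  using inv unfolding joint_invariant_def by blast

lemma skt_in: "w \<in> unit_ball \<Longrightarrow> b \<in> vecs E \<Longrightarrow> skt w b \<in> S"
  unfolding skt_def by (intro F.projection(1)[OF S] kt_in)

lemma ip_skt_right:
  assumes "u \<in> S" "w \<in> unit_ball" "b \<in> vecs E"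
  shows "ip F u (skt w b) = ip E (u w) b"
  unfolding skt_def F.ip_hproj_right[OF S kt_in[OF assms(2,3)] assms(1)]
  by (rule ip_kt_right[OF S_in[OF assms(1)] assms(2,3)])

lemma ip_skt_left:
  assumes "u \<in> S" "w \<in> unit_ball" "b \<in> vecs E"
  shows "ip F (skt w b) u = ip E b (u w)"
  unfolding skt_def F.ip_hproj_left[OF S kt_in[OF assms(2,3)] assms(1)]
  by (rule ip_kt_left[OF S_in[OF assms(1)] assms(2,3)])

lemma hnorm_skt_le:
  assumes "w \<in> unit_ball" "b \<in> vecs E"
  shows "hnorm F (skt w b) \<le> hnorm D (kernel_fun K w) * hnorm E b"
  using F.hnorm_hproj_le[OF S kt_in[OF assms]] by (simp only: skt_def hnorm_kt[OF assms])

lemma skt_add: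
  "w \<in> unit_ball \<Longrightarrow> a \<in> vecs E \<Longrightarrow> b \<in> vecs E \<Longrightarrow> skt w (a + b) = skt w a + skt w b"
  by (simp add: skt_def kt_add F.hproj_add[OF S])

lemma skt_scale: "w \<in> unit_ball \<Longrightarrow> b \<in> vecs E \<Longrightarrow> skt w (c *\<^sub>C b) = c *\<^sub>C skt w b"
  by (simp add: skt_def kt_scale F.hproj_scale[OF S])

section \<open>Factorization of the defect form on an invariant subspace\<close>

lemma ex_defect_factorization:
  obtains e :: "(complex ^ 'n \<Rightarrow> 'e) \<Rightarrow> nat \<Rightarrow> complex" where
    "\<And>x y. x \<in> S \<Longrightarrow> y \<in> S \<Longrightarrow> e (x + y) = e x + e y"
    "\<And>c x. x \<in> S \<Longrightarrow> e (c *\<^sub>C x) = c *\<^sub>C e x"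
    "\<And>x. x \<in> S \<Longrightarrow> e x \<in> vecs ell2"
    "\<And>x. x \<in> S \<Longrightarrow> hnorm ell2 (e x) \<le> hnorm F x"
    "\<And>w z a b. w \<in> unit_ball \<Longrightarrow> z \<in> unit_ball \<Longrightarrow> a \<in> vecs E \<Longrightarrow> b \<in> vecs E \<Longrightarrow>
      ip ell2 (e (skt w a)) (e (skt z b)) =
        (1 - (\<Sum>i\<in>UNIV. z $ i * cnj (w $ i))) * ip F (skt w a) (skt z b)"
proof -
  define G where "G = F\<lparr>vecs := S\<rparr>"
  have G_simps [simp]: "vecs G = S" "ip G = ip F" by (simp_all add: G_def)
  have hnorm_G [simp]: "hnorm G = hnorm F" by (simp add: fun_eq_iff hnorm_def)
  interpret G: hilbert G unfolding G_def by (rule F.hilbert_closed_subspace[OF S])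
  interpret L: hilbert "ell2 :: (nat \<Rightarrow> complex) hspace" by (rule hilbert_ell2)
  note row = row_contraction[OF con S_in S_in[OF coord_in]]
  have bdd: "bounded_op G G (mult_coord i)" for i :: 'n
    unfolding bounded_op_def
  proof (intro conjI ballI allI exI[of _ 1])
    fix u assume u: "u \<in> vecs G"
    then show "mult_coord i u \<in> vecs G" by (simp add: coord_in)
    \<comment> \<open>Padding u with zeros turns the row estimate into a bound for a single
      coordinate.\<close>
    define v where "v j = (if j = i then u else 0)" for j
    have v: "v j \<in> S" for j using u G.zero_in by (simp add: v_def)
    have "(\<Sum>j\<in>UNIV. mult_coord j (v j)) = (\<Sum>j\<in>UNIV. if j = i then mult_coord i u else 0)"
      by (intro sum.cong refl) (simp add: v_def mult_coord_def fun_eq_iff)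
    moreover have "(\<Sum>j\<in>UNIV. (hnorm F (v j))\<^sup>2) = (\<Sum>j\<in>UNIV. if j = i then (hnorm F u)\<^sup>2 else 0)"
      by (intro sum.cong refl) (simp add: v_def)
    ultimately show "hnorm G (mult_coord i u) \<le> 1 * hnorm G u"
      using row[of v, OF v v] u S_in[of u] by simp
  qed (auto simp: mult_coord_def fun_eq_iff scaleC_fun_def scaleC_add_right scaleC_scaleC mult.commute)
  define Ta where "Ta i = hadj G G (mult_coord i)" for i :: 'n
  note adj = G.adjoint[OF bdd G.semi_hspace_axioms, folded Ta_def, simplified]
  have Ta_bdd: "bounded_op G G (Ta i)" for i
    unfolding Ta_def by (rule G.bounded_op_adjoint[OF bdd G.semi_hspace_axioms])
  have Ta_add: "Ta i (x + y) = Ta i x + Ta i y" if "x \<in> S" "y \<in> S" for i x y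
    using Ta_bdd[of i] that unfolding bounded_op_def G_simps by blast
  have Ta_scale: "Ta i (c *\<^sub>C x) = c *\<^sub>C Ta i x" if "x \<in> S" for i c x
    using Ta_bdd[of i] that unfolding bounded_op_def G_simps by blast
  \<comment> \<open>Invariance keeps \<open>mult_coord i u\<close> in S, where pairing with
    \<open>skt w b\<close> still evaluates at w; the coordinate becomes the scalar
    \<open>w $ i\<close>.\<close>
  have Ta_skt: "Ta i (skt w b) = cnj (w $ i) *\<^sub>C skt w b" if w: "w \<in> unit_ball" and b: "b \<in> vecs E" for i w b
    unfolding Ta_def
  proof (rule G.adjoint_eqI[OF bdd G.semi_hspace_axioms])
    fix u assume "u \<in> vecs G"
    then have u: "u \<in> S" by simp
    have "ip F (mult_coord i u) (skt w b) = w $ i * ip E (u w) b"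
      unfolding ip_skt_right[OF coord_in[OF u] w b]
      by (simp add: mult_coord_def E.ip_scale_left[OF eval_in[OF S_in[OF u]] b])
    also have "\<dots> = ip F u (cnj (w $ i) *\<^sub>C skt w b)"
      using S_in[OF u] S_in[OF skt_in[OF w b]] by (simp add: F.ip_scale_right ip_skt_right[OF u w b])
    finally show "ip G (mult_coord i u) (skt w b) = ip G u (cnj (w $ i) *\<^sub>C skt w b)" by simp
  qed (use skt_in[OF w b] G.scale_in in simp_all)
  \<comment> \<open>From row to column: with N the left side, N is the pairing of the row image of
    the vectors \<open>Ta i x\<close> with x, hence at most sqrt N ||x||.\<close>
  have Ta_sum_le: "(\<Sum>i\<in>UNIV. (hnorm F (Ta i x))\<^sup>2) \<le> (hnorm F x)\<^sup>2" if x: "x \<in> S" for x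
  proof -
    let ?N = "\<Sum>i\<in>UNIV. (hnorm F (Ta i x))\<^sup>2" and ?v = "\<Sum>i\<in>UNIV. mult_coord i (Ta i x)"
    have Tx: "Ta i x \<in> S" for i by (rule adj(1)[OF x])
    have v: "?v \<in> vecs F" by (intro F.sum_in S_in coord_in Tx)
    have "?N = Re (ip F ?v x)"
      using S_in[OF x] S_in[OF Tx] S_in[OF coord_in[OF Tx]]
      by (simp add: F.ip_sum_left F.hnorm_sq adj(2)[OF x Tx])
    also have "\<dots> \<le> hnorm F ?v * hnorm F x"
      using F.cauchy_schwarz[OF v S_in[OF x]] complex_Re_le_cmod[of "ip F ?v x"] by linarith
    also have "\<dots> \<le> sqrt ?N * hnorm F x"
      using row[of "\<lambda>i. Ta i x", OF Tx Tx] S_in[OF x] by (intro mult_right_mono) simp_all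
    finally have "sqrt ?N * sqrt ?N \<le> hnorm F x * sqrt ?N" by (simp add: sum_nonneg mult.commute)
    then have "sqrt ?N \<le> hnorm F x"
      by (rule le_of_mult_self_le) (use S_in[OF x] in \<open>simp_all add: sum_nonneg\<close>)
    then show ?thesis by (rule sqrt_le_D)
  qed
  define Q where "Q = \<lparr>vecs = S, ip = \<lambda>x y. ip F x y - (\<Sum>i\<in>UNIV. ip F (Ta i x) (Ta i y))\<rparr>"
  have Q_simps [simp]: "vecs Q = S" "ip Q x y = ip F x y - (\<Sum>i\<in>UNIV. ip F (Ta i x) (Ta i y))" for x y
    by (simp_all add: Q_def)
  have TaF: "Ta i x \<in> vecs F" if "x \<in> S" for i x by (rule S_in[OF adj(1)[OF that]])
  have Re_Q: "Re (ip Q x x) = (hnorm F x)\<^sup>2 - (\<Sum>i\<in>UNIV. (hnorm F (Ta i x))\<^sup>2)" if "x \<in> S" for x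
    using S_in[OF that] TaF[OF that] by (simp add: F.hnorm_sq)
  have Q: "semi_hspace Q"
  proof
    show "cvs.subspace (vecs Q)" using closed_csubspaceD(1)[OF S] by simp
    fix x y c assume "x \<in> vecs Q" "y \<in> vecs Q"
    then have x: "x \<in> S" and y: "y \<in> S" by simp_all
    show "ip Q (c *\<^sub>C x) y = c * ip Q x y"
      using S_in[OF x] S_in[OF y] TaF[OF x] TaF[OF y]
      by (simp add: Ta_scale[OF x] F.ip_scale_left right_diff_distrib sum_distrib_left)
    have "ip F (Ta i y) (Ta i x) = cnj (ip F (Ta i x) (Ta i y))" for i
      by (rule F.ip_commute[OF TaF[OF x] TaF[OF y]])
    then show "ip Q y x = cnj (ip Q x y)"
      using F.ip_commute[OF S_in[OF x] S_in[OF y]] by simp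
    fix z assume "z \<in> vecs Q"
    then have z: "z \<in> S" by simp
    show "ip Q (x + y) z = ip Q x z + ip Q y z"
      using S_in[OF x] S_in[OF y] S_in[OF z] TaF[OF x] TaF[OF y] TaF[OF z]
      by (simp add: Ta_add[OF x y] F.ip_add_left sum.distrib)
  next
    fix x assume "x \<in> vecs Q"
    then have x: "x \<in> S" by simp
    show "0 \<le> Re (ip Q x x)" using Re_Q[OF x] Ta_sum_le[OF x] by linarith
  qed
  have Q_le: "hnorm Q x \<le> hnorm F x" if x: "x \<in> S" for x
  proof -
    have "Re (ip Q x x) \<le> (hnorm F x)\<^sup>2" using Re_Q[OF x] by (simp add: sum_nonneg)
    then show ?thesis unfolding hnorm_def[of Q] using S_in[OF x] by (intro real_le_lsqrt) simp_all
  qed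
  obtain e :: "(complex ^ 'n \<Rightarrow> 'e) \<Rightarrow> nat \<Rightarrow> complex" where
    e_add: "\<And>x y. x \<in> S \<Longrightarrow> y \<in> S \<Longrightarrow> e (x + y) = e x + e y" and
    e_scale: "\<And>c x. x \<in> S \<Longrightarrow> e (c *\<^sub>C x) = c *\<^sub>C e x" and
    e_sums: "\<And>x y. x \<in> S \<Longrightarrow> y \<in> S \<Longrightarrow> (\<lambda>k. e x k * cnj (e y k)) sums ip Q x y"
    by (rule G.ex_factorization[OF Q, unfolded G_simps hnorm_G, OF Q_simps(1) Q_le])
      (assumption, rule that)
  have e_in: "e x \<in> vecs ell2" if x: "x \<in> S" for x
  proof -
    have "(\<lambda>k. Re (e x k * cnj (e x k))) sums Re (ip Q x x)" by (rule sums_Re[OF e_sums[OF x x]])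
    moreover have "Re (e x k * cnj (e x k)) = (cmod (e x k))\<^sup>2" for k
      unfolding cmod_power2 by (simp add: power2_eq_square)
    ultimately have "summable (\<lambda>k. (cmod (e x k))\<^sup>2)" by (simp add: sums_iff)
    then show ?thesis unfolding ell2_iff by (intro summable_nonneg_imp_summable_on) simp_all
  qed
  have ip_e: "ip ell2 (e x) (e y) = ip Q x y" if "x \<in> S" "y \<in> S" for x y
    by (rule sums_unique2[OF has_sum_imp_sums[OF ell2_ip_has_sum[OF e_in[OF that(1)] e_in[OF that(2)]]] e_sums[OF that]])
  show ?thesis
  proof (rule that[OF e_add e_scale e_in])
    show "hnorm ell2 (e x) \<le> hnorm F x" if x: "x \<in> S" for x
      using Q_le[OF x] ip_e[OF x x] by (simp add: hnorm_def del: Q_simps)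
    fix w z :: "complex ^ 'n" and a b assume w: "w \<in> unit_ball" and z: "z \<in> unit_ball" and a: "a \<in> vecs E" and b: "b \<in> vecs E"
    have "ip ell2 (e (skt w a)) (e (skt z b)) = ip F (skt w a) (skt z b) -
      (\<Sum>i\<in>UNIV. ip F (cnj (w $ i) *\<^sub>C skt w a) (cnj (z $ i) *\<^sub>C skt z b))"
      by (simp add: ip_e[OF skt_in[OF w a] skt_in[OF z b]] Ta_skt[OF w a] Ta_skt[OF z b])
    also have "\<dots> = (1 - (\<Sum>i\<in>UNIV. z $ i * cnj (w $ i))) * ip F (skt w a) (skt z b)"
      using S_in[OF skt_in[OF w a]] S_in[OF skt_in[OF z b]]
      by (simp add: F.ip_scale_left F.ip_scale_right left_diff_distrib sum_distrib_right mult_ac)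
    finally show "ip ell2 (e (skt w a)) (e (skt z b)) =
      (1 - (\<Sum>i\<in>UNIV. z $ i * cnj (w $ i))) * ip F (skt w a) (skt z b)" .
  qed
qed

section \<open>Construction of the multiplier\<close>

lemma ex_multiplier:
  "\<exists>(L :: (nat \<Rightarrow> complex) hspace) P \<Theta>. hilbert_space L \<and> is_drury_arveson L P \<and>
     partially_isometric_multiplier L P E F \<Theta> \<and> S = mult_op \<Theta> ` vecs P"
proof -
  define G where "G = F\<lparr>vecs := S\<rparr>"
  have G_simps [simp]: "vecs G = S" "ip G = ip F" by (simp_all add: G_def)
  have hnorm_G [simp]: "hnorm G = hnorm F" by (simp add: fun_eq_iff hnorm_def)
  interpret G: hilbert G unfolding G_def by (rule F.hilbert_closed_subspace[OF S])
  interpret L: hilbert "ell2 :: (nat \<Rightarrow> complex) hspace" by (rule hilbert_ell2)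
  obtain e :: "(complex ^ 'n \<Rightarrow> 'e) \<Rightarrow> nat \<Rightarrow> complex" where
    e_add: "\<And>x y. x \<in> S \<Longrightarrow> y \<in> S \<Longrightarrow> e (x + y) = e x + e y" and
    e_scale: "\<And>c x. x \<in> S \<Longrightarrow> e (c *\<^sub>C x) = c *\<^sub>C e x" and
    e_in: "\<And>x. x \<in> S \<Longrightarrow> e x \<in> vecs ell2" and
    e_le: "\<And>x. x \<in> S \<Longrightarrow> hnorm ell2 (e x) \<le> hnorm F x" and
    ip_e: "\<And>w z a b. w \<in> unit_ball \<Longrightarrow> z \<in> unit_ball \<Longrightarrow> a \<in> vecs E \<Longrightarrow> b \<in> vecs E \<Longrightarrow>
      ip ell2 (e (skt w a)) (e (skt z b)) =
        (1 - (\<Sum>i\<in>UNIV. z $ i * cnj (w $ i))) * ip F (skt w a) (skt z b)"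
    by (rule ex_defect_factorization) blast
  obtain DA :: "(complex ^ 'n \<Rightarrow> complex) hspace" where DA: "is_rkhs drury_arveson_kernel DA"
    using ex_drury_arveson_rkhs by blast
  obtain P where P: "is_tensor DA (ell2 :: (nat \<Rightarrow> complex) hspace) P"
    using ex_tensor_ell2[OF DA] by blast
  interpret P: tensor_rkhs drury_arveson_kernel DA "ell2 :: (nat \<Rightarrow> complex) hspace" P
    by (intro tensor_rkhs.intro DA P hilbert_ell2)
  have s_fam: "lin_family E G unit_ball skt"
    by unfold_locales (simp_all add: skt_in skt_add skt_scale)
  interpret s: lin_family E G unit_ball skt by (rule s_fam)
  define c where "c w b = P.kt w (e (skt w b))" for w b
  have es_in: "e (skt w b) \<in> vecs ell2" if "w \<in> unit_ball" "b \<in> vecs E" for w b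
    by (rule e_in[OF skt_in[OF that]])
  have es_add: "e (skt w (a + b)) = e (skt w a) + e (skt w b)"
    if "w \<in> unit_ball" "a \<in> vecs E" "b \<in> vecs E" for w a b
    using that by (simp add: skt_add e_add skt_in)
  have es_scale: "e (skt w (r *\<^sub>C b)) = r *\<^sub>C e (skt w b)"
    if "w \<in> unit_ball" "b \<in> vecs E" for w r b
    using that by (simp add: skt_scale e_scale skt_in)
  have c_fam: "lin_family E P unit_ball c"
    by unfold_locales (simp_all add: c_def es_in es_add es_scale P.kt_add P.kt_scale)
  interpret c: lin_family E P unit_ball c by (rule c_fam)
  \<comment> \<open>The factor 1 - <z, w> contributed by e cancels against the Drury-Arveson kernel
    at (z, w), which is nonzero in its denominator on the ball.\<close>
  have ip_c: "ip P (c w a) (c z b) = ip G (skt w a) (skt z b)"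
    if "w \<in> unit_ball" "z \<in> unit_ball" "a \<in> vecs E" "b \<in> vecs E" for w z a b
    using that drury_arveson_denominator[OF that(2,1)]
    by (simp add: c_def P.ip_kt_kt es_in ip_e drury_arveson_kernel_def)
  have hnorm_c: "hnorm P (fin_sum c \<eta>) = hnorm G (fin_sum skt \<eta>)"
    if \<eta>: "\<eta> \<in> fin_supp unit_ball E" for \<eta>
  proof -
    have "complex_of_real ((hnorm P (fin_sum c \<eta>))\<^sup>2) = complex_of_real ((hnorm G (fin_sum skt \<eta>))\<^sup>2)"
      unfolding c.hnorm_fin_sum_sq[OF \<eta>] s.hnorm_fin_sum_sq[OF \<eta>]
      using \<eta> fin_suppD[OF \<eta>] by (intro sum.cong refl ip_c) (auto simp: fin_supp_def)
    then have "(hnorm P (fin_sum c \<eta>))\<^sup>2 = (hnorm G (fin_sum skt \<eta>))\<^sup>2" by (simp only: of_real_eq_iff)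
    then show ?thesis
      using P.F.hnorm_nonneg[OF c.fin_sum_in[OF \<eta>]] G.hnorm_nonneg[OF s.fin_sum_in[OF \<eta>]]
      by (simp add: power2_eq_iff_nonneg)
  qed
  \<comment> \<open>The adjoint exists because \<open>b |-> e (skt w b)\<close> is bounded by the
    norm of the kernel function at w.\<close>
  define \<Theta> where "\<Theta> w = hadj E ell2 (\<lambda>b. e (skt w b))" for w
  have es_bdd: "bounded_op E ell2 (\<lambda>b. e (skt w b))" if w: "w \<in> unit_ball" for w
    unfolding bounded_op_def
  proof (intro conjI ballI allI exI[of _ "hnorm D (kernel_fun K w)"])
    show "hnorm ell2 (e (skt w b)) \<le> hnorm D (kernel_fun K w) * hnorm E b" if "b \<in> vecs E" for b
      using e_le[OF skt_in[OF w that]] hnorm_skt_le[OF w that] by linarith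
  qed (use w in \<open>simp_all add: es_in es_add es_scale\<close>)
  have \<Theta>_bdd: "bounded_op ell2 E (\<Theta> w)" if w: "w \<in> unit_ball" for w
    unfolding \<Theta>_def by (rule E.bounded_op_adjoint[OF es_bdd[OF w] L.semi_hspace_axioms])
  have \<Theta>: "\<Theta> w v \<in> vecs E" "ip ell2 (e (skt w b)) v = ip E b (\<Theta> w v)"
    if "w \<in> unit_ball" "v \<in> vecs ell2" "b \<in> vecs E" for w v b
    unfolding \<Theta>_def using E.adjoint[OF es_bdd[OF that(1)] L.semi_hspace_axioms that(2)] that(3) by blast+
  \<comment> \<open>Both f and g are tested on matching families, so this recognizes g as the image
    of f under the adjoint of the isometry \<open>skt w b |-> c w b\<close>, and shows that this
    adjoint acts as multiplication by \<Theta>.\<close>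
  have eq_mult_op: "mult_op \<Theta> f = g"
    if f: "f \<in> vecs P" and g: "g \<in> S"
      and eq: "\<And>w b. w \<in> unit_ball \<Longrightarrow> b \<in> vecs E \<Longrightarrow> ip P (c w b) f = ip G (skt w b) g" for f g
  proof
    fix w
    show "mult_op \<Theta> f w = g w"
    proof (cases "w \<in> unit_ball")
      case True
      have "ip E b (\<Theta> w (f w)) = ip E b (g w)" if b: "b \<in> vecs E" for b
      proof -
        have "ip E b (\<Theta> w (f w)) = ip P (c w b) f"
          unfolding c_def P.ip_kt_left[OF f True es_in[OF True b]]
          by (rule \<Theta>(2)[OF True P.eval_in[OF f] b, symmetric])
        also have "\<dots> = ip F (skt w b) g" using eq[OF True b] by simp
        also have "\<dots> = ip E b (g w)" by (rule ip_skt_left[OF g True b])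
        finally show ?thesis .
      qed
      then have "\<Theta> w (f w) = g w"
        by (intro E.ip_eqI[OF \<Theta>(1)[OF True P.eval_in[OF f] E.zero_in] eval_in[OF S_in[OF g]]])
      then show ?thesis using True by (simp add: mult_op_def)
    qed (simp add: mult_op_def F_outside[OF S_in[OF g]])
  qed
  \<comment> \<open>The representing vector h in S is the image of f under the adjoint, which yields
    both membership in S and contractivity.\<close>
  have into: "mult_op \<Theta> f \<in> S \<and> hnorm F (mult_op \<Theta> f) \<le> hnorm P f" if f: "f \<in> vecs P" for f
  proof -
    have bound: "cmod (ip P (fin_sum c \<eta>) f) \<le> hnorm P f * hnorm G (fin_sum skt \<eta>)"
      if \<eta>: "\<eta> \<in> fin_supp unit_ball E" for \<eta>
      using P.F.cauchy_schwarz[OF c.fin_sum_in[OF \<eta>] f] hnorm_c[OF \<eta>] by (simp add: mult.commute)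
    obtain h where h: "h \<in> vecs G" "hnorm G h \<le> hnorm P f"
      and eq: "\<And>w b. w \<in> unit_ball \<Longrightarrow> b \<in> vecs E \<Longrightarrow> ip P (c w b) f = ip G (skt w b) h"
      by (rule s.family_representation[OF G.hilbert_axioms c_fam f P.F.hnorm_nonneg[OF f] bound])
        (assumption, rule that)
    have "mult_op \<Theta> f = h" using h(1) by (intro eq_mult_op[OF f _ eq]) simp_all
    with h show ?thesis by simp
  qed
  \<comment> \<open>The same lemma with the two families exchanged: f is the image of g under the
    isometry itself, a preimage of g that is no longer than g.\<close>
  have onto: "\<exists>f\<in>vecs P. mult_op \<Theta> f = g \<and> hnorm P f \<le> hnorm F g" if g: "g \<in> S" for g
  proof -
    have gG: "g \<in> vecs G" using g by simp
    have bound: "cmod (ip G (fin_sum skt \<eta>) g) \<le> hnorm G g * hnorm P (fin_sum c \<eta>)"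
      if \<eta>: "\<eta> \<in> fin_supp unit_ball E" for \<eta>
      using G.cauchy_schwarz[OF s.fin_sum_in[OF \<eta>] gG] hnorm_c[OF \<eta>] by (simp add: mult.commute)
    obtain f where f: "f \<in> vecs P" "hnorm P f \<le> hnorm G g"
      and eq: "\<And>w b. w \<in> unit_ball \<Longrightarrow> b \<in> vecs E \<Longrightarrow> ip G (skt w b) g = ip P (c w b) f"
      by (rule c.family_representation[OF P.F.hilbert_axioms s_fam gG G.hnorm_nonneg[OF gG] bound])
        (assumption, rule that)
    have "mult_op \<Theta> f = g" by (rule eq_mult_op[OF f(1) g eq[symmetric]])
    with f show ?thesis by auto
  qed
  have range: "S = mult_op \<Theta> ` vecs P" using into onto by blast
  have \<Theta>_add: "mult_op \<Theta> (f + g) = mult_op \<Theta> f + mult_op \<Theta> g" if "f \<in> vecs P" "g \<in> vecs P" for f g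
  proof
    fix w
    show "mult_op \<Theta> (f + g) w = (mult_op \<Theta> f + mult_op \<Theta> g) w"
      using \<Theta>_bdd[of w] P.eval_in[OF that(1)] P.eval_in[OF that(2)]
      unfolding bounded_op_def mult_op_def by simp
  qed
  have \<Theta>_scale: "mult_op \<Theta> (r *\<^sub>C f) = r *\<^sub>C mult_op \<Theta> f" if "f \<in> vecs P" for r f
  proof
    fix w
    show "mult_op \<Theta> (r *\<^sub>C f) w = (r *\<^sub>C mult_op \<Theta> f) w"
      using \<Theta>_bdd[of w] P.eval_in[OF that]
      unfolding bounded_op_def mult_op_def scaleC_fun_def by simp
  qed
  have bdd: "bounded_op P F (mult_op \<Theta>)"
    unfolding bounded_op_def
    by (intro conjI ballI allI exI[of _ 1] \<Theta>_add \<Theta>_scale) (use into S_in in auto)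
  have "partial_isometry P F (mult_op \<Theta>)"
    unfolding partial_isometry_def
  proof (intro conjI ballI impI bdd)
    fix x assume x: "x \<in> vecs P" and perp: "\<forall>u\<in>vecs P. mult_op \<Theta> u = 0 \<longrightarrow> ip P x u = 0"
    \<comment> \<open>This f has the same image as x, so x - f lies in the kernel and x is
      orthogonal to it. Then ||x||^2 = <x, f> gives ||x|| \<le> ||f||, and f is no longer than the
      image of x.\<close>
    obtain f where f: "f \<in> vecs P" "mult_op \<Theta> f = mult_op \<Theta> x" "hnorm P f \<le> hnorm F (mult_op \<Theta> x)"
      using onto into[OF x] by blast
    have "mult_op \<Theta> (x - f) = 0"
      using \<Theta>_add[of "x - f" f] x f by simp
    then have "ip P x (x - f) = 0" using perp x f(1) by simp
    then have "ip P x x = ip P x f" using x f(1) by (simp add: P.F.ip_diff_right)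
    then have "hnorm P x * hnorm P x = Re (ip P x f)"
      using P.F.hnorm_sq[OF x] by (simp add: power2_eq_square)
    also have "\<dots> \<le> hnorm P f * hnorm P x"
      using P.F.cauchy_schwarz[OF x f(1)] complex_Re_le_cmod[of "ip P x f"] by (simp add: mult.commute)
    finally have "hnorm P x \<le> hnorm P f"
      by (rule le_of_mult_self_le) (use x f in simp_all)
    then show "hnorm F (mult_op \<Theta> x) = hnorm P x" using f(3) into[OF x] by linarith
  qed
  moreover have "multiplier ell2 P E F \<Theta>"
    unfolding multiplier_def using \<Theta>_bdd into S_in by blast
  moreover have "hilbert_space (ell2 :: (nat \<Rightarrow> complex) hspace)"
    by (simp add: hilbert_space_iff hilbert_ell2)
  moreover have "is_drury_arveson ell2 P" unfolding is_drury_arveson_def using DA P by blast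
  ultimately show ?thesis
    using range unfolding partially_isometric_multiplier_def by blast
qed

end

lemma multiplier_range_iff:
  assumes S: "closed_csubspace F S" and P: "is_drury_arveson L P"
    and \<Theta>: "partially_isometric_multiplier L P E F \<Theta>"
  shows "S = mult_op \<Theta> ` vecs P \<longleftrightarrow>
    (\<forall>x\<in>vecs F. hproj F S x = mult_op \<Theta> (hadj P F (mult_op \<Theta>) x))"
proof (rule F.partial_isometry_range_iff[OF _ _ S])
  show "partial_isometry P F (mult_op \<Theta>)"
    using \<Theta> unfolding partially_isometric_multiplier_def by blast
  show "hilbert P"
    using P unfolding is_drury_arveson_def is_tensor_def hilbert_space_iff by blast
qed

end

theorem theorem4p4:
  fixes K :: "complex ^ 'n::finite \<Rightarrow> complex ^ 'n \<Rightarrow> complex"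
    and HK :: "(complex ^ 'n \<Rightarrow> complex) hspace"
    and Es :: "'b::complex_vector hspace"
    and HKEs :: "(complex ^ 'n \<Rightarrow> 'b) hspace"
    and S :: "(complex ^ 'n \<Rightarrow> 'b) set"
  assumes "analytic_hilbert_space K HK"
    and "hilbert_space Es"
    and "is_tensor HK Es HKEs"
    and "nontrivial_closed_csubspace HKEs S"
  shows
    "(joint_invariant S \<longleftrightarrow>
       (\<exists>(E :: (nat \<Rightarrow> complex) hspace) F \<Theta>.
          hilbert_space E \<and> is_drury_arveson E F \<and>
          partially_isometric_multiplier E F Es HKEs \<Theta> \<and>
          S = mult_op \<Theta> ` vecs F)) \<and>
     (joint_invariant S \<longleftrightarrow>
       (\<exists>(E :: (nat \<Rightarrow> complex) hspace) F \<Theta>.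
          hilbert_space E \<and> is_drury_arveson E F \<and>
          partially_isometric_multiplier E F Es HKEs \<Theta> \<and>
          (\<forall>x\<in>vecs HKEs. hproj HKEs S x = mult_op \<Theta> (hadj F HKEs (mult_op \<Theta>) x)))) \<and>
     (\<forall>(E :: 'e::complex_vector hspace) F \<Theta>.
        hilbert_space E \<and> is_drury_arveson E F \<and>
        partially_isometric_multiplier E F Es HKEs \<Theta> \<longrightarrow>
          (S = mult_op \<Theta> ` vecs F \<longrightarrow> joint_invariant S) \<and>
          (S = mult_op \<Theta> ` vecs F \<longleftrightarrow>
             (\<forall>x\<in>vecs HKEs. hproj HKEs S x = mult_op \<Theta> (hadj F HKEs (mult_op \<Theta>) x))))"
proof -
  have T: "tensor_rkhs K HK Es HKEs"
    using assms(1-3) by (simp add: tensor_rkhs_def analytic_hilbert_space_def hilbert_space_iff)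
  interpret tensor_rkhs K HK Es HKEs by (rule T)
  have con: "contractive"
    by (rule contractive_tensor[OF T analytic_hilbert_space_contractive[OF assms(1)]])
  have S: "closed_csubspace HKEs S"
    using assms(4) unfolding nontrivial_closed_csubspace_def by blast
  note range_iff = multiplier_range_iff[OF S]
  have invariant: "joint_invariant S"
    if "hilbert_space E" "is_drury_arveson E P" "partially_isometric_multiplier E P Es HKEs \<Theta>"
      "S = mult_op \<Theta> ` vecs P" for E :: "(nat \<Rightarrow> complex) hspace" and P \<Theta>
    using mult_op_range_invariant[OF that(1,2)] that(3,4)
    unfolding partially_isometric_multiplier_def by blast
  \<comment> \<open>A fact established inside a proof has fixed types, so the argument is repeated
    for the arbitrary coefficient type of the universal clause; the existential clauses use
    sequences.\<close>
  have invariant': "joint_invariant S"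
    if "hilbert_space E" "is_drury_arveson E P" "partially_isometric_multiplier E P Es HKEs \<Theta>"
      "S = mult_op \<Theta> ` vecs P" for E :: "'e hspace" and P \<Theta>
    using mult_op_range_invariant[OF that(1,2)] that(3,4)
    unfolding partially_isometric_multiplier_def by blast
  show ?thesis
    using ex_multiplier[OF con S] invariant invariant' range_iff by (smt (verit))
qed

end
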